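(* Let $d\ge1$ and let $J=[0,1)^d$, regarded as a $d$-dimensional torus. For $\lambda>0$ and $r>0$ let $\tau\sim\mathrm{Po}(\lambda)$ and, independently of $\tau$, let $(X_i)_{i\ge1}$ be independent and uniformly distributed on $J$. Let $\Phi$ be the point process on $J$ defined by $$\Phi(B)=\sum_{i=1}^{\tau}I[X_i\in B]\,I[X_j\notin K_r(X_i)\text{ for all }j=1,\dots,\tau,\ j\ne i],$$ where $K_r(x)$ is the closed $d$-dimensional cube with center $x$ and side length $r$, and let $\mu$ be its mean measure. Put $W=\Phi(J)-\mu(J)$, $\sigma^2=\mathrm{Var}\,W$, $\delta=\langle-4\sigma^2\rangle$ and $t=\langle-\mu(J)+2\sigma^2+\delta/2\rangle/(4\sigma^2+\delta)$. Let $a>0$ be a fixed real number. Then there are constants $C_1,C_2$, independent of $\lambda$, such that for every $\lambda$ and $r$ with $\lambda r^d=a$ and $\sigma^2>1$, $$d_l\bigl(\mathscr{L}(\Phi(J)-\mu(J)),\widehat{\mathrm{Bi}}(\lceil4\sigma^2\rceil,1/2-t)\bigr)\le C_l\,\lambda^{-l/2},\qquad l=1,2.$$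
   Context: $\langle x\rangle=x-\lfloor x\rfloor$ is the fractional part of $x\in\mathbb{R}$; $I[\cdot]$ is the indicator; $\mathscr{L}(X)$ is the law of $X$; $\mathrm{Po}(\lambda)$ is the Poisson distribution with mean $\lambda$. $\mathrm{Bi}(n,p)$ is the binomial distribution with $n$ trials and success probability $p$; $\widehat{\mathrm{Bi}}(n,p)$ is $\mathrm{Bi}(n,p)$ shifted by $-np$. For probability distributions $P,Q$ on $\mathbb{R}$, $d_1(P,Q)=d_{\mathrm{TV}}(P,Q)=\sup_{A\subset\mathbb{R}}|P(A)-Q(A)|$ (measurable $A$) and $d_2(P,Q)=d_{\mathrm{loc}}(P,Q)=\sup_{x\in\mathbb{R}}|P([x,x+1))-Q([x,x+1))|$. Torus convention: any point outside $J$ is identified with the point of $J$ obtained by coordinate-wise shifting by integers, so $K_r(x)$ is understood as a subset of the torus. The constants may depend on $a$ and $d$. *)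

theory Defs
  imports "HOL-Probability.Probability"
begin

text \<open>
  The dimension d is CARD('n).  The torus is represented by its fundamental domain.
\<close>

definition torus :: "(real ^ 'n) set" where
  "torus = {x. \<forall>i. 0 \<le> x $ i \<and> x $ i < 1}"

text \<open>
  A point outside the fundamental domain is identified with the point of the fundamental domain obtained by
  shifting each coordinate by an integer, i.e. by taking coordinatewise fractional parts.
\<close>

definition to_torus :: "real ^ 'n \<Rightarrow> real ^ 'n" where
  "to_torus y = (\<chi> i. frac (y $ i))"

definition torus_cube :: "real \<Rightarrow> real ^ 'n \<Rightarrow> (real ^ 'n) set" where
  "torus_cube r x = to_torus ` cbox (\<chi> i. x $ i - r / 2) (\<chi> i. x $ i + r / 2)"

text \<open>
  The first \<open>n\<close> points \<open>x 1, \<dots>, x n\<close> are present; only those with no other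
  point in the surrounding cube of side length \<open>r\<close> are counted.
\<close>

definition isolated_count :: "real \<Rightarrow> nat \<Rightarrow> (nat \<Rightarrow> real ^ 'n) \<Rightarrow> (real ^ 'n) set \<Rightarrow> real" where
  "isolated_count r n x B =
     (\<Sum>i = 1..n. of_bool (x i \<in> B) *
        of_bool (\<forall>j \<in> {1..n}. j \<noteq> i \<longrightarrow> x j \<notin> torus_cube r (x i)))"

text \<open>
  On the probability space \<open>M\<close>: \<open>\<tau>\<close> is Poisson with mean \<open>\<lambda>\<close>, the
  \<open>X i\<close> for \<open>i \<ge> 1\<close> are independent and uniform on the torus, and the whole
  sequence is independent of \<open>\<tau>\<close>.  The latter is independence of the generated sigma-algebras,
  since the library's \<open>indep_var\<close> needs both variables to have the same type.  The value \<open>X 0\<close> is never used.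
\<close>

definition poisson_uniform_sample ::
    "'w measure \<Rightarrow> real \<Rightarrow> ('w \<Rightarrow> nat) \<Rightarrow> (nat \<Rightarrow> 'w \<Rightarrow> real ^ 'n) \<Rightarrow> bool" where
  "poisson_uniform_sample M l \<tau> X \<longleftrightarrow>
     prob_space M \<and>
     \<tau> \<in> measurable M (count_space UNIV) \<and>
     distr M (count_space UNIV) \<tau> = measure_pmf (poisson_pmf l) \<and>
     (\<forall>i\<ge>1. X i \<in> borel_measurable M \<and>
             distr M borel (X i) = uniform_measure lborel torus) \<and>
     prob_space.indep_vars M (\<lambda>_. borel) X {1..} \<and>
     prob_space.indep_set M
       (sets (vimage_algebra (space M) \<tau> (count_space UNIV)))
       (sets (vimage_algebra (space M) (\<lambda>\<omega>. \<lambda>i\<in>{1..}. X i \<omega>) (Pi\<^sub>M {1..} (\<lambda>_. borel))))"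

definition mean_measure :: "'w measure \<Rightarrow> ('w \<Rightarrow> 'b set \<Rightarrow> real) \<Rightarrow> 'b set \<Rightarrow> real" where
  "mean_measure M \<Phi> B = prob_space.expectation M (\<lambda>\<omega>. \<Phi> \<omega> B)"

definition centred_binomial :: "nat \<Rightarrow> real \<Rightarrow> real measure" where
  "centred_binomial n p =
     distr (measure_pmf (binomial_pmf n p)) borel (\<lambda>k. real k - real n * p)"

definition d_TV :: "real measure \<Rightarrow> real measure \<Rightarrow> real" where
  "d_TV P Q = (SUP A \<in> sets borel. \<bar>measure P A - measure Q A\<bar>)"

definition d_loc :: "real measure \<Rightarrow> real measure \<Rightarrow> real" where
  "d_loc P Q = (SUP x. \<bar>measure P {x..<x + 1} - measure Q {x..<x + 1}\<bar>)"

end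

theory Submission
  imports Defs
begin

text \<open>
  Cut the torus into cells of side about \<open>r / 2\<close>.  A Poisson sample restricts to independent samples in
  the cells, a cell contains at most one isolated point, and whether it does depends only on boundedly
  many neighbouring cells.  So the number of isolated points, centred, is a sum \<open>W = \<Sum> \<eta> i\<close> of bounded
  variables with bounded dependency neighbourhoods, indexed by \<open>v\<close> cells, where \<open>v\<close> is of order \<open>\<lambda>\<close>.

  Tikhomirov's form of Stein's method is applied to \<open>\<phi> \<theta> = E exp (i \<theta> W)\<close>: removing neighbourhoods twice
  gives \<open>\<phi>' + \<sigma>\<^sup>2 \<theta> \<phi> = O(v \<theta>\<^sup>2 exp (- k v \<theta>\<^sup>2))\<close> on \<open>[-\<pi>, \<pi>]\<close>.  The Gaussian factor comes from a family of
  order \<open>v\<close> of cells with disjoint neighbourhoods: given everything outside these cells, each of them whose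
  neighbours are empty contributes an independent Bernoulli variable.  The same decay of \<open>\<phi>\<close> near \<open>0\<close> shows that
  \<open>\<sigma>\<^sup>2\<close> is at least of order \<open>v\<close>.

  The centred binomial distribution satisfies the same differential equation up to an error of the same
  kind, because its variance is \<open>\<sigma>\<^sup>2 + O(1)\<close>, and it lives on the same lattice.  Solving the equation for the difference
  \<open>D\<close> of the characteristic functions bounds \<open>D\<close> and \<open>D'\<close>; Fourier inversion gives the local bound, and
  Bessel's inequality for \<open>D\<close> and \<open>D'\<close> together with Cauchy-Schwarz gives total variation.
\<close>

section \<open>Locally dependent fields\<close>

text \<open>All constants must be uniform in \<lambda>. For \<open>r \<le> 1\<close> the choice
  \<open>m = \<lceil>2 / r\<rceil>\<close> gives \<open>2 \<le> r * m \<le> 3\<close>: the lower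
  bound makes two points of one cell exclude each other, the upper bound limits the influence of a
  cell to \<open>5 ^ d\<close> cells, and together they keep the mean number of points per cell
  between \<open>a / 3 ^ d\<close> and \<open>a\<close>. For \<open>r > 1\<close> the intensity
  \<lambda> is at most \<open>a\<close>, and the trivial bound 1 on both distances suffices. The
  obstacle is that both distances see single atoms, so the characteristic functions have to be
  controlled on a whole period and not only near 0. Every error term must therefore keep its
  Gaussian factor, even after a neighbourhood has been removed from the sum and a local factor has
  been inserted; this dictates the form of \<open>decay\<close>. The binomial parameters have
  separate tasks: about \<open>4 * \<sigma>\<^sup>2\<close> trials with probability near 1/2 give a
  variance near \<open>\<sigma>\<^sup>2\<close>, \<delta> makes the number of trials an integer, and
  \<open>t\<close> moves the binomial mean by less than 1, onto a point that differs from the mean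
  number of isolated points by an integer.\<close>

definition local_on :: "'i set \<Rightarrow> (('i \<Rightarrow> 'b) \<Rightarrow> 'c) \<Rightarrow> bool" where
  "local_on A f \<longleftrightarrow> (\<forall>x y. (\<forall>i\<in>A. x i = y i) \<longrightarrow> f x = f y)"

lemma local_onD: "local_on A f \<Longrightarrow> (\<And>i. i \<in> A \<Longrightarrow> x i = y i) \<Longrightarrow> f x = f y"
  by (auto simp: local_on_def)

lemma local_on_mono: "local_on A f \<Longrightarrow> A \<subseteq> B \<Longrightarrow> local_on B f"
  unfolding local_on_def by blast

lemma local_on_const: "local_on A (\<lambda>_. c)"
  by (simp add: local_on_def)

lemma local_on_comp: "local_on A f \<Longrightarrow> local_on A (\<lambda>x. g (f x))"
  unfolding local_on_def by metis

lemma local_on_comp2: "local_on A f \<Longrightarrow> local_on A g \<Longrightarrow> local_on A (\<lambda>x. h (f x) (g x))"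
  unfolding local_on_def by metis

lemma local_on_sum: "(\<And>j. j \<in> J \<Longrightarrow> local_on A (f j)) \<Longrightarrow> local_on A (\<lambda>x. \<Sum>j\<in>J. f j x)"
  unfolding local_on_def by (auto intro!: sum.cong)

lemma local_on_prod: "(\<And>j. j \<in> J \<Longrightarrow> local_on A (f j)) \<Longrightarrow> local_on A (\<lambda>x. \<Prod>j\<in>J. f j x)"
  unfolding local_on_def by (auto intro!: prod.cong)

text \<open>Splitting \<open>V\<close> into \<open>V \<inter> A\<close> and \<open>V - A\<close>
  makes \<open>f\<close> a function of the first block and \<open>g\<close> one of the second, so
  Fubini factors the integral. \<open>F\<close> and \<open>G\<close> freeze the other block at a
  fixed point, whose choice is immaterial by locality.\<close>

lemma integral_PiM_mult_local:
  fixes f g :: "('i \<Rightarrow> 'b) \<Rightarrow> 'c::{real_normed_field, banach, second_countable_topology}"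
  assumes prob: "\<And>i. prob_space (M i)" and fin: "finite V"
    and int: "integrable (PiM V M) f" "integrable (PiM V M) g"
      "integrable (PiM V M) (\<lambda>x. f x * g x)"
    and loc: "local_on A f" "local_on B g" and AB: "A \<inter> B = {}"
  shows "(\<integral>x. f x * g x \<partial>PiM V M) = (\<integral>x. f x \<partial>PiM V M) * (\<integral>x. g x \<partial>PiM V M)"
proof -
  interpret product_prob_space M by (rule product_prob_spaceI) (rule prob)
  define I where "I = V \<inter> A"
  define J where "J = V - A"
  have IJ: "I \<inter> J = {}" "finite I" "finite J" and V: "V = I \<union> J"
    using fin by (auto simp: I_def J_def)
  interpret PI: prob_space "PiM I M" by (intro prob_space_PiM prob)
  interpret PJ: prob_space "PiM J M" by (intro prob_space_PiM prob)
  define x0 where "x0 = (SOME x. x \<in> space (PiM I M))"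
  define y0 where "y0 = (SOME x. x \<in> space (PiM J M))"
  define F where "F x = f (merge I J (x, y0))" for x
  define G where "G y = g (merge I J (x0, y))" for y
  have f: "f (merge I J (x, y)) = F x" for x y
    unfolding F_def by (rule local_onD[OF loc(1)]) (use V in \<open>auto simp: merge_def J_def I_def\<close>)
  have g: "g (merge I J (x, y)) = G y" for x y
    unfolding G_def by (rule local_onD[OF loc(2)]) (use V AB in \<open>auto simp: merge_def J_def I_def\<close>)
  have "(\<integral>x. f x * g x \<partial>PiM V M) = (\<integral>x. (\<integral>y. f (merge I J (x, y)) * g (merge I J (x, y)) \<partial>PiM J M) \<partial>PiM I M)"
    unfolding V by (rule product_integral_fold[OF IJ]) (use int(3) V in simp)
  also have "\<dots> = (\<integral>x. F x \<partial>PiM I M) * (\<integral>y. G y \<partial>PiM J M)"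
    by (simp add: f g)
  also have "(\<integral>x. F x \<partial>PiM I M) = (\<integral>x. f x \<partial>PiM V M)"
    unfolding V by (subst product_integral_fold[OF IJ]) (use int(1) V in \<open>simp_all add: f PJ.prob_space\<close>)
  also have "(\<integral>y. G y \<partial>PiM J M) = (\<integral>x. g x \<partial>PiM V M)"
    unfolding V by (subst product_integral_fold[OF IJ]) (use int(2) V in \<open>simp_all add: g PI.prob_space\<close>)
  finally show ?thesis .
qed

section \<open>Elementary estimates for characteristic functions\<close>

text \<open>Source of the constant 12: the fourth-order expansion gives
  \<open>1 - cos x \<ge> x\<^sup>2 / 2 - x ^ 4 / 24\<close>, and \<open>pi\<^sup>2 \<le> 10\<close>
  turns this into \<open>(1/2 - 10/24) * x\<^sup>2\<close>.\<close>

lemma one_minus_cos_ge: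
  assumes "\<bar>x\<bar> \<le> pi"
  shows "x\<^sup>2 / 12 \<le> 1 - cos x"
proof -
  obtain t where t: "cos x = (\<Sum>m<4. cos_coeff m * x ^ m) + (cos (t + 1/2 * real 4 * pi) / fact 4) * x ^ 4"
    using Maclaurin_cos_expansion[of x 4] by blast
  have "(\<Sum>m<4. cos_coeff m * x ^ m) = 1 - x\<^sup>2 / 2"
  proof -
    have "{..<4} = {0, 1, 2, 3::nat}" by auto
    then show ?thesis by (simp add: cos_coeff_def)
  qed
  moreover have "(cos (t + 1/2 * real 4 * pi) / fact 4) * x ^ 4 \<le> 1 / 24 * x ^ 4"
    by (intro mult_right_mono) (auto simp: fact_numeral)
  ultimately have 1: "cos x \<le> 1 - x\<^sup>2 / 2 + x ^ 4 / 24" using t by simp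
  have "x\<^sup>2 \<le> pi\<^sup>2" using assms using power_mono[OF assms, of 2] by simp
  also have "\<dots> \<le> (315/100)\<^sup>2" using pi_approx by (intro power_mono) auto
  also have "\<dots> \<le> 10" by (simp add: power2_eq_square)
  finally have "x\<^sup>2 * x\<^sup>2 \<le> 10 * x\<^sup>2" by (intro mult_right_mono) auto
  moreover have "x\<^sup>2 * x\<^sup>2 = x ^ 4" by (metis mult_2 numeral_Bit0 power_add)
  ultimately have "x ^ 4 \<le> 10 * x\<^sup>2" by simp
  with 1 show ?thesis by simp
qed

text \<open>With \<open>u = q * (1 - q) * (1 - cos \<theta>)\<close> the squared modulus is exactly
  \<open>1 - 2 * u\<close>, which is at most \<open>(1 - u)\<^sup>2\<close>; the root may be taken
  because \<open>u \<le> 1/2\<close>.\<close>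

lemma norm_bernoulli_char_le:
  fixes q \<theta> :: real
  assumes q: "0 \<le> q" "q \<le> 1" and \<theta>: "\<bar>\<theta>\<bar> \<le> pi"
  shows "norm (1 - q + q * iexp \<theta>) \<le> 1 - q * (1 - q) / 12 * \<theta>\<^sup>2"
proof -
  define u where "u = q * (1 - q) * (1 - cos \<theta>)"
  have qq: "q * (1 - q) \<le> 1/4" "0 \<le> q * (1 - q)"
  proof -
    have "q * (1 - q) = 1/4 - (q - 1/2)\<^sup>2" by (simp add: power2_eq_square algebra_simps)
    then show "q * (1 - q) \<le> 1/4" by simp
    show "0 \<le> q * (1 - q)" using q by simp
  qed
  have "q * (1 - q) * (1 - cos \<theta>) \<le> 1/4 * 2"
    by (intro mult_mono) (use qq cos_ge_minus_one[of \<theta>] in auto)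
  then have u: "u \<le> 1/2" by (simp add: u_def)
  have re: "Re (iexp \<theta>) = cos \<theta>" and im: "Im (iexp \<theta>) = sin \<theta>"
    by (auto simp: Re_exp Im_exp)
  have s: "(sin \<theta>)\<^sup>2 = 1 - (cos \<theta>)\<^sup>2" by (simp add: sin_squared_eq)
  have "(norm (1 - q + q * iexp \<theta>))\<^sup>2 = (1 - q + q * cos \<theta>)\<^sup>2 + q\<^sup>2 * (sin \<theta>)\<^sup>2"
    unfolding cmod_power2 using re im by (simp add: power_mult_distrib)
  also have "\<dots> = 1 - 2 * u"
    unfolding s u_def by (simp add: power2_eq_square algebra_simps)
  also have "\<dots> \<le> (1 - 2 * u) + u\<^sup>2" by simp
  also have "\<dots> = (1 - u)\<^sup>2" by (simp add: power2_eq_square algebra_simps)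
  finally have n: "(norm (1 - q + q * iexp \<theta>))\<^sup>2 \<le> (1 - u)\<^sup>2" .
  have "norm (1 - q + q * iexp \<theta>) \<le> 1 - u"
    by (rule power2_le_imp_le[OF n]) (use u in linarith)
  moreover have "q * (1 - q) * (\<theta>\<^sup>2 / 12) \<le> u"
    unfolding u_def by (intro mult_left_mono one_minus_cos_ge \<theta> qq)
  ultimately show ?thesis by simp
qed

lemma card_UN_le_mult:
  assumes "finite A" "\<And>i. i \<in> A \<Longrightarrow> card (f i) \<le> k"
  shows "card (\<Union>i\<in>A. f i) \<le> k * card A"
proof -
  have "card (\<Union>i\<in>A. f i) \<le> (\<Sum>i\<in>A. card (f i))" by (rule card_UN_le[OF assms(1)])
  also have "\<dots> \<le> (\<Sum>i\<in>A. k)" by (intro sum_mono assms(2))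
  finally show ?thesis by (simp add: mult.commute)
qed

lemma norm_iexp_diff1: "norm (iexp x - 1) \<le> \<bar>x\<bar>"
  using iexp_approx1[of x 0] by simp

lemma norm_iexp_diff2: "norm (iexp x - 1 - \<i> * x) \<le> x\<^sup>2 / 2"
  using iexp_approx1[of x 1] by (simp add: eval_nat_numeral diff_diff_eq)

text \<open>
  The configuration in cell \<open>i\<close> is the \<open>i\<close>-th coordinate; \<open>void\<close> says that it has no point, \<open>single\<close> that it
  has exactly one, and \<open>nb i\<close> is the set of cells on which the bounded variable \<open>\<xi> i\<close> depends.
\<close>

locale dependency_field =
  fixes V :: "'i set" and M :: "'i \<Rightarrow> 'b measure" and nb :: "'i \<Rightarrow> 'i set" and K :: nat
    and \<xi> :: "'i \<Rightarrow> ('i \<Rightarrow> 'b) \<Rightarrow> real" and void single :: "'b \<Rightarrow> bool" and p0 q :: real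
  assumes prob: "\<And>i. prob_space (M i)"
    and fin: "finite V"
    and nb_refl: "i \<in> V \<Longrightarrow> i \<in> nb i"
    and nb_sub: "i \<in> V \<Longrightarrow> nb i \<subseteq> V"
    and nb_sym: "i \<in> V \<Longrightarrow> j \<in> nb i \<Longrightarrow> i \<in> nb j"
    and nb_card: "i \<in> V \<Longrightarrow> card (nb i) \<le> K"
    and meas [measurable]: "i \<in> V \<Longrightarrow> \<xi> i \<in> borel_measurable (PiM V M)"
    and range: "0 \<le> \<xi> i x" "\<xi> i x \<le> 1"
    and loc: "i \<in> V \<Longrightarrow> local_on (nb i) (\<xi> i)"
    and void_zero: "i \<in> V \<Longrightarrow> void (x i) \<Longrightarrow> \<xi> i x = 0"
    and surrounded: "i \<in> V \<Longrightarrow> (\<And>j. j \<in> nb i - {i} \<Longrightarrow> void (x j)) \<Longrightarrow> \<xi> i x = of_bool (single (x i))"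
    and pred_void [measurable]: "i \<in> V \<Longrightarrow> Measurable.pred (M i) void"
    and pred_single [measurable]: "i \<in> V \<Longrightarrow> Measurable.pred (M i) single"
    and K_pos: "0 < K"
    and p0: "0 \<le> p0" "i \<in> V \<Longrightarrow> p0 \<le> measure (M i) {x \<in> space (M i). void x}"
    and q: "i \<in> V \<Longrightarrow> measure (M i) {x \<in> space (M i). single x} = q"
begin

section \<open>Gaussian decay by conditioning on all but a separated family of cells\<close>

sublocale product_prob_space M V by (rule product_prob_spaceI) (rule prob)

lemma integrable_bounded:
  fixes f :: "('i \<Rightarrow> 'b) \<Rightarrow> 'c :: {banach, second_countable_topology}"
  assumes "f \<in> borel_measurable (PiM V M)" "\<And>x. norm (f x) \<le> B"
  shows "integrable (PiM V M) f"
  using assms by (intro P.integrable_const_bound[of _ B]) auto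

lemma p0_le_1: "i \<in> V \<Longrightarrow> p0 \<le> 1"
  using p0(2)[of i] by (meson order_trans prob prob_space.prob_le_1)

lemma q_range: "V \<noteq> {} \<Longrightarrow> 0 \<le> q" "V \<noteq> {} \<Longrightarrow> q \<le> 1"
  using q by (metis all_not_in_conv measure_nonneg, metis all_not_in_conv prob prob_space.prob_le_1)

text \<open>Bounds the characteristic function of the contribution of cell \<open>b\<close>, given all other cells.\<close>

definition damp :: "real \<Rightarrow> 'i \<Rightarrow> ('i \<Rightarrow> 'b) \<Rightarrow> real" where
  "damp \<rho> b x = (if \<forall>j\<in>nb b - {b}. void (x j) then \<rho> else 1)"

lemma damp_local: "local_on (nb b - {b}) (damp \<rho> b)"
  unfolding local_on_def damp_def by metis

lemma finite_nb: "i \<in> V \<Longrightarrow> finite (nb i)"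
  using nb_sub fin finite_subset by blast

lemma damp_measurable [measurable]:
  assumes b: "b \<in> V" shows "damp \<rho> b \<in> borel_measurable (PiM V M)"
proof -
  have [measurable]: "(\<lambda>x. of_bool (void (x j)) :: real) \<in> borel_measurable (PiM V M)" if "j \<in> nb b - {b}" for j
  proof -
    have "j \<in> V" using nb_sub[OF b] that by auto
    then show ?thesis by measurable
  qed
  have "damp \<rho> b = (\<lambda>x. 1 - (1 - \<rho>) * (\<Prod>j\<in>nb b - {b}. of_bool (void (x j))))"
    using finite_nb[OF b] by (auto simp: damp_def fun_eq_iff)
  also have "\<dots> \<in> borel_measurable (PiM V M)"
    by (intro borel_measurable_diff borel_measurable_times borel_measurable_const borel_measurable_prod) auto
  finally show ?thesis .
qed

text \<open>\<open>1 - damp \<rho> b\<close> is \<open>1 - \<rho>\<close> times the indicator that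
  all other cells of \<open>nb b\<close> are void. By independence this event has probability at
  least \<open>p0 ^ card A\<close>, and \<open>p0 \<le> 1\<close> replaces the exponent by
  \<open>K\<close>.\<close>

lemma integral_damp_le:
  assumes b: "b \<in> V" and \<rho>: "0 \<le> \<rho>" "\<rho> \<le> 1"
  shows "(\<integral>x. damp \<rho> b x \<partial>PiM V M) \<le> 1 - (1 - \<rho>) * p0 ^ K"
proof -
  define A where "A = nb b - {b}"
  have A: "A \<subseteq> V" "card A \<le> K"
    using nb_sub[OF b] nb_card[OF b] card_Diff1_le[of "nb b" b] by (auto simp: A_def)
  define f :: "'i \<Rightarrow> 'b \<Rightarrow> real" where "f j y = (if j \<in> A then of_bool (void y) else 1)" for j y
  have fi: "integrable (M j) (f j)" if "j \<in> V" for j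
    unfolding f_def using that by (intro M.integrable_const_bound[of _ 1]) auto
  have fint: "integral\<^sup>L (M j) (f j) = (if j \<in> A then measure (M j) {x \<in> space (M j). void x} else 1)"
    if "j \<in> V" for j
  proof -
    have "(\<integral>y. of_bool (void y) \<partial>M j) = (\<integral>y. indicator {x \<in> space (M j). void x} y \<partial>M j :: real)"
      by (intro Bochner_Integration.integral_cong) (auto simp: indicator_def)
    also have "\<dots> = measure (M j) {x \<in> space (M j). void x}"
      using that by simp
    finally show ?thesis by (auto simp: f_def[abs_def] M.prob_space)
  qed
  have eq: "damp \<rho> b x = 1 - (1 - \<rho>) * (\<Prod>j\<in>V. f j (x j))" for x
  proof (cases "\<forall>j\<in>A. void (x j)")
    case True
    then have "(\<Prod>j\<in>V. f j (x j)) = 1" by (intro prod.neutral) (auto simp: f_def)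
    with True show ?thesis by (simp add: damp_def A_def)
  next
    case False
    then obtain j where "j \<in> A" "\<not> void (x j)" by auto
    then have "(\<Prod>j\<in>V. f j (x j)) = 0"
      using A fin by (intro prod_zero) (auto simp: f_def)
    with False show ?thesis by (auto simp add: damp_def A_def)
  qed
  have "p0 ^ K \<le> p0 ^ card A"
    using A(2) p0(1) p0_le_1[OF b] by (intro power_decreasing) auto
  also have "\<dots> = (\<Prod>j\<in>A. p0)" by simp
  also have "\<dots> \<le> (\<Prod>j\<in>A. measure (M j) {x \<in> space (M j). void x})"
    using A p0 by (intro prod_mono) auto
  also have "\<dots> = (\<Prod>j\<in>V. if j \<in> A then measure (M j) {x \<in> space (M j). void x} else 1)"
    using A fin by (simp add: prod.If_cases Int_absorb1)
  also have "\<dots> = (\<integral>x. (\<Prod>j\<in>V. f j (x j)) \<partial>PiM V M)"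
    by (subst product_integral_prod) (use fin fi fint in auto)
  finally have "(1 - \<rho>) * p0 ^ K \<le> (1 - \<rho>) * (\<integral>x. (\<Prod>j\<in>V. f j (x j)) \<partial>PiM V M)"
    using \<rho> by (intro mult_left_mono) auto
  moreover have "integrable (PiM V M) (\<lambda>x. \<Prod>j\<in>V. f j (x j))"
    using fin fi by (intro product_integrable_prod) auto
  ultimately show ?thesis by (simp add: eq P.prob_space)
qed

text \<open>Disjoint neighbourhoods make the factors \<open>damp \<rho> b\<close> independent, so
  the bound for one cell multiplies up by induction on \<open>J\<close>.\<close>

lemma integral_prod_damp_le:
  assumes "finite J" "J \<subseteq> V" "pairwise (\<lambda>i j. nb i \<inter> nb j = {}) J" and \<rho>: "0 \<le> \<rho>" "\<rho> \<le> 1"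
  shows "(\<integral>x. (\<Prod>b\<in>J. damp \<rho> b x) \<partial>PiM V M) \<le> (1 - (1 - \<rho>) * p0 ^ K) ^ card J"
  using assms(1-3)
proof (induction J rule: finite_induct)
  case empty
  then show ?case by (simp add: P.prob_space)
next
  case (insert b J)
  have bV: "b \<in> V" and JV: "J \<subseteq> V" using insert.prems by auto
  have d01: "0 \<le> damp \<rho> c x" "damp \<rho> c x \<le> 1" for c x using \<rho> by (auto simp: damp_def)
  have p01: "0 \<le> (\<Prod>b\<in>J. damp \<rho> b x)" "(\<Prod>b\<in>J. damp \<rho> b x) \<le> 1" for x
    using d01 by (auto intro!: prod_nonneg prod_le_1)
  have [measurable]: "damp \<rho> c \<in> borel_measurable (PiM V M)" if "c \<in> insert b J" for c
    using that bV JV by (intro damp_measurable) auto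
  have "(\<integral>x. (\<Prod>b\<in>insert b J. damp \<rho> b x) \<partial>PiM V M) = (\<integral>x. damp \<rho> b x * (\<Prod>b\<in>J. damp \<rho> b x) \<partial>PiM V M)"
    using insert.hyps by simp
  also have "\<dots> = (\<integral>x. damp \<rho> b x \<partial>PiM V M) * (\<integral>x. (\<Prod>b\<in>J. damp \<rho> b x) \<partial>PiM V M)"
  proof (rule integral_PiM_mult_local[OF prob fin, where A = "nb b" and B = "\<Union>c\<in>J. nb c"])
    show "integrable (PiM V M) (damp \<rho> b)"
      by (rule integrable_bounded[of _ 1]) (use d01 in auto)
    show "integrable (PiM V M) (\<lambda>x. \<Prod>b\<in>J. damp \<rho> b x)"
      by (rule integrable_bounded[of _ 1]) (use p01 in auto)
    show "integrable (PiM V M) (\<lambda>x. damp \<rho> b x * (\<Prod>b\<in>J. damp \<rho> b x))"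
      by (rule integrable_bounded[of _ 1]) (use p01 d01 in \<open>auto simp: abs_mult intro!: mult_le_one\<close>)
    show "local_on (nb b) (damp \<rho> b)" using damp_local by (rule local_on_mono) auto
    show "local_on (\<Union>c\<in>J. nb c) (\<lambda>x. \<Prod>b\<in>J. damp \<rho> b x)"
      by (intro local_on_prod local_on_mono[OF damp_local]) auto
    show "nb b \<inter> (\<Union>c\<in>J. nb c) = {}"
      using insert.prems(2) insert.hyps(2) by (auto simp: pairwise_insert)
  qed
  also have "\<dots> \<le> (1 - (1 - \<rho>) * p0 ^ K) * (1 - (1 - \<rho>) * p0 ^ K) ^ card J"
  proof (intro mult_mono)
    show "(\<integral>x. damp \<rho> b x \<partial>PiM V M) \<le> 1 - (1 - \<rho>) * p0 ^ K" by (rule integral_damp_le[OF bV \<rho>])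
    show "(\<integral>x. (\<Prod>b\<in>J. damp \<rho> b x) \<partial>PiM V M) \<le> (1 - (1 - \<rho>) * p0 ^ K) ^ card J"
      using insert by (auto simp: pairwise_insert)
    have "(1 - \<rho>) * p0 ^ K \<le> 1 * 1"
      using \<rho> p0(1) p0_le_1[OF bV] by (intro mult_mono power_le_one) auto
    then show "0 \<le> 1 - (1 - \<rho>) * p0 ^ K" by simp
    show "0 \<le> (\<integral>x. (\<Prod>b\<in>J. damp \<rho> b x) \<partial>PiM V M)" using p01 by simp
  qed
  also have "\<dots> = (1 - (1 - \<rho>) * p0 ^ K) ^ card (insert b J)"
    using insert.hyps by simp
  finally show ?case .
qed

text \<open>Fix all cells outside \<open>J\<close>. Since the neighbourhoods of \<open>J\<close> are
  disjoint, the sum becomes a constant plus one function of each coordinate \<open>x b\<close>, and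
  the inner integral is a product over \<open>J\<close>. A factor whose surroundings are void is a
  Bernoulli characteristic function; the other factors are bounded by 1. \<open>G\<close> is
  constant in the inner integral because \<open>U\<close> misses \<open>J\<close>.\<close>

lemma decay:
  fixes G :: "('i \<Rightarrow> 'b) \<Rightarrow> complex" and \<theta> :: real
  assumes W: "W \<subseteq> V" and J: "J \<subseteq> W" and disj: "pairwise (\<lambda>i j. nb i \<inter> nb j = {}) J"
    and G [measurable]: "G \<in> borel_measurable (PiM V M)" and GB: "\<And>x. norm (G x) \<le> B"
    and GU: "local_on U G" and U: "\<And>b. b \<in> J \<Longrightarrow> nb b \<inter> U = {}" and \<theta>: "\<bar>\<theta>\<bar> \<le> pi"
  shows "norm (\<integral>x. G x * iexp (\<theta> * (\<Sum>i\<in>W. \<xi> i x)) \<partial>PiM V M)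
    \<le> B * exp (- (p0 ^ K * (q * (1 - q)) / 12) * \<theta>\<^sup>2 * card J)"
proof (cases "V = {}")
  case True
  then have J: "J = {}" using J W by auto
  have "norm (\<integral>x. G x * iexp (\<theta> * (\<Sum>i\<in>W. \<xi> i x)) \<partial>PiM V M)
      \<le> (\<integral>x. norm (G x * iexp (\<theta> * (\<Sum>i\<in>W. \<xi> i x))) \<partial>PiM V M)"
    by (rule integral_norm_bound)
  also have "\<dots> \<le> (\<integral>x. B \<partial>PiM V M)"
    by (rule integral_mono') (use GB order.trans[OF norm_ge_zero GB] in \<open>auto simp: norm_mult\<close>)
  finally show ?thesis by (simp add: J P.prob_space)
next
  case False
  define \<rho> where "\<rho> = norm (1 - q + q * iexp \<theta>)"
  have B0: "0 \<le> B" using GB order.trans[OF norm_ge_zero] by blast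
  have q01: "0 \<le> q" "q \<le> 1" using q_range False by auto
  have \<rho>: "0 \<le> \<rho>" "\<rho> \<le> 1 - q * (1 - q) / 12 * \<theta>\<^sup>2" "\<rho> \<le> 1"
    using norm_bernoulli_char_le[OF q01 \<theta>] q01 by (auto simp: \<rho>_def intro: order.trans)
  have JV: "J \<subseteq> V" using J W by auto
  define I where "I = V - J"
  have IJ: "I \<inter> J = {}" "finite I" "finite J" and V: "V = I \<union> J"
    using fin JV by (auto simp: I_def finite_subset)
  interpret PI: prob_space "PiM I M" by (intro prob_space_PiM prob)
  interpret PJ: prob_space "PiM J M" by (intro prob_space_PiM prob)
  define x0 where "x0 = (SOME x. x \<in> space (PiM J M))"
  have x0: "x0 \<in> space (PiM J M)"
    unfolding x0_def using PJ.not_empty[folded ex_in_conv] by (rule someI_ex)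
  define \<Phi> where "\<Phi> y = merge I J (y, x0)" for y
  have \<Phi>m [measurable]: "\<Phi> \<in> measurable (PiM I M) (PiM V M)"
    unfolding \<Phi>_def V by (rule measurable_compose[OF measurable_Pair2'[OF x0] measurable_merge])
  have off: "f (merge I J (y, x)) = f (\<Phi> y)" if "local_on A f" "A \<inter> J = {}"
    for f :: "('i \<Rightarrow> 'b) \<Rightarrow> 'z" and A x y
    unfolding \<Phi>_def by (rule local_onD[OF that(1)]) (use that(2) in \<open>auto simp: merge_def\<close>)
  \<comment> \<open>A cell near \<open>b\<close> sees no other element of \<open>J\<close>: by
    symmetry it would lie in two of the disjoint neighbourhoods.\<close>
  have nbJ: "(nb i) \<inter> J \<subseteq> {b}" if "i \<in> nb b" "b \<in> J" for i b
  proof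
    fix c assume c: "c \<in> nb i \<inter> J"
    have iV: "i \<in> V" using nb_sub that JV by auto
    have "i \<in> nb c" using nb_sym[OF iV, of c] c by auto
    then show "c \<in> {b}" using that disj c by (auto simp: pairwise_def)
  qed
  have nbJ': "nb b \<inter> J = {b}" if "b \<in> J" for b
    using nbJ[of b b] nb_refl[of b] that JV by auto
  define H where "H x = G x * iexp (\<theta> * (\<Sum>i\<in>W. \<xi> i x))" for x
  have Hm [measurable]: "H \<in> borel_measurable (PiM V M)"
  proof -
    have [measurable]: "(\<lambda>x. \<Sum>i\<in>W. \<xi> i x) \<in> borel_measurable (PiM V M)"
      using W by (intro borel_measurable_sum meas) auto
    show ?thesis unfolding H_def by measurable
  qed
  have HB: "norm (H x) \<le> B" for x using GB by (simp add: H_def norm_mult)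
  have inner: "norm (\<integral>x. H (merge I J (y, x)) \<partial>PiM J M) \<le> B * (\<Prod>b\<in>J. damp \<rho> b (\<Phi> y))"
    if y: "y \<in> space (PiM I M)" for y
  proof -
    have \<Phi>y: "\<Phi> y \<in> space (PiM V M)" using measurable_space[OF \<Phi>m y] .
    \<comment> \<open>\<open>R\<close> collects the cells near no element of \<open>J\<close>;
      \<open>h b\<close> collects those near \<open>b\<close>, as a function of coordinate
      \<open>b\<close> alone with all other coordinates taken from \<open>\<Phi> y\<close>.\<close>
    define R where "R = (\<Sum>i\<in>W - (\<Union>b\<in>J. nb b). \<xi> i (\<Phi> y))"
    define h where "h b t = (\<Sum>i\<in>W \<inter> nb b. \<xi> i ((\<Phi> y)(b := t)))" for b t
    have hm [measurable]: "h b \<in> borel_measurable (M b)" if b: "b \<in> J" for b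
    proof -
      have [measurable]: "(\<lambda>t. (\<Phi> y)(b := t)) \<in> measurable (M b) (PiM V M)"
      proof (rule measurable_PiM_single')
        show "(\<lambda>t. ((\<Phi> y)(b := t)) i) \<in> measurable (M b) (M i)" if "i \<in> V" for i
          using that \<Phi>y by (cases "i = b") (auto simp: space_PiM PiE_iff)
        show "(\<lambda>t. (\<Phi> y)(b := t)) \<in> space (M b) \<rightarrow> (\<Pi>\<^sub>E i\<in>V. space (M i))"
          using b JV \<Phi>y by (auto simp: space_PiM PiE_iff extensional_def)
      qed
      show ?thesis unfolding h_def using W
        by (intro borel_measurable_sum measurable_compose[OF _ meas]) auto
    qed
    have split: "(\<Sum>i\<in>W. \<xi> i (merge I J (y, x))) = R + (\<Sum>b\<in>J. h b (x b))" for x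
    proof -
      have "(\<Sum>i\<in>W. \<xi> i (merge I J (y, x))) =
          (\<Sum>i\<in>W - (\<Union>b\<in>J. nb b). \<xi> i (merge I J (y, x))) + (\<Sum>i\<in>(\<Union>b\<in>J. W \<inter> nb b). \<xi> i (merge I J (y, x)))"
        using finite_subset[OF W fin]
        by (subst sum.union_disjoint[symmetric]) (auto intro!: sum.cong)
      also have "(\<Sum>i\<in>W - (\<Union>b\<in>J. nb b). \<xi> i (merge I J (y, x))) = R"
        unfolding R_def
      proof (rule sum.cong[OF refl])
        fix i assume i: "i \<in> W - (\<Union>b\<in>J. nb b)"
        then have "i \<in> V" using W by auto
        moreover have "nb i \<inter> J = {}" using i nb_sym[OF \<open>i \<in> V\<close>] by auto
        ultimately show "\<xi> i (merge I J (y, x)) = \<xi> i (\<Phi> y)" using loc by (intro off)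
      qed
      also have "(\<Sum>i\<in>(\<Union>b\<in>J. W \<inter> nb b). \<xi> i (merge I J (y, x))) = (\<Sum>b\<in>J. \<Sum>i\<in>W \<inter> nb b. \<xi> i (merge I J (y, x)))"
        using IJ finite_subset[OF W fin] disj by (intro sum.UNION_disjoint) (auto simp: pairwise_def)
      also have "\<dots> = (\<Sum>b\<in>J. h b (x b))"
        unfolding h_def
      proof (intro sum.cong refl)
        fix b i assume b: "b \<in> J" and i: "i \<in> W \<inter> nb b"
        have "local_on (nb i) (\<xi> i)" using loc W i by auto
        then show "\<xi> i (merge I J (y, x)) = \<xi> i ((\<Phi> y)(b := x b))"
          by (rule local_onD) (use nbJ[of i b] b i IJ in \<open>auto simp: \<Phi>_def merge_def\<close>)
      qed
      finally show ?thesis .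
    qed
    have GJ: "G (merge I J (y, x)) = G (\<Phi> y)" for x
    proof (rule off[OF GU])
      show "U \<inter> J = {}" using U nb_refl JV by blast
    qed
    have Heq: "H (merge I J (y, x)) = G (\<Phi> y) * iexp (\<theta> * R) * (\<Prod>b\<in>J. iexp (\<theta> * h b (x b)))" for x
      unfolding H_def split GJ
      by (simp add: ring_distribs sum_distrib_left exp_add exp_sum IJ)
    have int: "integrable (M b) (\<lambda>t. iexp (\<theta> * h b t))" if "b \<in> J" for b
      by (rule M.integrable_const_bound[of _ 1]) (use that in auto)
    have "(\<integral>x. H (merge I J (y, x)) \<partial>PiM J M) =
        G (\<Phi> y) * iexp (\<theta> * R) * (\<Prod>b\<in>J. \<integral>t. iexp (\<theta> * h b t) \<partial>M b)"
      unfolding Heq integral_mult_right_zero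
      by (subst product_integral_prod[OF IJ(3), of "\<lambda>b t. iexp (\<theta> * h b t)"]) (use int in simp_all)
    then have "norm (\<integral>x. H (merge I J (y, x)) \<partial>PiM J M) =
        norm (G (\<Phi> y)) * (\<Prod>b\<in>J. norm (\<integral>t. iexp (\<theta> * h b t) \<partial>M b))"
      by (simp add: norm_mult prod_norm)
    also have "\<dots> \<le> B * (\<Prod>b\<in>J. damp \<rho> b (\<Phi> y))"
    proof (intro mult_mono GB prod_mono conjI norm_ge_zero B0 prod_nonneg)
      fix b assume b: "b \<in> J"
      show "norm (\<integral>t. iexp (\<theta> * h b t) \<partial>M b) \<le> damp \<rho> b (\<Phi> y)"
      proof (cases "\<forall>j\<in>nb b - {b}. void (\<Phi> y j)")
        case True
        have bW: "b \<in> W" "b \<in> V" using b J JV by auto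
        \<comment> \<open>Void surroundings make every summand \<open>i \<noteq> b\<close> near
          \<open>b\<close> vanish by \<open>void_zero\<close>, whatever \<open>t\<close> is, and
          \<open>surrounded\<close> evaluates the remaining summand.\<close>
        have "h b t = of_bool (single t)" for t
        proof -
          have "h b t = (\<Sum>i\<in>W \<inter> nb b. if i = b then of_bool (single t) else 0)"
            unfolding h_def
          proof (rule sum.cong[OF refl])
            fix i assume i: "i \<in> W \<inter> nb b"
            show "\<xi> i ((\<Phi> y)(b := t)) = (if i = b then of_bool (single t) else 0)"
            proof (cases "i = b")
              case True
              then show ?thesis
                using surrounded[of b "(\<Phi> y)(b := t)"] bW \<open>\<forall>j\<in>nb b - {b}. void (\<Phi> y j)\<close> by auto
            next
              case False
              then show ?thesis
                using void_zero[of i "(\<Phi> y)(b := t)"] i W \<open>\<forall>j\<in>nb b - {b}. void (\<Phi> y j)\<close> by auto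
            qed
          qed
          also have "\<dots> = of_bool (single t)"
            using bW nb_refl[of b] finite_nb[of b] by (simp add: sum.delta)
          finally show ?thesis .
        qed
        then have "(\<integral>t. iexp (\<theta> * h b t) \<partial>M b) =
            (\<integral>t. 1 + (iexp \<theta> - 1) * complex_of_real (indicator {t \<in> space (M b). single t} t) \<partial>M b)"
          by (intro Bochner_Integration.integral_cong) (auto simp: indicator_def)
        also have "\<dots> = 1 + (iexp \<theta> - 1) * q"
        proof -
          have [measurable]: "{t \<in> space (M b). single t} \<in> sets (M b)"
            using pred_single[OF bW(2)] by measurable
          have "integrable (M b) (\<lambda>t. complex_of_real (indicator {t \<in> space (M b). single t} t))"
            by (rule M.integrable_const_bound[of _ 1]) (auto simp: indicator_def)
          then show ?thesis using q[OF bW(2)] by (simp add: M.prob_space)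
        qed
        also have "\<dots> = 1 - q + q * iexp \<theta>" by (simp add: algebra_simps)
        finally show ?thesis using True by (simp add: damp_def \<rho>_def)
      next
        case False
        have "norm (\<integral>t. iexp (\<theta> * h b t) \<partial>M b) \<le> (\<integral>t. norm (iexp (\<theta> * h b t)) \<partial>M b)"
          by (rule integral_norm_bound)
        also have "\<dots> = 1" by (simp add: M.prob_space)
        finally show ?thesis using False by (auto simp: damp_def)
      qed
    qed
    finally show ?thesis .
  qed
  \<comment> \<open>\<open>damp \<rho> b\<close> ignores \<open>b\<close> itself and sees no other
    element of \<open>J\<close>, so the integral over the outer cells can be replaced by the one
    over all cells.\<close>
  have dJ: "(\<Prod>b\<in>J. damp \<rho> b (merge I J (y, x))) = (\<Prod>b\<in>J. damp \<rho> b (\<Phi> y))" for x y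
    by (intro prod.cong refl off[OF damp_local]) (use nbJ' in auto)
  have d01: "0 \<le> (\<Prod>b\<in>J. damp \<rho> b x)" "(\<Prod>b\<in>J. damp \<rho> b x) \<le> 1" for x
    using \<rho> by (auto intro!: prod_nonneg prod_le_1 simp: damp_def)
  have dm [measurable]: "(\<lambda>x. \<Prod>b\<in>J. damp \<rho> b x) \<in> borel_measurable (PiM V M)"
    using JV by (intro borel_measurable_prod damp_measurable) auto
  have iH: "integrable (PiM V M) H" by (rule integrable_bounded) (auto intro: HB)
  have id: "integrable (PiM V M) (\<lambda>x. \<Prod>b\<in>J. damp \<rho> b x)"
    by (rule integrable_bounded[of _ 1]) (use d01 in auto)
  have "(\<integral>x. H x \<partial>PiM V M) = (\<integral>y. (\<integral>x. H (merge I J (y, x)) \<partial>PiM J M) \<partial>PiM I M)"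
    unfolding V by (rule product_integral_fold[OF IJ]) (use iH V in simp)
  then have "norm (\<integral>x. H x \<partial>PiM V M) \<le> (\<integral>y. norm (\<integral>x. H (merge I J (y, x)) \<partial>PiM J M) \<partial>PiM I M)"
    using integral_norm_bound by metis
  also have "\<dots> \<le> (\<integral>y. B * (\<Prod>b\<in>J. damp \<rho> b (\<Phi> y)) \<partial>PiM I M)"
  proof (rule integral_mono')
    show "integrable (PiM I M) (\<lambda>y. B * (\<Prod>b\<in>J. damp \<rho> b (\<Phi> y)))"
    proof (rule PI.integrable_const_bound[of _ B])
      show "AE y in PiM I M. norm (B * (\<Prod>b\<in>J. damp \<rho> b (\<Phi> y))) \<le> B"
        using B0 d01 by (auto simp: abs_mult intro!: mult_left_le)
      show "(\<lambda>y. B * (\<Prod>b\<in>J. damp \<rho> b (\<Phi> y))) \<in> borel_measurable (PiM I M)"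
        using measurable_compose[OF \<Phi>m dm] by measurable
    qed
  qed (use inner B0 d01 in auto)
  also have "\<dots> = B * (\<integral>y. (\<Prod>b\<in>J. damp \<rho> b (\<Phi> y)) \<partial>PiM I M)" by simp
  also have "(\<integral>y. (\<Prod>b\<in>J. damp \<rho> b (\<Phi> y)) \<partial>PiM I M) = (\<integral>x. (\<Prod>b\<in>J. damp \<rho> b x) \<partial>PiM V M)"
    unfolding V by (subst product_integral_fold[OF IJ]) (use id V in \<open>simp_all add: dJ PJ.prob_space\<close>)
  also have "B * \<dots> \<le> B * (1 - (1 - \<rho>) * p0 ^ K) ^ card J"
    using integral_prod_damp_le[OF IJ(3) JV disj \<rho>(1,3)] B0 by (intro mult_left_mono) auto
  also have "(1 - (1 - \<rho>) * p0 ^ K) ^ card J \<le> exp (- (p0 ^ K * (q * (1 - q)) / 12) * \<theta>\<^sup>2) ^ card J"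
  proof (rule power_mono)
    have "(q * (1 - q) / 12 * \<theta>\<^sup>2) * p0 ^ K \<le> (1 - \<rho>) * p0 ^ K"
      using \<rho> p0(1) by (intro mult_right_mono) auto
    then have "1 - (1 - \<rho>) * p0 ^ K \<le> 1 + (- (p0 ^ K * (q * (1 - q)) / 12) * \<theta>\<^sup>2)"
      by (simp add: algebra_simps)
    also have "\<dots> \<le> exp (- (p0 ^ K * (q * (1 - q)) / 12) * \<theta>\<^sup>2)" by (rule exp_ge_add_one_self)
    finally show "1 - (1 - \<rho>) * p0 ^ K \<le> exp (- (p0 ^ K * (q * (1 - q)) / 12) * \<theta>\<^sup>2)" .
    obtain i where i: "i \<in> V" using False by auto
    have "(1 - \<rho>) * p0 ^ K \<le> 1 * 1"
      using \<rho> p0(1) p0_le_1[OF i] by (intro mult_mono power_le_one) auto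
    then show "0 \<le> 1 - (1 - \<rho>) * p0 ^ K" by simp
  qed
  also have "exp (- (p0 ^ K * (q * (1 - q)) / 12) * \<theta>\<^sup>2) ^ card J = exp (- (p0 ^ K * (q * (1 - q)) / 12) * \<theta>\<^sup>2 * card J)"
    by (simp add: exp_of_nat_mult[symmetric] mult_ac)
  finally show ?thesis using B0 by (simp add: H_def mult_left_mono)
qed

section \<open>Neighbourhoods of sets of cells and separated families\<close>

definition nbs :: "'i set \<Rightarrow> 'i set" where "nbs A = (\<Union>i\<in>A. nb i)"

lemma nbs_sub: "A \<subseteq> V \<Longrightarrow> nbs A \<subseteq> V"
  using nb_sub by (auto simp: nbs_def)

lemma sub_nbs: "A \<subseteq> V \<Longrightarrow> A \<subseteq> nbs A"
  using nb_refl by (auto simp: nbs_def)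

lemma nbs_mono: "A \<subseteq> B \<Longrightarrow> nbs A \<subseteq> nbs B"
  by (auto simp: nbs_def)

lemma card_nbs: "A \<subseteq> V \<Longrightarrow> card (nbs A) \<le> K * card A"
  unfolding nbs_def using fin nb_card by (intro card_UN_le_mult) (auto intro: finite_subset)

text \<open>By symmetry of \<open>nb\<close>. It makes a function local on \<open>A\<close>
  independent of the sum over \<open>V - nbs A\<close>, because that sum is local on
  \<open>nbs (V - nbs A)\<close>.\<close>

lemma nbs_disjoint: "A \<subseteq> V \<Longrightarrow> A \<inter> nbs (V - nbs A) = {}"
  using nb_sym by (auto simp: nbs_def)

text \<open>Take \<open>J\<close> maximal. Every element of \<open>S\<close> then shares a neighbour
  with some element of \<open>J\<close>, hence lies in \<open>nbs (nbs J)\<close>, which has at most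
  \<open>K\<^sup>2 * card J\<close> elements.\<close>

lemma exists_separated:
  assumes S: "S \<subseteq> V"
  shows "\<exists>J\<subseteq>S. pairwise (\<lambda>i j. nb i \<inter> nb j = {}) J \<and> card S \<le> K\<^sup>2 * card J"
proof -
  define \<J> where "\<J> = {J. J \<subseteq> S \<and> pairwise (\<lambda>i j. nb i \<inter> nb j = {}) J}"
  have "finite \<J>" "{} \<in> \<J>"
    using finite_subset[OF S fin] by (auto simp: \<J>_def)
  then obtain J where J: "J \<in> \<J>" and max: "\<And>J'. J' \<in> \<J> \<Longrightarrow> J \<subseteq> J' \<Longrightarrow> J = J'"
    using finite_has_maximal2[of \<J> "{}"] by (metis)
  have JS: "J \<subseteq> S" and JV: "J \<subseteq> V" using J S by (auto simp: \<J>_def)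
  have "S \<subseteq> nbs (nbs J)"
  proof
    fix s assume s: "s \<in> S"
    show "s \<in> nbs (nbs J)"
    proof (cases "s \<in> J")
      case True
      then show ?thesis using sub_nbs[OF JV] sub_nbs[OF nbs_sub[OF JV]] by auto
    next
      case False
      then have "insert s J \<notin> \<J>" using max[of "insert s J"] by auto
      then obtain b where b: "b \<in> J" "nb s \<inter> nb b \<noteq> {}"
        using J s by (auto simp: \<J>_def pairwise_insert Int_commute)
      then obtain c where c: "c \<in> nb s" "c \<in> nb b" by auto
      then have "s \<in> nb c" using nb_sym s S by auto
      then show ?thesis using b c by (auto simp: nbs_def)
    qed
  qed
  then have "card S \<le> card (nbs (nbs J))"
    using finite_subset[OF nbs_sub[OF nbs_sub[OF JV]] fin] by (intro card_mono)
  also have "\<dots> \<le> K * (K * card J)"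
    using card_nbs[OF nbs_sub[OF JV]] card_nbs[OF JV] by (meson le_trans mult_le_mono2)
  finally show ?thesis using J by (auto simp: \<J>_def power2_eq_square mult.assoc)
qed

text \<open>The exponent per cell in \<open>decay\<close> is
  \<open>p0 ^ K * (q * (1 - q)) / 12\<close>; dividing by \<open>K\<^sup>2\<close> pays for passing
  from all cells to a separated family.\<close>

definition rate :: real where "rate = p0 ^ K * (q * (1 - q)) / 12 / K\<^sup>2"

definition \<eta> :: "'i \<Rightarrow> ('i \<Rightarrow> 'b) \<Rightarrow> real" where
  "\<eta> i x = \<xi> i x - (\<integral>y. \<xi> i y \<partial>PiM V M)"

abbreviation \<eta>s :: "'i set \<Rightarrow> ('i \<Rightarrow> 'b) \<Rightarrow> real" where
  "\<eta>s A x \<equiv> (\<Sum>i\<in>A. \<eta> i x)"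

lemma rate_nonneg: "V \<noteq> {} \<Longrightarrow> 0 \<le> rate"
  unfolding rate_def using q_range p0(1) by auto

lemma \<eta>_measurable [measurable]: "i \<in> V \<Longrightarrow> \<eta> i \<in> borel_measurable (PiM V M)"
  unfolding \<eta>_def by measurable

lemma \<eta>s_measurable: "A \<subseteq> V \<Longrightarrow> \<eta>s A \<in> borel_measurable (PiM V M)"
  by (intro borel_measurable_sum) auto

lemma integrable_\<xi>: "i \<in> V \<Longrightarrow> integrable (PiM V M) (\<xi> i)"
  by (rule integrable_bounded[of _ 1]) (use range in auto)

lemma mean_range: "i \<in> V \<Longrightarrow> 0 \<le> P.expectation (\<xi> i) \<and> P.expectation (\<xi> i) \<le> 1"
  using integral_mono[OF integrable_\<xi>, of i "\<lambda>_. 1"] range by (auto simp: P.prob_space)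

lemma abs_\<eta>_le: "i \<in> V \<Longrightarrow> \<bar>\<eta> i x\<bar> \<le> 1"
  using mean_range[of i] range[of i x] by (auto simp: \<eta>_def abs_le_iff)

lemma integral_\<eta>: "i \<in> V \<Longrightarrow> (\<integral>x. \<eta> i x \<partial>PiM V M) = 0"
  unfolding \<eta>_def using integrable_\<xi> by (simp add: P.prob_space)

lemma abs_\<eta>s_le: "A \<subseteq> V \<Longrightarrow> \<bar>\<eta>s A x\<bar> \<le> card A"
  using order.trans[OF sum_abs sum_mono, of A "\<lambda>i. \<eta> i x" "\<lambda>_. 1"] abs_\<eta>_le by auto

lemma \<eta>_local: "i \<in> V \<Longrightarrow> local_on (nb i) (\<eta> i)"
  unfolding \<eta>_def by (rule local_on_comp[OF loc])

lemma \<eta>s_local: "A \<subseteq> V \<Longrightarrow> local_on (nbs A) (\<eta>s A)"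
  by (intro local_on_sum local_on_mono[OF \<eta>_local]) (auto simp: nbs_def)

text \<open>Apply \<open>decay\<close> to a separated family in \<open>W - nbs U\<close>. At most
  \<open>L\<close> cells are lost by leaving out \<open>V - W\<close> and \<open>nbs U\<close>, and
  as \<open>\<theta>\<^sup>2 \<le> pi\<^sup>2\<close> this costs only the factor
  \<open>exp (rate * pi\<^sup>2 * L)\<close>. Centring multiplies the integral by a number of
  modulus 1.\<close>

lemma decay_\<eta>s:
  fixes G :: "('i \<Rightarrow> 'b) \<Rightarrow> complex" and \<theta> :: real
  assumes W: "W \<subseteq> V" and U: "U \<subseteq> V" and L: "card (V - W) + K * card U \<le> L"
    and G [measurable]: "G \<in> borel_measurable (PiM V M)" and GB: "\<And>x. norm (G x) \<le> B"
    and GU: "local_on U G" and \<theta>: "\<bar>\<theta>\<bar> \<le> pi" and ne: "V \<noteq> {}"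
  shows "norm (\<integral>x. G x * iexp (\<theta> * \<eta>s W x) \<partial>PiM V M)
    \<le> B * exp (rate * pi\<^sup>2 * L) * exp (- rate * \<theta>\<^sup>2 * card V)"
proof -
  define k where "k = p0 ^ K * (q * (1 - q)) / 12"
  have k0: "0 \<le> k" unfolding k_def using q_range[OF ne] p0(1) by auto
  have rk: "rate = k / K\<^sup>2" by (simp add: rate_def k_def)
  have B0: "0 \<le> B" using GB order.trans[OF norm_ge_zero] by blast
  obtain J where J: "J \<subseteq> W - nbs U" "pairwise (\<lambda>i j. nb i \<inter> nb j = {}) J"
    and cJ: "card (W - nbs U) \<le> K\<^sup>2 * card J"
    using exists_separated[of "W - nbs U"] W by auto
  have "card V \<le> card (W - nbs U) + card (V - W) + card (nbs U)"
  proof -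
    have "card V \<le> card ((W - nbs U) \<union> (V - W) \<union> nbs U)"
      using W fin nbs_sub[OF U] by (intro card_mono) (auto intro: finite_subset)
    also have "\<dots> \<le> card (W - nbs U) + card (V - W) + card (nbs U)"
      by (intro order.trans[OF card_Un_le] add_mono card_Un_le order.refl)
    finally show ?thesis .
  qed
  also have "\<dots> \<le> K\<^sup>2 * card J + L"
    using cJ L card_nbs[OF U] by linarith
  finally have "real (card V) \<le> real (K\<^sup>2 * card J + L)" by (rule of_nat_mono)
  then have "rate * \<theta>\<^sup>2 * card V \<le> rate * \<theta>\<^sup>2 * (K\<^sup>2 * card J + L)"
    using rate_nonneg[OF ne] by (intro mult_left_mono) auto
  also have "\<dots> = k * \<theta>\<^sup>2 * card J + rate * \<theta>\<^sup>2 * L"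
    using K_pos by (simp add: rk field_simps)
  also have "rate * \<theta>\<^sup>2 * L \<le> rate * pi\<^sup>2 * L"
    using power_mono[OF \<theta>, of 2] rate_nonneg[OF ne] by (intro mult_right_mono mult_left_mono) auto
  finally have exps: "- k * \<theta>\<^sup>2 * card J \<le> rate * pi\<^sup>2 * L + - rate * \<theta>\<^sup>2 * card V" by simp
  define c where "c = iexp (- \<theta> * (\<Sum>i\<in>W. P.expectation (\<xi> i)))"
  have nc: "norm c = 1" unfolding c_def by (rule norm_exp_i_times)
  have "G x * iexp (\<theta> * \<eta>s W x) = c * (G x * iexp (\<theta> * (\<Sum>i\<in>W. \<xi> i x)))" for x
    by (simp add: c_def \<eta>_def sum_subtractf right_diff_distrib exp_diff exp_minus field_simps)
  then have "norm (\<integral>x. G x * iexp (\<theta> * \<eta>s W x) \<partial>PiM V M) =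
      norm (\<integral>x. G x * iexp (\<theta> * (\<Sum>i\<in>W. \<xi> i x)) \<partial>PiM V M)"
    by (simp only: integral_mult_right_zero norm_mult nc mult_1)
  also have "\<dots> \<le> B * exp (- k * \<theta>\<^sup>2 * card J)"
    unfolding k_def
  proof (rule decay[OF W _ J(2) G GB GU _ \<theta>])
    show "J \<subseteq> W" using J by auto
    show "nb b \<inter> U = {}" if "b \<in> J" for b
      using that J(1) W nb_sym[of b] by (auto simp: nbs_def)
  qed
  also have "\<dots> \<le> B * exp (rate * pi\<^sup>2 * L + - rate * \<theta>\<^sup>2 * card V)"
    using exps B0 by (intro mult_left_mono) auto
  finally show ?thesis by (simp only: exp_add mult.assoc)
qed

section \<open>Tikhomirov's differential inequality for the characteristic function\<close>

text \<open>The share of one cell. Expanding \<open>iexp (\<theta> * \<eta>s U1 x)\<close> to first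
  order produces the main term, in which \<open>m\<close> is the covariance of
  \<open>\<eta> i\<close> with the whole sum. What remains is of size
  \<open>\<theta>\<^sup>2\<close> and local on \<open>U3\<close>, so that
  \<open>decay_\<eta>s\<close> applies to it.\<close>

lemma stein_summand:
  fixes \<theta> :: real
  assumes i: "i \<in> V" and \<theta>: "\<bar>\<theta>\<bar> \<le> pi"
  shows "\<exists>m::real. (\<integral>x. \<eta> i x * \<eta>s V x \<partial>PiM V M) = m \<and> \<bar>m\<bar> \<le> real K ^ 2 \<and>
    norm ((\<integral>x. \<eta> i x * iexp (\<theta> * \<eta>s V x) \<partial>PiM V M) - \<i> * \<theta> * m * (\<integral>x. iexp (\<theta> * \<eta>s V x) \<partial>PiM V M))
    \<le> 3 * real K ^ 6 * \<theta>\<^sup>2 * exp (rate * pi\<^sup>2 * (2 * real K ^ 6)) * exp (- rate * \<theta>\<^sup>2 * card V)"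
proof -
  have ne: "V \<noteq> {}" using i by auto
  \<comment> \<open>The sum over \<open>V - U1\<close> is independent of \<open>\<eta> i\<close>, the sum over \<open>V - U2\<close> is independent of \<open>\<eta> i * \<eta>s U1\<close>,
    and everything that is split off is local on \<open>U3\<close>.\<close>
  define U1 where "U1 = nbs (nb i)"
  define U where "U = nbs U1"
  define U2 where "U2 = nbs U"
  define U3 where "U3 = nbs U2"
  have sub: "nb i \<subseteq> V" "U1 \<subseteq> V" "U \<subseteq> V" "U2 \<subseteq> V" "U3 \<subseteq> V"
    using nb_sub[OF i] nbs_sub by (auto simp: U1_def U_def U2_def U3_def)
  have chain: "nb i \<subseteq> U1" "U1 \<subseteq> U" "U \<subseteq> U2" "U2 \<subseteq> U3"
    using sub sub_nbs by (auto simp: U1_def U_def U2_def U3_def)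
  have K1: "1 \<le> real K" using K_pos by auto
  have c1: "card U1 \<le> K ^ 2"
    unfolding U1_def using card_nbs[OF sub(1)] nb_card[OF i]
    by (metis le_trans mult_le_mono2 power2_eq_square)
  have c2: "card U2 \<le> K ^ 4"
  proof -
    have "card U2 \<le> K * (K * card U1)"
      unfolding U2_def U_def using card_nbs[OF sub(2)] card_nbs[OF sub(3)]
      by (metis U_def le_trans mult_le_mono2)
    also have "\<dots> \<le> K * (K * K ^ 2)" using c1 by simp
    finally show ?thesis by (simp add: eval_nat_numeral)
  qed
  have c3: "card U3 \<le> K ^ 5"
  proof -
    have "card U3 \<le> K * card U2" unfolding U3_def by (rule card_nbs[OF sub(4)])
    also have "\<dots> \<le> K * K ^ 4" using c2 by simp
    finally show ?thesis by (simp add: eval_nat_numeral)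
  qed
  have c1r: "real (card U1) \<le> real K ^ 2" and c2r: "real (card U2) \<le> real K ^ 4"
    using c1 c2 by (metis of_nat_le_iff of_nat_power)+
  \<comment> \<open>The cells lost to decay: \<open>U2\<close> is removed from the sum and
    \<open>nbs U3\<close> from the separated family, at most \<open>K ^ 4 + K * K ^ 5\<close>
    cells.\<close>
  have L: "card (V - (V - U2)) + K * card U3 \<le> 2 * K ^ 6"
  proof -
    have *: "V - (V - U2) = U2" using sub by auto
    have "K ^ 4 \<le> K ^ 6" using K_pos by (intro power_increasing) auto
    moreover have "K * card U3 \<le> K * K ^ 5" using c3 by simp
    moreover have "K * K ^ 5 = K ^ 6" by (simp add: eval_nat_numeral)
    ultimately show ?thesis unfolding * using c2 by linarith
  qed
  note [measurable] = \<eta>_measurable[OF i] \<eta>s_measurable[OF sub(2)] \<eta>s_measurable[OF sub(4)]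
    \<eta>s_measurable[of "V - U1", OF Diff_subset] \<eta>s_measurable[of "V - U2", OF Diff_subset]
    \<eta>s_measurable[of "U2 - U1", OF order.trans[OF Diff_subset sub(4)]] \<eta>s_measurable[OF order.refl]
  define m where "m = (\<integral>x. \<eta> i x * \<eta>s U1 x \<partial>PiM V M)"
  have b\<eta>: "\<bar>\<eta> i x\<bar> \<le> 1" for x using abs_\<eta>_le[OF i] .
  have bY: "\<bar>\<eta>s U1 x\<bar> \<le> real K ^ 2" for x using abs_\<eta>s_le[OF sub(2), of x] c1r by linarith
  have bY2: "\<bar>\<eta>s U2 x\<bar> \<le> real K ^ 4" for x using abs_\<eta>s_le[OF sub(4), of x] c2r by linarith
  have bY': "\<bar>\<eta>s (U2 - U1) x\<bar> \<le> real K ^ 4" for x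
  proof -
    have "card (U2 - U1) \<le> card U2" using finite_subset[OF sub(4) fin] by (intro card_mono) auto
    moreover have "\<bar>\<eta>s (U2 - U1) x\<bar> \<le> card (U2 - U1)" by (rule abs_\<eta>s_le) (use sub in auto)
    ultimately show ?thesis using c2r by linarith
  qed
  have bV: "\<bar>\<eta>s A x\<bar> \<le> card V" if "A \<subseteq> V" for A x
    using abs_\<eta>s_le[OF that, of x] card_mono[OF fin that] by linarith
  have b\<eta>Y: "\<bar>\<eta> i x * \<eta>s U1 x\<bar> \<le> real K ^ 2" for x
    using mult_mono[OF b\<eta> bY, of x x] by (simp add: abs_mult)
  have mb: "\<bar>m\<bar> \<le> real K ^ 2"
  proof -
    have "\<bar>m\<bar> \<le> (\<integral>x. \<bar>\<eta> i x * \<eta>s U1 x\<bar> \<partial>PiM V M)" unfolding m_def by (rule integral_abs_bound)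
    also have "\<dots> \<le> (\<integral>x. real K ^ 2 \<partial>PiM V M)" by (rule integral_mono') (use b\<eta>Y in auto)
    finally show ?thesis by (simp add: P.prob_space)
  qed
  have sV: "\<eta>s V x = \<eta>s U1 x + \<eta>s (V - U1) x" for x
    using sum.subset_diff[OF sub(2) fin, of "\<lambda>i. \<eta> i x"] by simp
  have sV2: "\<eta>s V x = \<eta>s U2 x + \<eta>s (V - U2) x" for x
    using sum.subset_diff[OF sub(4) fin, of "\<lambda>i. \<eta> i x"] by simp
  have sU2: "\<eta>s U2 x = \<eta>s U1 x + \<eta>s (U2 - U1) x" for x
    using sum.subset_diff[of U1 U2 "\<lambda>i. \<eta> i x"] finite_subset[OF sub(4) fin] chain by auto
  have lr: "local_on (nbs (V - U1)) (\<eta>s (V - U1))" "local_on (nbs (V - U2)) (\<eta>s (V - U2))"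
    by (intro \<eta>s_local Diff_subset)+
  have far1: "nb i \<inter> nbs (V - U1) = {}" unfolding U1_def by (rule nbs_disjoint[OF sub(1)])
  have far2: "U \<inter> nbs (V - U2) = {}" unfolding U2_def by (rule nbs_disjoint[OF sub(3)])
  have cm: "integrable (PiM V M) f" if "f \<in> borel_measurable (PiM V M)" "\<And>x. norm (f x) \<le> B"
    for f :: "('i \<Rightarrow> 'b) \<Rightarrow> complex" and B
    using that by (rule integrable_bounded)
  have i\<eta>: "(\<integral>x. complex_of_real (\<eta> i x) \<partial>PiM V M) = 0"
    using integral_\<eta>[OF i] by simp
  have z1: "(\<integral>x. \<eta> i x * iexp (\<theta> * \<eta>s (V - U1) x) \<partial>PiM V M) = 0"
  proof -
    have "(\<integral>x. \<eta> i x * iexp (\<theta> * \<eta>s (V - U1) x) \<partial>PiM V M) =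
      (\<integral>x. complex_of_real (\<eta> i x) \<partial>PiM V M) * (\<integral>x. iexp (\<theta> * \<eta>s (V - U1) x) \<partial>PiM V M)"
    proof (rule integral_PiM_mult_local[OF prob fin _ _ _ _ _ far1])
      show "local_on (nb i) (\<lambda>x. complex_of_real (\<eta> i x))" by (rule local_on_comp[OF \<eta>_local[OF i]])
      show "local_on (nbs (V - U1)) (\<lambda>x. iexp (\<theta> * \<eta>s (V - U1) x))"
        by (rule local_on_comp[OF lr(1)])
    qed (rule cm[of _ 1]; use b\<eta> in \<open>simp add: norm_mult\<close>)+
    then show ?thesis using i\<eta> by simp
  qed
  have b\<eta>V: "\<bar>\<eta> i x * \<eta>s A x\<bar> \<le> card V" if "A \<subseteq> V" for A x
    using mult_mono[OF b\<eta> bV[OF that], of x x] by (simp add: abs_mult)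
  have z2: "(\<integral>x. \<eta> i x * \<eta>s (V - U1) x \<partial>PiM V M) = 0"
  proof -
    have "(\<integral>x. \<eta> i x * \<eta>s (V - U1) x \<partial>PiM V M) = (\<integral>x. \<eta> i x \<partial>PiM V M) * (\<integral>x. \<eta>s (V - U1) x \<partial>PiM V M)"
    proof (rule integral_PiM_mult_local[OF prob fin _ _ _ \<eta>_local[OF i] lr(1) far1])
      show "integrable (PiM V M) (\<eta> i)" by (rule integrable_bounded[of _ 1]) (use b\<eta> in auto)
      show "integrable (PiM V M) (\<eta>s (V - U1))"
        by (rule integrable_bounded[of _ "card V"]) (use bV in auto)
      show "integrable (PiM V M) (\<lambda>x. \<eta> i x * \<eta>s (V - U1) x)"
        by (rule integrable_bounded[of _ "card V"]) (use b\<eta>V[OF Diff_subset] in simp_all)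
    qed
    then show ?thesis using integral_\<eta>[OF i] by simp
  qed
  have z3: "(\<integral>x. complex_of_real (\<eta> i x * \<eta>s U1 x) * iexp (\<theta> * \<eta>s (V - U2) x) \<partial>PiM V M) =
      m * (\<integral>x. iexp (\<theta> * \<eta>s (V - U2) x) \<partial>PiM V M)"
  proof -
    have "(\<integral>x. complex_of_real (\<eta> i x * \<eta>s U1 x) * iexp (\<theta> * \<eta>s (V - U2) x) \<partial>PiM V M) =
      (\<integral>x. complex_of_real (\<eta> i x * \<eta>s U1 x) \<partial>PiM V M) * (\<integral>x. iexp (\<theta> * \<eta>s (V - U2) x) \<partial>PiM V M)"
    proof (rule integral_PiM_mult_local[OF prob fin _ _ _ _ _ far2])
      have "local_on U (\<eta> i)" "local_on U (\<eta>s U1)"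
        using local_on_mono[OF \<eta>_local[OF i]] chain \<eta>s_local[OF sub(2)] by (auto simp: U_def)
      then show "local_on U (\<lambda>x. complex_of_real (\<eta> i x * \<eta>s U1 x))"
        by (rule local_on_comp2[where h = "\<lambda>a b. complex_of_real (a * b)"])
      show "local_on (nbs (V - U2)) (\<lambda>x. iexp (\<theta> * \<eta>s (V - U2) x))"
        by (rule local_on_comp[OF lr(2)])
    qed (rule cm[of _ "real K ^ 2"]; use b\<eta>Y K1 in \<open>simp add: norm_mult abs_mult del: of_real_mult of_real_sum\<close>)+
    then show ?thesis by (simp only: m_def integral_complex_of_real)
  qed
  have mV: "(\<integral>x. \<eta> i x * \<eta>s V x \<partial>PiM V M) = m"
  proof -
    have "integrable (PiM V M) (\<lambda>x. \<eta> i x * \<eta>s U1 x)" "integrable (PiM V M) (\<lambda>x. \<eta> i x * \<eta>s (V - U1) x)"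
      by (rule integrable_bounded[of _ "card V"]; use b\<eta>V sub in simp)+
    then show ?thesis by (simp add: sV ring_distribs z2 m_def)
  qed
  \<comment> \<open>The three sources of error: the second-order remainder on \<open>U1\<close>, the
    cost of dropping \<open>U2 - U1\<close> from the main term, and the cost of restoring
    \<open>U2\<close> in the characteristic function that multiplies \<open>m\<close>.\<close>
  define R where "R x = \<eta> i x * (iexp (\<theta> * \<eta>s U1 x) - 1 - \<i> * (\<theta> * \<eta>s U1 x)) * iexp (\<theta> * \<eta>s (U2 - U1) x)
      + \<i> * \<theta> * (\<eta> i x * \<eta>s U1 x) * (iexp (\<theta> * \<eta>s (U2 - U1) x) - 1)
      - \<i> * \<theta> * m * (iexp (\<theta> * \<eta>s U2 x) - 1)" for x
  define e where "e x = iexp (\<theta> * \<eta>s (V - U2) x)" for x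
  have ident: "\<eta> i x * iexp (\<theta> * \<eta>s V x) - \<i> * \<theta> * m * iexp (\<theta> * \<eta>s V x) =
      R x * e x + \<eta> i x * iexp (\<theta> * \<eta>s (V - U1) x)
      + \<i> * \<theta> * (complex_of_real (\<eta> i x * \<eta>s U1 x) * e x) - \<i> * \<theta> * m * e x" for x
  proof -
    have "iexp (\<theta> * \<eta>s V x) = iexp (\<theta> * \<eta>s U1 x) * iexp (\<theta> * \<eta>s (U2 - U1) x) * e x"
      unfolding sV2 sU2 e_def by (simp add: ring_distribs exp_add)
    moreover have "iexp (\<theta> * \<eta>s U2 x) = iexp (\<theta> * \<eta>s U1 x) * iexp (\<theta> * \<eta>s (U2 - U1) x)"
      unfolding sU2 by (simp add: ring_distribs exp_add)
    moreover have "iexp (\<theta> * \<eta>s (V - U1) x) = iexp (\<theta> * \<eta>s (U2 - U1) x) * e x"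
    proof -
      have "\<eta>s (V - U1) x = \<eta>s (U2 - U1) x + \<eta>s (V - U2) x" using sV[of x] sV2[of x] sU2[of x] by simp
      then show ?thesis unfolding e_def by (simp only: of_real_add of_real_mult ring_distribs exp_add)
    qed
    \<comment> \<open>\<open>A\<close>, \<open>B\<close>, \<open>E\<close> stand for the
      exponentials over \<open>U1\<close>, \<open>U2 - U1\<close> and \<open>V - U2\<close>, and
      \<open>h\<close>, \<open>t\<close>, \<open>c\<close>, \<open>Y\<close> for
      \<open>\<eta> i x\<close>, \<theta>, \<open>m\<close> and \<open>\<eta>s U1 x\<close>; in
      generic variables the identity is purely polynomial.\<close>
    moreover have "h * (A * B * E) - \<i> * t * c * (A * B * E) = (h * (A - 1 - \<i> * (t * Y)) * B
        + \<i> * t * (h * Y) * (B - 1) - \<i> * t * c * (A * B - 1)) * E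
        + h * (B * E) + \<i> * t * ((h * Y) * E) - \<i> * t * c * E" for h A B E t c Y :: complex
      by (simp add: algebra_simps)
    ultimately show ?thesis unfolding R_def by (simp only: of_real_mult)
  qed
  have Rm [measurable]: "R \<in> borel_measurable (PiM V M)" unfolding R_def by measurable
  have em [measurable]: "e \<in> borel_measurable (PiM V M)" unfolding e_def by measurable
  have ne1: "norm (e x) = 1" for x unfolding e_def by (rule norm_exp_i_times)
  have K26: "real K ^ 4 \<le> real K ^ 6" using K1 by (intro power_increasing) auto
  have RB: "norm (R x) \<le> 3 * real K ^ 6 * \<theta>\<^sup>2" for x
  proof -
    have "norm (complex_of_real (\<eta> i x) * (iexp (\<theta> * \<eta>s U1 x) - 1 - \<i> * (\<theta> * \<eta>s U1 x)) * iexp (\<theta> * \<eta>s (U2 - U1) x))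
        = \<bar>\<eta> i x\<bar> * norm (iexp (\<theta> * \<eta>s U1 x) - 1 - \<i> * (\<theta> * \<eta>s U1 x))"
      unfolding norm_mult norm_exp_i_times by simp
    also have "\<dots> \<le> 1 * ((\<theta> * \<eta>s U1 x)\<^sup>2 / 2)"
      using norm_iexp_diff2[of "\<theta> * \<eta>s U1 x"] b\<eta> by (intro mult_mono) auto
    also have "\<dots> \<le> \<theta>\<^sup>2 * (real K ^ 2)\<^sup>2"
    proof -
      have "(\<eta>s U1 x)\<^sup>2 \<le> (real K ^ 2)\<^sup>2" using power_mono[OF bY, of x 2] by simp
      then have "\<theta>\<^sup>2 * (\<eta>s U1 x)\<^sup>2 \<le> \<theta>\<^sup>2 * (real K ^ 2)\<^sup>2" by (intro mult_left_mono) auto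
      moreover have "0 \<le> (\<theta> * \<eta>s U1 x)\<^sup>2" by simp
      ultimately show ?thesis unfolding power_mult_distrib by linarith
    qed
    also have "\<dots> \<le> \<theta>\<^sup>2 * real K ^ 6" using K26 by (intro mult_left_mono) auto
    finally have 1: "norm (complex_of_real (\<eta> i x) * (iexp (\<theta> * \<eta>s U1 x) - 1 - \<i> * (\<theta> * \<eta>s U1 x)) * iexp (\<theta> * \<eta>s (U2 - U1) x))
       \<le> \<theta>\<^sup>2 * real K ^ 6" .
    have gen: "norm (\<i> * complex_of_real \<theta> * complex_of_real a * (iexp (\<theta> * b) - 1)) \<le> \<theta>\<^sup>2 * real K ^ 6"
      if "\<bar>a\<bar> \<le> real K ^ 2" "\<bar>b\<bar> \<le> real K ^ 4" for a b
    proof -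
      have "norm (\<i> * complex_of_real \<theta> * complex_of_real a * (iexp (\<theta> * b) - 1)) = \<bar>\<theta>\<bar> * \<bar>a\<bar> * norm (iexp (\<theta> * b) - 1)"
        by (simp only: norm_mult norm_of_real norm_ii mult_1)
      also have "\<dots> \<le> \<bar>\<theta>\<bar> * real K ^ 2 * (\<bar>\<theta>\<bar> * real K ^ 4)"
      proof (intro mult_mono order.refl that)
        have "norm (iexp (\<theta> * b) - 1) \<le> \<bar>\<theta>\<bar> * \<bar>b\<bar>" using norm_iexp_diff1[of "\<theta> * b"] by (simp add: abs_mult)
        also have "\<dots> \<le> \<bar>\<theta>\<bar> * real K ^ 4" using that by (intro mult_left_mono) auto
        finally show "norm (iexp (\<theta> * b) - 1) \<le> \<bar>\<theta>\<bar> * real K ^ 4" .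
      qed auto
      also have "\<dots> = \<theta>\<^sup>2 * real K ^ 6"
        by (simp add: power2_eq_square[of \<theta>] eval_nat_numeral flip: abs_mult)
      finally show ?thesis .
    qed
    have 2: "norm (\<i> * \<theta> * (\<eta> i x * \<eta>s U1 x) * (iexp (\<theta> * \<eta>s (U2 - U1) x) - 1)) \<le> \<theta>\<^sup>2 * real K ^ 6"
      using gen[OF b\<eta>Y bY', of x x] by (simp only: of_real_mult)
    have 3: "norm (\<i> * \<theta> * m * (iexp (\<theta> * \<eta>s U2 x) - 1)) \<le> \<theta>\<^sup>2 * real K ^ 6"
      by (rule gen[OF mb bY2])
    have "norm (R x) \<le> \<theta>\<^sup>2 * real K ^ 6 + \<theta>\<^sup>2 * real K ^ 6 + \<theta>\<^sup>2 * real K ^ 6"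
      unfolding R_def by (intro order.trans[OF norm_triangle_ineq4] order.trans[OF norm_triangle_ineq] add_mono 1 2 3)
    then show ?thesis by (simp add: mult_ac)
  qed
  have RU: "local_on U3 R"
  proof -
    have *: "local_on U3 (\<eta>s A)" if "A \<subseteq> U2" for A
      by (rule local_on_mono[OF \<eta>s_local]) (use that sub nbs_mono[OF that] in \<open>auto simp: U3_def\<close>)
    have 1: "local_on U3 (\<eta> i)" "local_on U3 (\<eta>s U1)" "local_on U3 (\<eta>s U2)" "local_on U3 (\<eta>s (U2 - U1))"
      using chain by (auto intro!: * local_on_mono[OF \<eta>_local[OF i]])
    show ?thesis unfolding local_on_def
    proof (intro allI impI)
      fix x y :: "'i \<Rightarrow> 'b" assume "\<forall>i\<in>U3. x i = y i"
      then have "\<eta> i x = \<eta> i y" "\<eta>s U1 x = \<eta>s U1 y" "\<eta>s U2 x = \<eta>s U2 y" "\<eta>s (U2 - U1) x = \<eta>s (U2 - U1) y"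
        using 1[THEN local_onD, of x y] by auto
      then show "R x = R y" unfolding R_def by (simp only:)
    qed
  qed
  have ints: "integrable (PiM V M) (\<lambda>x. R x * e x)"
    "integrable (PiM V M) (\<lambda>x. \<eta> i x * iexp (\<theta> * \<eta>s (V - U1) x))"
    "integrable (PiM V M) (\<lambda>x. complex_of_real (\<eta> i x * \<eta>s U1 x) * e x)"
    "integrable (PiM V M) e"
    "integrable (PiM V M) (\<lambda>x. \<eta> i x * iexp (\<theta> * \<eta>s V x))"
    "integrable (PiM V M) (\<lambda>x. iexp (\<theta> * \<eta>s V x))"
    subgoal by (rule cm[of _ "3 * real K ^ 6 * \<theta>\<^sup>2"]) (use RB ne1 in \<open>auto simp: norm_mult\<close>)
    subgoal by (rule cm[of _ 1]) (use b\<eta> in \<open>simp_all add: norm_mult\<close>)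
    subgoal by (rule cm[of _ "real K ^ 2"]) (use b\<eta>Y ne1 in \<open>simp_all add: norm_mult abs_mult del: of_real_sum\<close>)
    subgoal by (rule cm[of _ 1]) (use ne1 in auto)
    subgoal by (rule cm[of _ 1]) (use b\<eta> in \<open>simp_all add: norm_mult\<close>)
    subgoal by (rule cm[of _ 1]) simp_all
    done
  have "(\<integral>x. \<eta> i x * iexp (\<theta> * \<eta>s V x) \<partial>PiM V M) - \<i> * \<theta> * m * (\<integral>x. iexp (\<theta> * \<eta>s V x) \<partial>PiM V M)
      = (\<integral>x. \<eta> i x * iexp (\<theta> * \<eta>s V x) - \<i> * \<theta> * m * iexp (\<theta> * \<eta>s V x) \<partial>PiM V M)"
    by (subst Bochner_Integration.integral_diff[OF ints(5) integrable_mult_right[OF ints(6)]])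
       (simp only: integral_mult_right_zero)
  also have "\<dots> = (\<integral>x. R x * e x \<partial>PiM V M) + (\<integral>x. \<eta> i x * iexp (\<theta> * \<eta>s (V - U1) x) \<partial>PiM V M)
      + \<i> * \<theta> * (\<integral>x. complex_of_real (\<eta> i x * \<eta>s U1 x) * e x \<partial>PiM V M) - \<i> * \<theta> * m * (\<integral>x. e x \<partial>PiM V M)"
    unfolding ident
    by (simp only: Bochner_Integration.integral_diff Bochner_Integration.integral_add
        Bochner_Integration.integrable_add integrable_mult_right integral_mult_right_zero ints)
  \<comment> \<open>The term over \<open>V - U1\<close> vanishes by \<open>z1\<close>, since
    \<open>\<eta> i\<close> is centred and independent of that sum; the last two terms cancel by
    \<open>z3\<close>.\<close>
  also have "\<dots> = (\<integral>x. R x * e x \<partial>PiM V M)"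
    using z1 z3 unfolding e_def[symmetric] by (simp add: mult.assoc)
  finally have "norm ((\<integral>x. \<eta> i x * iexp (\<theta> * \<eta>s V x) \<partial>PiM V M) - \<i> * \<theta> * m * (\<integral>x. iexp (\<theta> * \<eta>s V x) \<partial>PiM V M))
      = norm (\<integral>x. R x * e x \<partial>PiM V M)" by (rule arg_cong)
  also have "\<dots> \<le> 3 * real K ^ 6 * \<theta>\<^sup>2 * exp (rate * pi\<^sup>2 * real (2 * K ^ 6)) * exp (- rate * \<theta>\<^sup>2 * card V)"
    unfolding e_def by (rule decay_\<eta>s[OF Diff_subset sub(5) L Rm RB RU \<theta> ne])
  also have "real (2 * K ^ 6) = 2 * real K ^ 6" by simp
  finally show ?thesis using mV mb by blast
qed

text \<open>Both claims sum \<open>stein_summand\<close> over the cells, using that the covariances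
  \<open>m i\<close> add up to the variance.\<close>

lemma variance_le: "(\<integral>x. (\<eta>s V x)\<^sup>2 \<partial>PiM V M) \<le> real K ^ 2 * card V"
  and char_stein: "\<bar>\<theta>\<bar> \<le> pi \<Longrightarrow>
    norm ((\<integral>x. \<eta>s V x * iexp (\<theta> * \<eta>s V x) \<partial>PiM V M)
       - \<i> * \<theta> * (\<integral>x. (\<eta>s V x)\<^sup>2 \<partial>PiM V M) * (\<integral>x. iexp (\<theta> * \<eta>s V x) \<partial>PiM V M))
    \<le> card V * (3 * real K ^ 6 * \<theta>\<^sup>2 * exp (rate * pi\<^sup>2 * (2 * real K ^ 6)) * exp (- rate * \<theta>\<^sup>2 * card V))"
proof -
  define m where "m i = (\<integral>x. \<eta> i x * \<eta>s V x \<partial>PiM V M)" for i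
  define \<phi> where "\<phi> \<theta> = (\<integral>x. iexp (\<theta> * \<eta>s V x) \<partial>PiM V M)" for \<theta> :: real
  note [measurable] = \<eta>s_measurable[OF order.refl]
  have b: "\<bar>\<eta> i x * \<eta>s V x\<bar> \<le> card V" if "i \<in> V" for i x
    using mult_mono[OF abs_\<eta>_le[OF that] abs_\<eta>s_le[OF order.refl], of x x] by (simp add: abs_mult)
  have int: "integrable (PiM V M) (\<lambda>x. \<eta> i x * \<eta>s V x)" if i: "i \<in> V" for i
    by (rule integrable_bounded[of _ "card V"]) (use b[OF i] i in simp_all)
  have int2: "integrable (PiM V M) (\<lambda>x. \<eta> i x * iexp (\<theta> * \<eta>s V x))" if i: "i \<in> V" for i and \<theta> :: real
    by (rule integrable_bounded[of _ 1]) (use abs_\<eta>_le[OF i] i in \<open>simp_all add: norm_mult\<close>)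
  have s2: "(\<integral>x. (\<eta>s V x)\<^sup>2 \<partial>PiM V M) = (\<Sum>i\<in>V. m i)"
  proof -
    have "(\<eta>s V x)\<^sup>2 = (\<Sum>i\<in>V. \<eta> i x * \<eta>s V x)" for x
      by (simp add: power2_eq_square sum_distrib_right)
    then show ?thesis unfolding m_def by (simp only: Bochner_Integration.integral_sum[OF int])
  qed
  have "(\<Sum>i\<in>V. m i) \<le> (\<Sum>i\<in>V. real K ^ 2)"
    using stein_summand[of _ 0] by (intro sum_mono) (auto simp: m_def abs_le_iff)
  then show "(\<integral>x. (\<eta>s V x)\<^sup>2 \<partial>PiM V M) \<le> real K ^ 2 * card V" by (simp add: s2 mult.commute)
  assume \<theta>: "\<bar>\<theta>\<bar> \<le> pi"
  have e1: "(\<integral>x. \<eta>s V x * iexp (\<theta> * \<eta>s V x) \<partial>PiM V M) = (\<Sum>i\<in>V. \<integral>x. \<eta> i x * iexp (\<theta> * \<eta>s V x) \<partial>PiM V M)"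
    unfolding of_real_sum sum_distrib_right
    by (rule Bochner_Integration.integral_sum) (use int2[of _ \<theta>] in simp)
  have e2: "\<i> * \<theta> * (\<integral>x. (\<eta>s V x)\<^sup>2 \<partial>PiM V M) * \<phi> \<theta> = (\<Sum>i\<in>V. \<i> * \<theta> * m i * \<phi> \<theta>)"
    unfolding s2 of_real_sum sum_distrib_right sum_distrib_left ..
  have "norm ((\<integral>x. \<eta>s V x * iexp (\<theta> * \<eta>s V x) \<partial>PiM V M) - \<i> * \<theta> * (\<integral>x. (\<eta>s V x)\<^sup>2 \<partial>PiM V M) * \<phi> \<theta>)
      \<le> (\<Sum>i\<in>V. norm ((\<integral>x. \<eta> i x * iexp (\<theta> * \<eta>s V x) \<partial>PiM V M) - \<i> * \<theta> * m i * \<phi> \<theta>))"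
    unfolding e1 e2 sum_subtractf[symmetric] by (rule norm_sum)
  also have "\<dots> \<le> (\<Sum>i\<in>V. 3 * real K ^ 6 * \<theta>\<^sup>2 * exp (rate * pi\<^sup>2 * (2 * real K ^ 6)) * exp (- rate * \<theta>\<^sup>2 * card V))"
  proof (rule sum_mono)
    fix i assume "i \<in> V"
    then show "norm ((\<integral>x. \<eta> i x * iexp (\<theta> * \<eta>s V x) \<partial>PiM V M) - \<i> * \<theta> * m i * \<phi> \<theta>)
      \<le> 3 * real K ^ 6 * \<theta>\<^sup>2 * exp (rate * pi\<^sup>2 * (2 * real K ^ 6)) * exp (- rate * \<theta>\<^sup>2 * card V)"
      using stein_summand[OF _ \<theta>, of i] unfolding m_def \<phi>_def by metis
  qed
  finally show "norm ((\<integral>x. \<eta>s V x * iexp (\<theta> * \<eta>s V x) \<partial>PiM V M)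
       - \<i> * \<theta> * (\<integral>x. (\<eta>s V x)\<^sup>2 \<partial>PiM V M) * (\<integral>x. iexp (\<theta> * \<eta>s V x) \<partial>PiM V M))
    \<le> card V * (3 * real K ^ 6 * \<theta>\<^sup>2 * exp (rate * pi\<^sup>2 * (2 * real K ^ 6)) * exp (- rate * \<theta>\<^sup>2 * card V))"
    unfolding \<phi>_def sum_constant .
qed

section \<open>Lower bound for the variance\<close>

lemma norm_char_le:
  assumes \<theta>: "\<bar>\<theta>\<bar> \<le> pi" and ne: "V \<noteq> {}"
  shows "norm (\<integral>x. iexp (\<theta> * \<eta>s V x) \<partial>PiM V M) \<le> exp (- rate * \<theta>\<^sup>2 * card V)"
  using decay_\<eta>s[OF order.refl, of "{}" 0 "\<lambda>_. 1" 1 \<theta>] \<theta> ne by (simp add: local_on_const)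

text \<open>At \<open>\<theta>\<^sup>2 = y\<close> the real part of the characteristic function is
  at least \<open>1 - s2 * y / 2\<close>, while \<open>norm_char_le\<close> bounds it by
  \<open>exp (- (A * y)) \<le> 1 - A * y + (A * y)\<^sup>2\<close>. For small \<open>y\<close> this
  excludes \<open>s2 / 2 < A\<close>.\<close>

lemma variance_ge:
  assumes ne: "V \<noteq> {}"
  shows "2 * rate * card V \<le> (\<integral>x. (\<eta>s V x)\<^sup>2 \<partial>PiM V M)"
proof (rule ccontr)
  define s2 where "s2 = (\<integral>x. (\<eta>s V x)\<^sup>2 \<partial>PiM V M)"
  define A where "A = rate * card V"
  define d where "d = A - s2 / 2"
  assume "\<not> 2 * rate * card V \<le> (\<integral>x. (\<eta>s V x)\<^sup>2 \<partial>PiM V M)"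
  then have d: "0 < d" by (simp add: d_def A_def s2_def)
  have s20: "0 \<le> s2" by (simp add: s2_def)
  then have A: "0 < A" using d by (auto simp: d_def)
  note [measurable] = \<eta>s_measurable[OF order.refl]
  \<comment> \<open>Small enough for the quadratic term \<open>A\<^sup>2 * y\<close> to stay below
    the gap \<open>d\<close>; the cap 1 keeps \<theta> inside the period.\<close>
  define y where "y = min 1 (d / (2 * A\<^sup>2))"
  define \<theta> where "\<theta> = sqrt y"
  have y: "0 < y" "y \<le> 1" "A\<^sup>2 * y \<le> d / 2"
  proof -
    show "0 < y" "y \<le> 1" using d A by (auto simp: y_def)
    have "A\<^sup>2 * y \<le> A\<^sup>2 * (d / (2 * A\<^sup>2))" unfolding y_def by (intro mult_left_mono) auto
    then show "A\<^sup>2 * y \<le> d / 2" using A by simp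
  qed
  have \<theta>2: "\<theta>\<^sup>2 = y" using y by (simp add: \<theta>_def)
  have \<theta>: "\<bar>\<theta>\<bar> \<le> pi" using y pi_ge_two by (simp add: \<theta>_def real_sqrt_le_1_iff order.trans[of _ 1])
  have b2: "(\<eta>s V x)\<^sup>2 \<le> real (card V) ^ 2" for x
    using power_mono[OF abs_\<eta>s_le[OF order.refl], of x 2] by simp
  have i2: "integrable (PiM V M) (\<lambda>x. (\<eta>s V x)\<^sup>2)"
    by (rule integrable_bounded[of _ "real (card V) ^ 2"]) (use b2 in simp_all)
  have ic: "integrable (PiM V M) (\<lambda>x. cos (\<theta> * \<eta>s V x))"
    by (rule integrable_bounded[of _ 1]) simp_all
  have ie: "integrable (PiM V M) (\<lambda>x. iexp (\<theta> * \<eta>s V x))"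
    by (rule integrable_bounded[of _ 1]) simp_all
  have "1 - s2 * y / 2 = (\<integral>x. 1 - y / 2 * (\<eta>s V x)\<^sup>2 \<partial>PiM V M)"
    using i2 by (simp add: s2_def P.prob_space)
  also have "\<dots> \<le> (\<integral>x. cos (\<theta> * \<eta>s V x) \<partial>PiM V M)"
  proof (rule integral_mono)
    show "1 - y / 2 * (\<eta>s V x)\<^sup>2 \<le> cos (\<theta> * \<eta>s V x)" for x
    proof -
      have "1 - cos (\<theta> * \<eta>s V x) = 2 * (sin (\<theta> * \<eta>s V x / 2))\<^sup>2"
        using cos_double_sin[of "\<theta> * \<eta>s V x / 2"] by simp
      also have "\<dots> \<le> 2 * (\<theta> * \<eta>s V x / 2)\<^sup>2"
        using abs_sin_x_le_abs_x[of "\<theta> * \<eta>s V x / 2"] by (simp only: abs_le_square_iff[symmetric] mult_le_cancel_left) simp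
      also have "\<dots> = y / 2 * (\<eta>s V x)\<^sup>2" by (simp add: power_mult_distrib power_divide \<theta>2)
      finally show ?thesis by simp
    qed
  qed (use i2 ic in auto)
  also have "\<dots> = (\<integral>x. Re (iexp (\<theta> * \<eta>s V x)) \<partial>PiM V M)"
    by (intro Bochner_Integration.integral_cong) (auto simp: Re_exp)
  also have "\<dots> = Re (\<integral>x. iexp (\<theta> * \<eta>s V x) \<partial>PiM V M)" by (rule integral_Re[OF ie])
  also have "\<dots> \<le> norm (\<integral>x. iexp (\<theta> * \<eta>s V x) \<partial>PiM V M)" by (rule complex_Re_le_cmod)
  also have "\<dots> \<le> exp (- (A * y))" using norm_char_le[OF \<theta> ne] by (simp add: A_def \<theta>2 mult_ac)
  also have "\<dots> \<le> 1 / (1 + A * y)"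
  proof -
    have "0 < 1 + A * y" using A y by (simp add: add_pos_pos)
    then have "inverse (exp (A * y)) \<le> inverse (1 + A * y)" by (intro le_imp_inverse_le) auto
    then show ?thesis by (simp add: exp_minus inverse_eq_divide)
  qed
  also have "\<dots> \<le> 1 - A * y + (A * y)\<^sup>2"
  proof -
    have "0 \<le> (A * y) ^ 3" using A y by simp
    then have "1 \<le> (1 - A * y + (A * y)\<^sup>2) * (1 + A * y)"
      by (simp add: algebra_simps power2_eq_square power3_eq_cube)
    moreover have "0 < 1 + A * y" using A y by (simp add: add_pos_pos)
    ultimately show ?thesis by (simp add: pos_divide_le_eq)
  qed
  finally have "d * y \<le> (A\<^sup>2 * y) * y" by (simp add: d_def algebra_simps power2_eq_square)
  then have "d \<le> A\<^sup>2 * y" using y by simp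
  then show False using y d by linarith
qed

text \<open>Here \<open>p0\<close> and \<open>q\<close> are the Poisson probabilities of 0 and 1,
  and \<open>1 - q \<ge> exp (- \<nu>)\<close> because
  \<open>(1 + \<nu>) * exp (- \<nu>) \<le> 1\<close>. The bounds see \<nu> only through
  \<open>b\<close> and \<open>a\<close>, which makes the final constants uniform in the
  intensity.\<close>

lemma rate_bounds:
  assumes \<nu>: "p0 = exp (- \<nu>)" "q = \<nu> * exp (- \<nu>)" and lo: "0 < b" "b \<le> \<nu>" and hi: "\<nu> \<le> a"
  shows "exp (- a) ^ K * (b * exp (- a) * exp (- a)) / 12 / K\<^sup>2 \<le> rate" "rate \<le> 1"
proof -
  have e: "0 < exp (- \<nu>)" "exp (- a) \<le> exp (- \<nu>)" "exp (- \<nu>) \<le> 1" using hi lo by auto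
  have q1: "exp (- a) \<le> 1 - q"
  proof -
    have "(1 + \<nu>) * exp (- \<nu>) \<le> exp \<nu> * exp (- \<nu>)" by (intro mult_right_mono exp_ge_add_one_self) auto
    also have "\<dots> = 1" by (simp add: exp_minus)
    finally have "exp (- \<nu>) \<le> 1 - q" by (simp add: \<nu> algebra_simps)
    then show ?thesis using e by linarith
  qed
  have q2: "b * exp (- a) \<le> q" unfolding \<nu> using lo e by (intro mult_mono) auto
  have q0: "0 \<le> q" using lo by (simp add: \<nu>)
  have "b * exp (- a) * exp (- a) \<le> q * (1 - q)" using q1 q2 q0 lo by (intro mult_mono) auto
  moreover have "exp (- a) ^ K \<le> p0 ^ K" unfolding \<nu>(1) using e by (intro power_mono) auto
  ultimately have "exp (- a) ^ K * (b * exp (- a) * exp (- a)) \<le> p0 ^ K * (q * (1 - q))"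
    using lo p0(1) by (intro mult_mono[of "exp (- a) ^ K"]) auto
  then show "exp (- a) ^ K * (b * exp (- a) * exp (- a)) / 12 / K\<^sup>2 \<le> rate"
    unfolding rate_def by (intro divide_right_mono) auto
  have "p0 ^ K * (q * (1 - q)) \<le> 1 * (1 * 1)"
  proof (intro mult_mono)
    have "0 \<le> 1 - q" using q1 exp_ge_zero[of "- a"] by linarith
    then show "0 \<le> q * (1 - q)" "1 - q \<le> 1" using q0 by auto
    then show "q \<le> 1" using \<open>0 \<le> 1 - q\<close> by simp
    show "0 \<le> 1 - q" by fact
    show "p0 ^ K \<le> 1" unfolding \<nu>(1) using e by (intro power_le_one) auto
  qed (use q0 in auto)
  then have "p0 ^ K * (q * (1 - q)) / 12 / K\<^sup>2 \<le> 1 / 12 / K\<^sup>2" by (intro divide_right_mono) auto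
  also have "\<dots> \<le> 1"
  proof -
    have "1 \<le> real K ^ 2" using K_pos by (intro one_le_power) auto
    then show ?thesis by (simp add: divide_le_eq)
  qed
  finally show "rate \<le> 1" by (simp add: rate_def)
qed

end

section \<open>Fourier analysis of lattice distributions\<close>

text \<open>For finite second moment this is the derivative of \<open>char P\<close> divided by
  \<open>\<i>\<close>. Without the factor \<open>\<i>\<close> its Fourier coefficients on a lattice
  are simply \<open>w * measure P {w}\<close>, up to \<open>2 * pi\<close>.\<close>

definition dchar :: "real measure \<Rightarrow> real \<Rightarrow> complex" where
  "dchar P \<theta> = (CLINT x|P. x * iexp (\<theta> * x))"

lemma (in real_distribution) integrable_self_of_square:
  assumes "integrable M (\<lambda>x. x\<^sup>2)"
  shows "integrable M (\<lambda>x. x :: real)"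
proof (rule Bochner_Integration.integrable_bound)
  show "integrable M (\<lambda>x. 1 + x\<^sup>2)" using assms by auto
  have "\<bar>x\<bar> \<le> 1 + x\<^sup>2" for x :: real
    using sum_squares_bound[of "\<bar>x\<bar>" 1] by (simp add: power2_eq_square)
  then show "AE x in M. norm x \<le> norm (1 + x\<^sup>2)" by auto
qed simp

text \<open>The bound \<open>u\<^sup>2 / 2\<close> for \<open>iexp u - 1 - \<i> * u\<close>,
  integrated, leaves a remainder of at most \<open>(y - \<theta>)\<^sup>2\<close> times the second
  moment.\<close>

lemma (in real_distribution) char_has_vector_derivative:
  assumes sq: "integrable M (\<lambda>x. x\<^sup>2)"
  shows "(char M has_vector_derivative \<i> * dchar M \<theta>) (at \<theta>)"
  unfolding has_vector_derivative_def has_derivative_at_alt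
proof (intro conjI allI impI)
  show "bounded_linear (\<lambda>h. h *\<^sub>R (\<i> * dchar M \<theta>))" by (rule bounded_linear_scaleR_left)
  define C where "C = (\<integral>x. x\<^sup>2 \<partial>M)"
  have C: "0 \<le> C" by (simp add: C_def)
  fix e :: real assume e: "0 < e"
  have int1: "integrable M (\<lambda>x. x * iexp (\<theta> * x))"
    by (rule Bochner_Integration.integrable_bound[OF integrable_self_of_square[OF sq]])
       (auto simp: norm_mult)
  have int0: "integrable M (\<lambda>x. iexp (t * x))" for t
    by (rule integrable_const_bound[of _ 1]) auto
  have bnd: "norm (char M y - char M \<theta> - (y - \<theta>) *\<^sub>R (\<i> * dchar M \<theta>)) \<le> (y - \<theta>)\<^sup>2 * C" for y
  proof -
    have eq: "char M y - char M \<theta> - (y - \<theta>) *\<^sub>R (\<i> * dchar M \<theta>)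
      = (CLINT x|M. iexp (y * x) - iexp (\<theta> * x) - \<i> * (y - \<theta>) * (x * iexp (\<theta> * x)))"
      by (simp only: Bochner_Integration.integral_diff Bochner_Integration.integrable_diff integrable_mult_right
          int0 int1 integral_mult_right_zero) (simp add: char_def dchar_def scaleR_conv_of_real mult_ac)
    have "norm (char M y - char M \<theta> - (y - \<theta>) *\<^sub>R (\<i> * dchar M \<theta>))
      \<le> (\<integral>x. norm (iexp (y * x) - iexp (\<theta> * x) - \<i> * (y - \<theta>) * (x * iexp (\<theta> * x))) \<partial>M)"
      unfolding eq by (rule integral_norm_bound)
    also have "\<dots> \<le> (\<integral>x. (y - \<theta>)\<^sup>2 * x\<^sup>2 \<partial>M)"
    proof (rule integral_mono')
      show "integrable M (\<lambda>x. (y - \<theta>)\<^sup>2 * x\<^sup>2)" using sq by auto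
      fix x
      have "iexp (y * x) - iexp (\<theta> * x) - \<i> * (y - \<theta>) * (x * iexp (\<theta> * x))
          = iexp (\<theta> * x) * (iexp ((y - \<theta>) * x) - 1 - \<i> * ((y - \<theta>) * x))"
      proof -
        have "iexp (y * x) = iexp (\<theta> * x) * iexp ((y - \<theta>) * x)"
          unfolding exp_add[symmetric] by (simp add: algebra_simps)
        then show ?thesis by (simp add: right_diff_distrib mult_ac)
      qed
      then have "norm (iexp (y * x) - iexp (\<theta> * x) - \<i> * (y - \<theta>) * (x * iexp (\<theta> * x)))
          = norm (iexp ((y - \<theta>) * x) - 1 - \<i> * ((y - \<theta>) * x))"
        by (simp only: norm_mult norm_exp_i_times mult_1)
      also have "\<dots> \<le> ((y - \<theta>) * x)\<^sup>2 / 2"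
        using iexp_approx1[of "(y - \<theta>) * x" 1] by (simp add: eval_nat_numeral diff_diff_eq)
      also have "\<dots> \<le> (y - \<theta>)\<^sup>2 * x\<^sup>2"
        by (simp add: power_mult_distrib)
      finally show "norm (iexp (y * x) - iexp (\<theta> * x) - \<i> * (y - \<theta>) * (x * iexp (\<theta> * x))) \<le> (y - \<theta>)\<^sup>2 * x\<^sup>2" .
    qed auto
    finally show ?thesis by (simp add: C_def)
  qed
  show "\<exists>d>0. \<forall>y. norm (y - \<theta>) < d \<longrightarrow>
      norm (char M y - char M \<theta> - (y - \<theta>) *\<^sub>R (\<i> * dchar M \<theta>)) \<le> e * norm (y - \<theta>)"
  proof (intro exI[of _ "e / (C + 1)"] conjI allI impI)
    show "0 < e / (C + 1)" using C e by simp
    fix y assume y: "norm (y - \<theta>) < e / (C + 1)"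
    have "(y - \<theta>)\<^sup>2 * C \<le> \<bar>y - \<theta>\<bar> * (\<bar>y - \<theta>\<bar> * (C + 1))"
    proof -
      have "(y - \<theta>)\<^sup>2 = \<bar>y - \<theta>\<bar> * \<bar>y - \<theta>\<bar>" by (simp add: power2_eq_square)
      then show ?thesis by (simp only: mult.assoc ring_distribs) simp
    qed
    also have "\<dots> \<le> \<bar>y - \<theta>\<bar> * e"
      using y C by (intro mult_left_mono) (auto simp: pos_less_divide_eq)
    finally show "norm (char M y - char M \<theta> - (y - \<theta>) *\<^sub>R (\<i> * dchar M \<theta>)) \<le> e * norm (y - \<theta>)"
      using bnd[of y] by (simp add: mult.commute)
  qed
qed

lemma (in real_distribution) isCont_dchar:
  assumes sq: "integrable M (\<lambda>x. x\<^sup>2)"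
  shows "isCont (dchar M) t"
  unfolding continuous_at_sequentially
proof safe
  fix X assume X: "X \<longlonglongrightarrow> t"
  show "(dchar M \<circ> X) \<longlonglongrightarrow> dchar M t"
    unfolding comp_def dchar_def
    by (rule integral_dominated_convergence[where w = "\<lambda>x. \<bar>x\<bar>"])
       (use integrable_self_of_square[OF sq] in \<open>auto intro!: tendsto_intros X simp: norm_mult\<close>)
qed

section \<open>Fourier inversion and Bessel's inequality on a shifted lattice\<close>

lemma integral_iexp_int:
  fixes u :: real
  assumes "u \<in> \<int>"
  shows "integral {-pi..pi} (\<lambda>\<theta>. iexp (\<theta> * u)) = (if u = 0 then 2 * pi else 0)"
proof (cases "u = 0")
  case True
  then show ?thesis by (simp add: scaleR_conv_of_real)
next
  case False
  have "((\<lambda>\<theta>. iexp (\<theta> * u)) has_integral (iexp (pi * u) / (\<i> * u) - iexp (- pi * u) / (\<i> * u))) {-pi..pi}"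
  proof (rule fundamental_theorem_of_calculus)
    fix x assume "x \<in> {-pi..pi}"
    have "((\<lambda>\<theta>. iexp (\<theta> * u)) has_vector_derivative u *\<^sub>R (\<i> * iexp (x * u))) (at x within {-pi..pi})"
      by (rule vector_diff_chain_within[of "\<lambda>\<theta>. \<theta> * u" u _ _ iexp, unfolded comp_def])
         (auto intro!: derivative_eq_intros)
    then have "((\<lambda>\<theta>. iexp (\<theta> * u) / (\<i> * u)) has_vector_derivative (u *\<^sub>R (\<i> * iexp (x * u))) / (\<i> * u)) (at x within {-pi..pi})"
      by (rule has_vector_derivative_divide)
    also have "(u *\<^sub>R (\<i> * iexp (x * u))) / (\<i> * u) = iexp (x * u)"
      using False by (simp add: scaleR_conv_of_real)
    finally show "((\<lambda>\<theta>. iexp (\<theta> * u) / (\<i> * u)) has_vector_derivative iexp (x * u)) (at x within {-pi..pi})" .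
  qed simp
  also have "iexp (pi * u) = iexp (- pi * u)"
  proof -
    obtain k where k: "u = of_int k" using assms Ints_cases by blast
    have "iexp (pi * u) = iexp (- pi * u) * exp (2 * of_int k * pi * \<i>)"
      unfolding exp_add[symmetric] by (simp add: k algebra_simps)
    also have "exp (2 * of_int k * pi * \<i>) = 1" by (rule exp_integer_2pi) simp
    finally show ?thesis by simp
  qed
  finally show ?thesis using False by (simp add: integral_unique)
qed

text \<open>Fubini exchanges the integrals and orthogonality keeps only the atom at
  \<open>w\<close>. The weight serves two cases, \<open>f x = 1\<close> for \<open>char\<close> and
  \<open>f x = x\<close> for \<open>dchar\<close>. Integrality is asked of \<open>x - w\<close>
  only, so the lattice may be shifted.\<close>

lemma (in real_distribution) fourier_coefficient:
  fixes f :: "real \<Rightarrow> real"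
  assumes f: "integrable M f" and lat: "AE x in M. x - w \<in> \<int>"
    and F: "\<And>\<theta>. F \<theta> = (CLINT x|M. f x * iexp (\<theta> * x))" and cont: "continuous_on UNIV F"
  shows "integral {-pi..pi} (\<lambda>\<theta>. F \<theta> * iexp (- \<theta> * w)) = 2 * pi * f w * measure M {w}"
proof -
  have [measurable]: "f \<in> borel_measurable M" using f by auto
  interpret pair_sigma_finite M lborel ..
  define g where "g x \<theta> = indicator {-pi..pi} \<theta> *\<^sub>R (f x * iexp (\<theta> * (x - w)))" for x \<theta>
  have gm [measurable]: "case_prod g \<in> borel_measurable (M \<Otimes>\<^sub>M lborel)"
    unfolding g_def by measurable
  have gint: "(CLINT \<theta>|lborel. g x \<theta>) = f x * integral {-pi..pi} (\<lambda>\<theta>. iexp (\<theta> * (x - w)))" for x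
  proof -
    have "set_integrable lborel {-pi..pi} (\<lambda>\<theta>. iexp (\<theta> * (x - w)))"
      by (intro borel_integrable_atLeastAtMost') (intro continuous_intros)
    then have "(CLINT \<theta>:{-pi..pi}|lborel. iexp (\<theta> * (x - w))) = integral {-pi..pi} (\<lambda>\<theta>. iexp (\<theta> * (x - w)))"
      by (rule set_borel_integral_eq_integral)
    moreover have "g x \<theta> = f x * (indicator {-pi..pi} \<theta> *\<^sub>R iexp (\<theta> * (x - w)))" for \<theta>
      by (simp add: g_def)
    ultimately show ?thesis by (simp only: integral_mult_right_zero set_lebesgue_integral_def)
  qed
  have nint: "(\<integral>\<theta>. norm (g x \<theta>) \<partial>lborel) = 2 * pi * \<bar>f x\<bar>" for x
  proof -
    have "norm (g x \<theta>) = \<bar>f x\<bar> * indicator {-pi..pi} \<theta>" for \<theta>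
      by (simp add: g_def norm_mult del: of_real_diff of_real_mult)
    then show ?thesis by simp
  qed
  have int: "integrable (M \<Otimes>\<^sub>M lborel) (case_prod g)"
  proof (rule Fubini_integrable[OF gm])
    show "integrable M (\<lambda>x. \<integral>y. norm (case_prod g (x, y)) \<partial>lborel)"
      using f by (simp add: nint)
    show "AE x in M. integrable lborel (\<lambda>y. case_prod g (x, y))"
    proof (intro AE_I2)
      fix x
      have "set_integrable lborel {-pi..pi} (\<lambda>\<theta>. f x * iexp (\<theta> * (x - w)))"
        by (intro borel_integrable_atLeastAtMost') (intro continuous_intros)
      then show "integrable lborel (\<lambda>y. case_prod g (x, y))" by (simp add: set_integrable_def g_def)
    qed
  qed
  have "integral {-pi..pi} (\<lambda>\<theta>. F \<theta> * iexp (- \<theta> * w)) = (CLINT \<theta>:{-pi..pi}|lborel. F \<theta> * iexp (- \<theta> * w))"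
  proof (rule set_borel_integral_eq_integral(2)[symmetric])
    show "set_integrable lborel {-pi..pi} (\<lambda>\<theta>. F \<theta> * iexp (- \<theta> * w))"
      by (intro borel_integrable_atLeastAtMost' continuous_intros continuous_on_subset[OF cont]) auto
  qed
  also have "\<dots> = (CLINT \<theta>|lborel. CLINT x|M. g x \<theta>)"
    unfolding set_lebesgue_integral_def
  proof (rule Bochner_Integration.integral_cong[OF refl])
    fix \<theta> :: real
    have "g x \<theta> = indicator {-pi..pi} \<theta> *\<^sub>R ((f x * iexp (\<theta> * x)) * iexp (- \<theta> * w))" for x
    proof -
      have "iexp (\<theta> * (x - w)) = iexp (\<theta> * x) * iexp (- \<theta> * w)"
        unfolding exp_add[symmetric] by (simp add: algebra_simps)
      then show ?thesis by (simp only: g_def mult.assoc)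
    qed
    then show "indicator {-pi..pi} \<theta> *\<^sub>R (F \<theta> * iexp (- \<theta> * w)) = (CLINT x|M. g x \<theta>)"
      by (simp only: F integral_scaleR_right integral_mult_left_zero)
  qed
  also have "\<dots> = (CLINT x|M. CLINT \<theta>|lborel. g x \<theta>)" by (rule Fubini_integral[OF int])
  also have "\<dots> = (CLINT x|M. complex_of_real (2 * pi * f w * indicator {w} x))"
    unfolding gint
  proof (rule Bochner_Integration.integral_cong_AE)
    show "AE x in M. f x * integral {-pi..pi} (\<lambda>\<theta>. iexp (\<theta> * (x - w))) = complex_of_real (2 * pi * f w * indicator {w} x)"
      using lat
    proof eventually_elim
      case (elim x)
      show ?case unfolding integral_iexp_int[OF elim] by (auto simp: indicator_def)
    qed
    have "(\<lambda>x. CLINT \<theta>|lborel. g x \<theta>) \<in> borel_measurable M" by measurable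
    then show "(\<lambda>x. f x * integral {-pi..pi} (\<lambda>\<theta>. iexp (\<theta> * (x - w)))) \<in> borel_measurable M"
      unfolding gint .
  qed measurable
  also have "\<dots> = 2 * pi * f w * measure M {w}"
    by (subst integral_complex_of_real) simp
  finally show ?thesis .
qed

text \<open>Orthogonality of the functions \<open>iexp (\<theta> * w)\<close> uses only that the
  differences of the frequencies are integers. \<open>S\<close> is the orthogonal projection of
  \<open>D\<close> onto their span, and the claim is the integral of
  \<open>0 \<le> (norm (D \<theta> - S \<theta>))\<^sup>2\<close>.\<close>

lemma bessel_inequality:
  fixes D c :: "real \<Rightarrow> complex"
  assumes D: "continuous_on {-pi..pi} D" and F: "finite F" "\<And>w w'. w \<in> F \<Longrightarrow> w' \<in> F \<Longrightarrow> w - w' \<in> \<int>"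
    and c: "\<And>w. w \<in> F \<Longrightarrow> integral {-pi..pi} (\<lambda>\<theta>. D \<theta> * iexp (- \<theta> * w)) = 2 * pi * c w"
  shows "2 * pi * (\<Sum>w\<in>F. (norm (c w))\<^sup>2) \<le> integral {-pi..pi} (\<lambda>\<theta>. (norm (D \<theta>))\<^sup>2)"
proof -
  let ?I = "integral {-pi..pi} :: (real \<Rightarrow> complex) \<Rightarrow> complex"
  define S where "S \<theta> = (\<Sum>w\<in>F. c w * iexp (\<theta> * w))" for \<theta> :: real
  have Sc [continuous_intros]: "continuous_on {-pi..pi} S" unfolding S_def by (intro continuous_intros)
  note D [continuous_intros]
  have coeff: "?I (\<lambda>\<theta>. (D \<theta> - S \<theta>) * iexp (- \<theta> * w)) = 0" if w: "w \<in> F" for w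
  proof -
    have "?I (\<lambda>\<theta>. S \<theta> * iexp (- \<theta> * w)) = (\<Sum>w'\<in>F. c w' * ?I (\<lambda>\<theta>. iexp (\<theta> * (w' - w))))"
    proof -
      have "S \<theta> * iexp (- \<theta> * w) = (\<Sum>w'\<in>F. c w' * iexp (\<theta> * (w' - w)))" for \<theta>
      proof -
        have "iexp (\<theta> * (w' - w)) = iexp (\<theta> * w') * iexp (- \<theta> * w)" for w'
          unfolding exp_add[symmetric] by (simp add: algebra_simps)
        then show ?thesis unfolding S_def by (simp only: sum_distrib_right mult.assoc)
      qed
      then have "?I (\<lambda>\<theta>. S \<theta> * iexp (- \<theta> * w)) = ?I (\<lambda>\<theta>. \<Sum>w'\<in>F. c w' * iexp (\<theta> * (w' - w)))" by simp
      also have "\<dots> = (\<Sum>w'\<in>F. ?I (\<lambda>\<theta>. c w' * iexp (\<theta> * (w' - w))))"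
        by (intro integral_sum F integrable_continuous_interval continuous_intros)
      finally show ?thesis by (simp only: integral_mult_right)
    qed
    also have "\<dots> = (\<Sum>w'\<in>F. if w' = w then 2 * pi * c w else 0)"
    proof (intro sum.cong refl)
      fix w' assume w': "w' \<in> F"
      show "c w' * ?I (\<lambda>\<theta>. iexp (\<theta> * (w' - w))) = (if w' = w then 2 * pi * c w else 0)"
        unfolding integral_iexp_int[OF F(2)[OF w' w]] by simp
    qed
    also have "\<dots> = 2 * pi * c w" using w F by simp
    finally have s: "?I (\<lambda>\<theta>. S \<theta> * iexp (- \<theta> * w)) = 2 * pi * c w" .
    have "?I (\<lambda>\<theta>. (D \<theta> - S \<theta>) * iexp (- \<theta> * w)) = ?I (\<lambda>\<theta>. D \<theta> * iexp (- \<theta> * w) - S \<theta> * iexp (- \<theta> * w))"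
      by (simp only: left_diff_distrib)
    also have "\<dots> = ?I (\<lambda>\<theta>. D \<theta> * iexp (- \<theta> * w)) - ?I (\<lambda>\<theta>. S \<theta> * iexp (- \<theta> * w))"
      by (intro integral_diff integrable_continuous_interval continuous_intros)
    finally show ?thesis using s c[OF w] by simp
  qed
  have cS: "cnj (S \<theta>) = (\<Sum>w\<in>F. cnj (c w) * iexp (- \<theta> * w))" for \<theta>
    by (simp add: S_def exp_cnj)
  have orth: "?I (\<lambda>\<theta>. (D \<theta> - S \<theta>) * cnj (S \<theta>)) = 0"
  proof -
    have "?I (\<lambda>\<theta>. (D \<theta> - S \<theta>) * cnj (S \<theta>)) = ?I (\<lambda>\<theta>. \<Sum>w\<in>F. cnj (c w) * ((D \<theta> - S \<theta>) * iexp (- \<theta> * w)))"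
      unfolding cS sum_distrib_left by (simp only: mult.left_commute)
    also have "\<dots> = (\<Sum>w\<in>F. ?I (\<lambda>\<theta>. cnj (c w) * ((D \<theta> - S \<theta>) * iexp (- \<theta> * w))))"
      by (intro integral_sum F integrable_continuous_interval continuous_intros)
    also have "\<dots> = 0" unfolding integral_mult_right by (intro sum.neutral ballI) (simp only: coeff mult_zero_right)
    finally show ?thesis .
  qed
  have DS: "?I (\<lambda>\<theta>. D \<theta> * cnj (S \<theta>)) = 2 * pi * (\<Sum>w\<in>F. (norm (c w))\<^sup>2)"
  proof -
    have "?I (\<lambda>\<theta>. D \<theta> * cnj (S \<theta>)) = ?I (\<lambda>\<theta>. \<Sum>w\<in>F. cnj (c w) * (D \<theta> * iexp (- \<theta> * w)))"
      unfolding cS sum_distrib_left by (simp only: mult.left_commute)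
    also have "\<dots> = (\<Sum>w\<in>F. ?I (\<lambda>\<theta>. cnj (c w) * (D \<theta> * iexp (- \<theta> * w))))"
      by (intro integral_sum F integrable_continuous_interval continuous_intros)
    also have "\<dots> = (\<Sum>w\<in>F. cnj (c w) * (2 * pi * c w))"
      by (intro sum.cong refl) (simp only: integral_mult_right c)
    also have "\<dots> = (\<Sum>w\<in>F. of_real (2 * pi) * of_real ((norm (c w))\<^sup>2))"
      by (intro sum.cong refl) (simp only: complex_norm_square of_real_mult of_real_numeral mult_ac)
    finally show ?thesis by (simp add: sum_distrib_left)
  qed
  have rint: "integral {-pi..pi} (\<lambda>\<theta>. Re (g \<theta>)) = Re (?I g)" if "continuous_on {-pi..pi} g" for g
    using integral_linear[OF integrable_continuous_interval[OF that] bounded_linear_Re] by (simp add: comp_def)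
  \<comment> \<open>The left side equals \<open>2 * Re (D \<theta> * cnj (S \<theta>)) - (norm (S
    \<theta>))\<^sup>2\<close>; written as here, its second summand integrates to 0 by
    \<open>orth\<close>.\<close>
  have pw: "Re (D \<theta> * cnj (S \<theta>)) + Re ((D \<theta> - S \<theta>) * cnj (S \<theta>)) \<le> (norm (D \<theta>))\<^sup>2" for \<theta>
  proof -
    have "0 \<le> (norm (D \<theta> - S \<theta>))\<^sup>2" by simp
    then show ?thesis unfolding cmod_power2 by (simp add: power2_eq_square algebra_simps)
  qed
  have "2 * pi * (\<Sum>w\<in>F. (norm (c w))\<^sup>2) = Re (?I (\<lambda>\<theta>. D \<theta> * cnj (S \<theta>))) + Re (?I (\<lambda>\<theta>. (D \<theta> - S \<theta>) * cnj (S \<theta>)))"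
    unfolding DS orth by simp
  also have "\<dots> = integral {-pi..pi} (\<lambda>\<theta>. Re (D \<theta> * cnj (S \<theta>))) + integral {-pi..pi} (\<lambda>\<theta>. Re ((D \<theta> - S \<theta>) * cnj (S \<theta>)))"
    by (intro arg_cong2[where f = "(+)"] rint[symmetric] continuous_intros)
  also have "\<dots> = integral {-pi..pi} (\<lambda>\<theta>. Re (D \<theta> * cnj (S \<theta>)) + Re ((D \<theta> - S \<theta>) * cnj (S \<theta>)))"
    by (intro integral_add[symmetric] integrable_continuous_interval continuous_intros)
  also have "\<dots> \<le> integral {-pi..pi} (\<lambda>\<theta>. (norm (D \<theta>))\<^sup>2)"
    by (intro integral_le integrable_continuous_interval continuous_intros pw)
  finally show ?thesis .
qed

section \<open>Sums and integrals of inverse quadratic weights\<close>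

text \<open>The terms after the first are dominated by the telescoping differences
  \<open>1 / (s + n) - 1 / (s + n + 1)\<close> and add up to at most \<open>1 / s\<close>; the first
  one is \<open>1 / s\<^sup>2 \<le> 1 / s\<close>.\<close>

lemma sum_inverse_square_shift_le:
  fixes s :: real
  assumes "1 \<le> s"
  shows "(\<Sum>k<n. 1 / (s + real k)\<^sup>2) \<le> 2 / s"
proof -
  have "(\<Sum>k<Suc n. 1 / (s + real k)\<^sup>2) \<le> 1 / s\<^sup>2 + 1 / s - 1 / (s + n)" for n
  proof (induction n)
    case (Suc n)
    have p: "0 < s + real n" "0 < s + real n + 1" using assms by auto
    have "1 / (s + real (Suc n))\<^sup>2 \<le> 1 / ((s + n) * (s + n + 1))"
      using p by (intro divide_left_mono) (auto simp: power2_eq_square intro!: mult_mono)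
    also have "\<dots> = 1 / (s + n) - 1 / (s + Suc n)" using p by (simp add: field_simps)
    finally show ?case using Suc by simp
  qed simp
  moreover have "1 / s\<^sup>2 \<le> 1 / s" using assms by (intro divide_left_mono) (auto simp: power2_eq_square)
  moreover have "0 \<le> 1 / (s + n)" for n :: nat using assms by simp
  moreover have "(\<Sum>k<n. 1 / (s + real k)\<^sup>2) \<le> (\<Sum>k<Suc n. 1 / (s + real k)\<^sup>2)" by simp
  ultimately show ?thesis by (smt (verit) add_divide_distrib)
qed

text \<open>On each half-line the integer part \<open>k\<close> of \<open>\<bar>w\<bar>\<close>
  determines the lattice point, and \<open>1 + w\<^sup>2 / s\<^sup>2 \<ge> (s + k)\<^sup>2 / (2 *
  s\<^sup>2)\<close>; each half thus contributes at most
  \<open>2 * s\<^sup>2 * (2 / s)\<close>.\<close>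

lemma lattice_sum_le:
  fixes s :: real
  assumes s: "1 \<le> s" and F: "finite F" "\<And>w w'. w \<in> F \<Longrightarrow> w' \<in> F \<Longrightarrow> w - w' \<in> \<int>"
  shows "(\<Sum>w\<in>F. 1 / (1 + w\<^sup>2 / s\<^sup>2)) \<le> 8 * s"
proof -
  have half: "(\<Sum>w\<in>G. 1 / (1 + w\<^sup>2 / s\<^sup>2)) \<le> 4 * s"
    if G: "G \<subseteq> F" and sgn: "(\<forall>w\<in>G. 0 \<le> w) \<or> (\<forall>w\<in>G. w \<le> 0)" for G
  proof -
    define k where "k w = nat \<lfloor>\<bar>w\<bar>\<rfloor>" for w :: real
    have fin: "finite G" using finite_subset[OF G F(1)] .
    have inj: "inj_on k G"
    proof (rule inj_onI)
      fix w w' assume w: "w \<in> G" "w' \<in> G" and eq: "k w = k w'"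
      then obtain z where z: "w - w' = of_int z" using F(2)[of w w'] subsetD[OF G] by (auto elim: Ints_cases)
      have "\<lfloor>\<bar>w\<bar>\<rfloor> = \<lfloor>\<bar>w'\<bar>\<rfloor>" using eq by (simp add: k_def eq_nat_nat_iff)
      then have "\<bar>\<bar>w\<bar> - \<bar>w'\<bar>\<bar> < 1" by linarith
      moreover have "\<bar>\<bar>w\<bar> - \<bar>w'\<bar>\<bar> = \<bar>w - w'\<bar>" using sgn w by auto
      ultimately have "\<bar>of_int z :: real\<bar> < 1" by (simp add: z)
      then have "z = 0" by linarith
      then show "w = w'" using z by simp
    qed
    have "(\<Sum>w\<in>G. 1 / (1 + w\<^sup>2 / s\<^sup>2)) \<le> (\<Sum>w\<in>G. 2 * s\<^sup>2 * (1 / (s + real (k w))\<^sup>2))"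
    proof (rule sum_mono)
      fix w
      have kw: "real (k w) \<le> \<bar>w\<bar>" unfolding k_def by simp
      have "(s + real (k w))\<^sup>2 \<le> (s + \<bar>w\<bar>)\<^sup>2" using kw s by (intro power_mono) auto
      also have "\<dots> \<le> 2 * (s\<^sup>2 + w\<^sup>2)"
        using sum_squares_bound[of s "\<bar>w\<bar>"] by (simp add: power2_eq_square algebra_simps)
      finally have 1: "(s + real (k w))\<^sup>2 \<le> 2 * (s\<^sup>2 + w\<^sup>2)" .
      have p: "0 < s\<^sup>2 + w\<^sup>2" "0 < (s + real (k w))\<^sup>2" using s by (auto intro: add_pos_nonneg)
      have "1 / (1 + w\<^sup>2 / s\<^sup>2) = s\<^sup>2 / (s\<^sup>2 + w\<^sup>2)" using s by (simp add: field_simps)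
      also have "\<dots> = 2 * s\<^sup>2 * (1 / (2 * (s\<^sup>2 + w\<^sup>2)))" by (simp only: times_divide_eq_right mult_1_right mult_divide_mult_cancel_left_if) simp
      also have "\<dots> \<le> 2 * s\<^sup>2 * (1 / (s + real (k w))\<^sup>2)"
        using p 1 by (intro mult_left_mono divide_left_mono) auto
      finally show "1 / (1 + w\<^sup>2 / s\<^sup>2) \<le> 2 * s\<^sup>2 * (1 / (s + real (k w))\<^sup>2)" .
    qed
    also have "\<dots> = 2 * s\<^sup>2 * (\<Sum>j\<in>k ` G. 1 / (s + real j)\<^sup>2)"
      by (simp add: sum.reindex[OF inj] sum_distrib_left)
    also have "(\<Sum>j\<in>k ` G. 1 / (s + real j)\<^sup>2) \<le> (\<Sum>j<Suc (Max (insert 0 (k ` G))). 1 / (s + real j)\<^sup>2)"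
      using fin by (intro sum_mono2) (auto simp: less_Suc_eq_le)
    also have "\<dots> \<le> 2 / s" by (rule sum_inverse_square_shift_le[OF s])
    finally show ?thesis using s by (simp add: power2_eq_square mult_left_mono)
  qed
  have "(\<Sum>w\<in>F. 1 / (1 + w\<^sup>2 / s\<^sup>2)) = (\<Sum>w\<in>{w\<in>F. 0 \<le> w}. 1 / (1 + w\<^sup>2 / s\<^sup>2)) + (\<Sum>w\<in>{w\<in>F. w < 0}. 1 / (1 + w\<^sup>2 / s\<^sup>2))"
    using F(1) by (subst sum.union_disjoint[symmetric]) (auto intro!: sum.cong)
  also have "\<dots> \<le> 4 * s + 4 * s" by (intro add_mono half) auto
  finally show ?thesis by simp
qed

lemma integral_inverse_quadratic_le:
  fixes s :: real
  assumes "0 < s"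
  shows "integral {-pi..pi} (\<lambda>\<theta>. 1 / (1 + s\<^sup>2 * \<theta>\<^sup>2)) \<le> pi / s"
proof -
  have "((\<lambda>\<theta>. 1 / (1 + s\<^sup>2 * \<theta>\<^sup>2)) has_integral (arctan (s * pi) / s - arctan (s * (- pi)) / s)) {-pi..pi}"
  proof (rule fundamental_theorem_of_calculus)
    fix x :: real
    have "((\<lambda>\<theta>. arctan (s * \<theta>) / s) has_real_derivative 1 / (1 + s\<^sup>2 * x\<^sup>2)) (at x within {-pi..pi})"
      using assms by (auto intro!: derivative_eq_intros simp: power_mult_distrib inverse_eq_divide)
    then show "((\<lambda>\<theta>. arctan (s * \<theta>) / s) has_vector_derivative 1 / (1 + s\<^sup>2 * x\<^sup>2)) (at x within {-pi..pi})"
      by (simp add: has_real_derivative_iff_has_vector_derivative)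
  qed simp
  then have "integral {-pi..pi} (\<lambda>\<theta>. 1 / (1 + s\<^sup>2 * \<theta>\<^sup>2)) = 2 * arctan (s * pi) / s"
    by (simp add: integral_unique arctan_minus)
  also have "\<dots> \<le> pi / s"
    using arctan_ubound[of "s * pi"] assms by (intro divide_right_mono) auto
  finally show ?thesis .
qed

section \<open>From characteristic functions to the two distances\<close>

text \<open>The bound for the difference of the \<open>char\<close> is smaller by the factor
  \<open>s\<close> than that for the \<open>dchar\<close>, which matches the weight
  \<open>1 + w\<^sup>2 / s\<^sup>2\<close>: Bessel bounds the weighted sum of the
  \<open>(d w)\<^sup>2\<close> by \<open>B\<^sup>2 / (s\<^sup>2 * s)\<close>, and Cauchy-Schwarz
  against \<open>lattice_sum_le\<close> costs a factor \<open>8 * s\<close>. The bound for one atom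
  is plain inversion, with an integral of at most \<open>pi / s\<close>.\<close>

lemma lattice_measure_bounds:
  fixes P Q :: "real measure" and s B \<mu> :: real
  assumes P: "real_distribution P" and Q: "real_distribution Q"
    and P2: "integrable P (\<lambda>x. x\<^sup>2)" and Q2: "integrable Q (\<lambda>x. x\<^sup>2)"
    and latP: "AE x in P. x + \<mu> \<in> \<int>" and latQ: "AE x in Q. x + \<mu> \<in> \<int>"
    and s: "1 \<le> s" and B: "0 \<le> B"
    and D: "\<And>\<theta>. \<bar>\<theta>\<bar> \<le> pi \<Longrightarrow> norm (char P \<theta> - char Q \<theta>) \<le> B / s * (1 / (1 + s\<^sup>2 * \<theta>\<^sup>2))"
    and D': "\<And>\<theta>. \<bar>\<theta>\<bar> \<le> pi \<Longrightarrow> norm (dchar P \<theta> - dchar Q \<theta>) \<le> B * (1 / (1 + s\<^sup>2 * \<theta>\<^sup>2))"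
  shows "w + \<mu> \<in> \<int> \<Longrightarrow> \<bar>measure P {w} - measure Q {w}\<bar> \<le> B / (2 * s\<^sup>2)"
    and "finite F \<Longrightarrow> (\<And>w. w \<in> F \<Longrightarrow> w + \<mu> \<in> \<int>) \<Longrightarrow> (\<Sum>w\<in>F. \<bar>measure P {w} - measure Q {w}\<bar>) \<le> 3 * B / s"
proof -
  interpret P: real_distribution P by (rule P)
  interpret Q: real_distribution Q by (rule Q)
  define d where "d w = measure P {w} - measure Q {w}" for w
  define I where "I = integral {-pi..pi} (\<lambda>\<theta>. 1 / (1 + s\<^sup>2 * \<theta>\<^sup>2))"
  have I: "0 \<le> I" "I \<le> pi / s"
    unfolding I_def using integral_inverse_quadratic_le[of s] s by (auto intro!: integral_nonneg integrable_continuous_interval continuous_intros simp: add_nonneg_eq_0_iff)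
  have contc [continuous_intros]: "continuous_on S (char P)" "continuous_on S (char Q)"
      "continuous_on S (dchar P)" "continuous_on S (dchar Q)" for S
    using P.isCont_char Q.isCont_char P.isCont_dchar[OF P2] Q.isCont_dchar[OF Q2]
    by (auto intro: continuous_at_imp_continuous_on)
  have contq [continuous_intros]: "continuous_on S (\<lambda>\<theta>::real. 1 / (1 + s\<^sup>2 * \<theta>\<^sup>2))" for S
    by (intro continuous_intros) (auto simp: add_nonneg_eq_0_iff)
  have lat: "AE x in P. x - w \<in> \<int>" "AE x in Q. x - w \<in> \<int>" if "w + \<mu> \<in> \<int>" for w
  proof -
    have *: "x - w \<in> \<int>" if "x + \<mu> \<in> \<int>" for x
      using Ints_diff[OF that \<open>w + \<mu> \<in> \<int>\<close>] by (simp add: algebra_simps)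
    show "AE x in P. x - w \<in> \<int>" "AE x in Q. x - w \<in> \<int>"
      using latP latQ by (auto elim!: eventually_mono intro: *)
  qed
  have split: "integral {-pi..pi} (\<lambda>\<theta>. (f \<theta> - g \<theta>) * iexp (- \<theta> * w)) =
     integral {-pi..pi} (\<lambda>\<theta>. f \<theta> * iexp (- \<theta> * w)) - integral {-pi..pi} (\<lambda>\<theta>. g \<theta> * iexp (- \<theta> * w))"
    if "continuous_on UNIV f" "continuous_on UNIV g" for f g :: "real \<Rightarrow> complex" and w :: real
    unfolding left_diff_distrib
    by (intro integral_diff integrable_continuous_interval continuous_intros continuous_on_subset[OF that(1)] continuous_on_subset[OF that(2)]) auto
  have c0: "integral {-pi..pi} (\<lambda>\<theta>. (char P \<theta> - char Q \<theta>) * iexp (- \<theta> * w)) = 2 * pi * complex_of_real (d w)"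
    if w: "w + \<mu> \<in> \<int>" for w
  proof -
    have "integral {-pi..pi} (\<lambda>\<theta>. char P \<theta> * iexp (- \<theta> * w)) = 2 * pi * 1 * measure P {w}"
      by (rule P.fourier_coefficient[where f = "\<lambda>_. 1"]) (use lat[OF w] contc in \<open>auto simp: char_def\<close>)
    moreover have "integral {-pi..pi} (\<lambda>\<theta>. char Q \<theta> * iexp (- \<theta> * w)) = 2 * pi * 1 * measure Q {w}"
      by (rule Q.fourier_coefficient[where f = "\<lambda>_. 1"]) (use lat[OF w] contc in \<open>auto simp: char_def\<close>)
    ultimately show ?thesis unfolding split[OF contc(1,2)] d_def by (simp add: algebra_simps)
  qed
  have c1: "integral {-pi..pi} (\<lambda>\<theta>. (dchar P \<theta> - dchar Q \<theta>) * iexp (- \<theta> * w)) = 2 * pi * complex_of_real (w * d w)"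
    if w: "w + \<mu> \<in> \<int>" for w
  proof -
    have "integral {-pi..pi} (\<lambda>\<theta>. dchar P \<theta> * iexp (- \<theta> * w)) = 2 * pi * w * measure P {w}"
      by (rule P.fourier_coefficient[where f = "\<lambda>x. x"])
         (use lat[OF w] contc P.integrable_self_of_square[OF P2] in \<open>auto simp: dchar_def\<close>)
    moreover have "integral {-pi..pi} (\<lambda>\<theta>. dchar Q \<theta> * iexp (- \<theta> * w)) = 2 * pi * w * measure Q {w}"
      by (rule Q.fourier_coefficient[where f = "\<lambda>x. x"])
         (use lat[OF w] contc Q.integrable_self_of_square[OF Q2] in \<open>auto simp: dchar_def\<close>)
    ultimately show ?thesis unfolding split[OF contc(3,4)] d_def by (simp add: algebra_simps)
  qed
  show "\<bar>measure P {w} - measure Q {w}\<bar> \<le> B / (2 * s\<^sup>2)" if w: "w + \<mu> \<in> \<int>" for w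
  proof -
    have "norm (integral {-pi..pi} (\<lambda>\<theta>. (char P \<theta> - char Q \<theta>) * iexp (- \<theta> * w)))
        \<le> integral {-pi..pi} (\<lambda>\<theta>. B / s * (1 / (1 + s\<^sup>2 * \<theta>\<^sup>2)))"
      by (intro integral_norm_bound_integral integrable_continuous_interval continuous_intros)
         (use D s in \<open>auto simp: norm_mult add_nonneg_eq_0_iff\<close>)
    also have "\<dots> = B / s * I" unfolding I_def by (rule integral_mult_right)
    also have "\<dots> \<le> B / s * (pi / s)" using I B s by (intro mult_left_mono) auto
    finally have "2 * pi * \<bar>d w\<bar> \<le> B / s * (pi / s)"
      unfolding c0[OF w] by (simp add: norm_mult)
    then show ?thesis using s by (simp add: d_def field_simps power2_eq_square)
  qed
  show "(\<Sum>w\<in>F. \<bar>measure P {w} - measure Q {w}\<bar>) \<le> 3 * B / s"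
    if fin: "finite F" and F: "\<And>w. w \<in> F \<Longrightarrow> w + \<mu> \<in> \<int>" for F
  proof -
    have Fd: "w - w' \<in> \<int>" if "w \<in> F" "w' \<in> F" for w w'
      using Ints_diff[OF F[OF that(1)] F[OF that(2)]] by (simp add: algebra_simps)
    \<comment> \<open>The weight is at most 1, so its square is at most itself and the integral
      \<open>I\<close> serves for the squared norms as well.\<close>
    have sq: "(1 / (1 + s\<^sup>2 * \<theta>\<^sup>2))\<^sup>2 \<le> 1 / (1 + s\<^sup>2 * \<theta>\<^sup>2)" for \<theta> :: real
    proof -
      have "0 \<le> 1 / (1 + s\<^sup>2 * \<theta>\<^sup>2)" "1 / (1 + s\<^sup>2 * \<theta>\<^sup>2) \<le> 1" by (auto simp: divide_le_eq_1 add_pos_nonneg)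
      then show ?thesis unfolding power2_eq_square[of "1 / _"] by (intro mult_left_le)
    qed
    have norm_sq: "integral {-pi..pi} (\<lambda>\<theta>. (norm (f \<theta>))\<^sup>2) \<le> b\<^sup>2 * I"
      if f: "continuous_on {-pi..pi} f" and b: "\<And>\<theta>. \<bar>\<theta>\<bar> \<le> pi \<Longrightarrow> norm (f \<theta>) \<le> b * (1 / (1 + s\<^sup>2 * \<theta>\<^sup>2))"
      for f :: "real \<Rightarrow> complex" and b
    proof -
      have "integral {-pi..pi} (\<lambda>\<theta>. (norm (f \<theta>))\<^sup>2) \<le> integral {-pi..pi} (\<lambda>\<theta>. b\<^sup>2 * (1 / (1 + s\<^sup>2 * \<theta>\<^sup>2)))"
      proof (intro integral_le integrable_continuous_interval continuous_intros f)
        fix \<theta> assume \<theta>: "\<theta> \<in> {-pi..pi}"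
        then have "(norm (f \<theta>))\<^sup>2 \<le> (b * (1 / (1 + s\<^sup>2 * \<theta>\<^sup>2)))\<^sup>2" by (intro power_mono b) auto
        also have "\<dots> \<le> b\<^sup>2 * (1 / (1 + s\<^sup>2 * \<theta>\<^sup>2))"
          unfolding power_mult_distrib by (intro mult_left_mono sq) auto
        finally show "(norm (f \<theta>))\<^sup>2 \<le> b\<^sup>2 * (1 / (1 + s\<^sup>2 * \<theta>\<^sup>2))" .
      qed (auto simp: add_nonneg_eq_0_iff)
      then show ?thesis by (simp only: I_def integral_mult_right)
    qed
    have e0: "2 * pi * (\<Sum>w\<in>F. (d w)\<^sup>2) \<le> (B / s)\<^sup>2 * I"
    proof -
      have "2 * pi * (\<Sum>w\<in>F. (norm (complex_of_real (d w)))\<^sup>2) \<le> integral {-pi..pi} (\<lambda>\<theta>. (norm (char P \<theta> - char Q \<theta>))\<^sup>2)"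
        by (rule bessel_inequality[OF _ fin Fd c0[OF F]]) (intro continuous_intros)
      also have "\<dots> \<le> (B / s)\<^sup>2 * I" by (rule norm_sq) (intro continuous_intros, rule D)
      finally show ?thesis by simp
    qed
    have e1: "2 * pi * (\<Sum>w\<in>F. (w * d w)\<^sup>2) \<le> B\<^sup>2 * I"
    proof -
      have "2 * pi * (\<Sum>w\<in>F. (norm (complex_of_real (w * d w)))\<^sup>2) \<le> integral {-pi..pi} (\<lambda>\<theta>. (norm (dchar P \<theta> - dchar Q \<theta>))\<^sup>2)"
        by (rule bessel_inequality[OF _ fin Fd c1[OF F]]) (intro continuous_intros)
      also have "\<dots> \<le> B\<^sup>2 * I" by (rule norm_sq) (intro continuous_intros, rule D')
      finally show ?thesis by (simp del: of_real_mult)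
    qed
    have "(\<Sum>w\<in>F. (1 + w\<^sup>2 / s\<^sup>2) * (d w)\<^sup>2) = (\<Sum>w\<in>F. (d w)\<^sup>2) + (\<Sum>w\<in>F. (w * d w)\<^sup>2) / s\<^sup>2"
      by (simp add: sum.distrib sum_divide_distrib ring_distribs power_mult_distrib)
    also have "\<dots> \<le> (B / s)\<^sup>2 * I / (2 * pi) + (B\<^sup>2 * I / (2 * pi)) / s\<^sup>2"
    proof (intro add_mono divide_right_mono)
      show "(\<Sum>w\<in>F. (d w)\<^sup>2) \<le> (B / s)\<^sup>2 * I / (2 * pi)"
        by (subst pos_le_divide_eq) (use e0 in \<open>simp_all only: mult.commute[of _ "2 * pi"] pi_gt_zero\<close>, simp)
      show "(\<Sum>w\<in>F. (w * d w)\<^sup>2) \<le> B\<^sup>2 * I / (2 * pi)"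
        by (subst pos_le_divide_eq) (use e1 in \<open>simp_all only: mult.commute[of _ "2 * pi"] pi_gt_zero\<close>, simp)
    qed simp
    also have "\<dots> = B\<^sup>2 / s\<^sup>2 / pi * I" by (simp add: power_divide field_simps)
    also have "\<dots> \<le> B\<^sup>2 / s\<^sup>2 / pi * (pi / s)" by (intro mult_left_mono I) auto
    also have "\<dots> = B\<^sup>2 / (s\<^sup>2 * s)" by simp
    finally have w2: "(\<Sum>w\<in>F. (1 + w\<^sup>2 / s\<^sup>2) * (d w)\<^sup>2) \<le> B\<^sup>2 / (s\<^sup>2 * s)" .
    have pos: "0 < 1 + w\<^sup>2 / s\<^sup>2" for w by (auto intro!: add_pos_nonneg)
    have "(\<Sum>w\<in>F. \<bar>d w\<bar>)\<^sup>2 = (\<Sum>w\<in>F. sqrt (1 / (1 + w\<^sup>2 / s\<^sup>2)) * (sqrt (1 + w\<^sup>2 / s\<^sup>2) * \<bar>d w\<bar>))\<^sup>2"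
    proof -
      have "sqrt (1 / (1 + w\<^sup>2 / s\<^sup>2)) * (sqrt (1 + w\<^sup>2 / s\<^sup>2) * \<bar>d w\<bar>) = \<bar>d w\<bar>" for w
      proof -
        have "sqrt (1 / (1 + w\<^sup>2 / s\<^sup>2)) * sqrt (1 + w\<^sup>2 / s\<^sup>2) = 1"
          unfolding real_sqrt_mult[symmetric] using pos[of w] by simp
        then show ?thesis by (simp only: mult.assoc[symmetric] mult_1)
      qed
      then show ?thesis by (simp only:)
    qed
    also have "\<dots> \<le> (\<Sum>w\<in>F. (sqrt (1 / (1 + w\<^sup>2 / s\<^sup>2)))\<^sup>2) * (\<Sum>w\<in>F. (sqrt (1 + w\<^sup>2 / s\<^sup>2) * \<bar>d w\<bar>)\<^sup>2)"
      by (rule Cauchy_Schwarz_ineq_sum)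
    also have "\<dots> = (\<Sum>w\<in>F. 1 / (1 + w\<^sup>2 / s\<^sup>2)) * (\<Sum>w\<in>F. (1 + w\<^sup>2 / s\<^sup>2) * (d w)\<^sup>2)"
      using pos by (simp add: power_mult_distrib less_imp_le)
    also have "\<dots> \<le> (8 * s) * (B\<^sup>2 / (s\<^sup>2 * s))"
      using s pos by (intro mult_mono w2 lattice_sum_le[OF s fin Fd] sum_nonneg) (auto simp: less_imp_le)
    \<comment> \<open>The factor 8 is rounded up to the square 9 before the root is taken.\<close>
    also have "\<dots> \<le> (3 * B / s)\<^sup>2"
      using s by (simp add: field_simps power2_eq_square)
    finally show ?thesis
      unfolding d_def by (rule power2_le_imp_le) (use B s in simp)
  qed
qed

text \<open>Finite windows exhaust the lattice, so bounds for finite sums of atoms pass to arbitrary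
  Borel sets in the limit.\<close>

lemma measure_lattice_eq:
  fixes P :: "real measure"
  assumes P: "real_distribution P" and lat: "AE x in P. x + \<mu> \<in> \<int>" and A: "A \<in> sets borel"
  shows "(\<lambda>n. \<Sum>w\<in>A \<inter> (\<lambda>k. of_int k - \<mu>) ` {- int n..int n}. measure P {w}) \<longlonglongrightarrow> measure P A"
proof -
  interpret P: real_distribution P by (rule P)
  define G where "G n = A \<inter> (\<lambda>k. real_of_int k - \<mu>) ` {- int n..int n}" for n
  have fin: "finite (G n)" for n by (auto simp: G_def)
  have Gs: "G n \<in> sets borel" for n by (rule borel_closed[OF finite_imp_closed[OF fin]])
  have "measure P A = measure P (\<Union>n. G n)"
  proof (rule P.finite_measure_eq_AE)
    show "AE x in P. x \<in> A \<longleftrightarrow> x \<in> (\<Union>n. G n)"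
      using lat
    proof eventually_elim
      case (elim x)
      then obtain k where k: "x + \<mu> = of_int k" by (auto elim: Ints_cases)
      have "x \<in> (\<lambda>k. real_of_int k - \<mu>) ` {- int (nat \<bar>k\<bar>)..int (nat \<bar>k\<bar>)}"
        by (rule image_eqI[of _ _ k]) (use k in auto)
      then show ?case unfolding G_def by blast
    qed
    show "(\<Union>n. G n) \<in> sets P" using Gs by (auto intro!: sets.countable_UN)
  qed (use A in auto)
  moreover have "(\<lambda>n. measure P (G n)) \<longlonglongrightarrow> measure P (\<Union>n. G n)"
  proof (rule P.finite_Lim_measure_incseq)
    show "range G \<subseteq> sets P" using Gs by auto
    show "incseq G" by (rule incseq_SucI) (auto simp: G_def)
  qed
  moreover have "measure P (G n) = (\<Sum>w\<in>G n. measure P {w})" for n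
    by (rule P.finite_measure_eq_sum_singleton[OF fin]) auto
  ultimately show ?thesis by (simp add: G_def)
qed

text \<open>A half-open interval of length 1 holds exactly one point of the shifted lattice, namely
  \<open>\<lceil>x + \<mu>\<rceil> - \<mu>\<close>, so the probabilities in \<open>d_loc\<close> are
  atoms. For \<open>d_TV\<close> the finite-sum bound passes to the limit along windows of the
  lattice.\<close>

lemma d_TV_d_loc_le:
  fixes P Q :: "real measure" and s B \<mu> :: real
  assumes P: "real_distribution P" and Q: "real_distribution Q"
    and P2: "integrable P (\<lambda>x. x\<^sup>2)" and Q2: "integrable Q (\<lambda>x. x\<^sup>2)"
    and latP: "AE x in P. x + \<mu> \<in> \<int>" and latQ: "AE x in Q. x + \<mu> \<in> \<int>"
    and s: "1 \<le> s" and B: "0 \<le> B"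
    and D: "\<And>\<theta>. \<bar>\<theta>\<bar> \<le> pi \<Longrightarrow> norm (char P \<theta> - char Q \<theta>) \<le> B / s * (1 / (1 + s\<^sup>2 * \<theta>\<^sup>2))"
    and D': "\<And>\<theta>. \<bar>\<theta>\<bar> \<le> pi \<Longrightarrow> norm (dchar P \<theta> - dchar Q \<theta>) \<le> B * (1 / (1 + s\<^sup>2 * \<theta>\<^sup>2))"
  shows "d_TV P Q \<le> 3 * B / s" and "d_loc P Q \<le> B / (2 * s\<^sup>2)"
proof -
  interpret P: real_distribution P by (rule P)
  interpret Q: real_distribution Q by (rule Q)
  note bounds = lattice_measure_bounds[OF P Q P2 Q2 latP latQ s B D D']
  show "d_TV P Q \<le> 3 * B / s"
    unfolding d_TV_def
  proof (rule cSUP_least)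
    fix A :: "real set" assume A: "A \<in> sets borel"
    define G where "G n = A \<inter> (\<lambda>k. real_of_int k - \<mu>) ` {- int n..int n}" for n
    have "(\<lambda>n. \<bar>(\<Sum>w\<in>G n. measure P {w}) - (\<Sum>w\<in>G n. measure Q {w})\<bar>) \<longlonglongrightarrow> \<bar>measure P A - measure Q A\<bar>"
      unfolding G_def by (intro tendsto_intros measure_lattice_eq P Q latP latQ A)
    moreover have "\<bar>(\<Sum>w\<in>G n. measure P {w}) - (\<Sum>w\<in>G n. measure Q {w})\<bar> \<le> 3 * B / s" for n
    proof -
      have "\<bar>(\<Sum>w\<in>G n. measure P {w}) - (\<Sum>w\<in>G n. measure Q {w})\<bar> \<le> (\<Sum>w\<in>G n. \<bar>measure P {w} - measure Q {w}\<bar>)"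
        unfolding sum_subtractf[symmetric] by (rule sum_abs)
      also have "\<dots> \<le> 3 * B / s" by (rule bounds(2)) (auto simp: G_def)
      finally show ?thesis .
    qed
    ultimately show "\<bar>measure P A - measure Q A\<bar> \<le> 3 * B / s"
      by (intro LIMSEQ_le_const2) auto
  qed auto
  show "d_loc P Q \<le> B / (2 * s\<^sup>2)"
    unfolding d_loc_def
  proof (rule cSUP_least)
    fix x :: real
    define w where "w = of_int \<lceil>x + \<mu>\<rceil> - \<mu>"
    have only: "y = w" if y: "y + \<mu> \<in> \<int>" "x \<le> y" "y < x + 1" for y
    proof -
      obtain k where k: "y + \<mu> = of_int k" using Ints_cases[OF y(1)] by metis
      then have "k = \<lceil>x + \<mu>\<rceil>" using y by linarith
      then show ?thesis using k by (simp add: w_def)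
    qed
    have w: "w \<in> {x..<x + 1}" by (simp add: w_def) linarith
    have "measure N {x..<x + 1} = measure N {w}" if "AE y in N. y + \<mu> \<in> \<int>" "real_distribution N" for N
    proof -
      interpret N: real_distribution N by fact
      show ?thesis
        by (rule N.finite_measure_eq_AE)
           (use that(1) w in \<open>auto elim!: eventually_mono dest: only\<close>)
    qed
    then have "measure P {x..<x + 1} = measure P {w}" "measure Q {x..<x + 1} = measure Q {w}"
      using latP latQ P Q by auto
    then show "\<bar>measure P {x..<x + 1} - measure Q {x..<x + 1}\<bar> \<le> B / (2 * s\<^sup>2)"
      using bounds(1)[of w] by (simp add: w_def)
  qed auto
qed

section \<open>Comparison with the centred binomial distribution\<close>

text \<open>This is \<open>1 + y \<le> (1 + 3 / k) * exp (k * y / 3)\<close>, cubed. The later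
  estimates carry a factor \<open>(1 + y)\<^sup>2\<close>, and the third power leaves
  \<open>1 / (1 + y)\<close> over.\<close>

lemma cube_le_exp:
  fixes y k :: real
  assumes "0 \<le> y" "0 < k"
  shows "(1 + y) ^ 3 * exp (- k * y) \<le> (1 + 3 / k) ^ 3"
proof -
  have "1 + y \<le> (1 + 3 / k) * (1 + k * y / 3)" using assms by (simp add: field_simps)
  also have "\<dots> \<le> (1 + 3 / k) * exp (k * y / 3)"
    using assms exp_ge_add_one_self[of "k * y / 3"] by (intro mult_left_mono) auto
  finally have "(1 + y) ^ 3 \<le> ((1 + 3 / k) * exp (k * y / 3)) ^ 3"
    using assms by (intro power_mono) auto
  also have "\<dots> = (1 + 3 / k) ^ 3 * exp (k * y)"
    by (simp add: power_mult_distrib exp_of_nat_mult[symmetric])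
  finally have "(1 + y) ^ 3 * exp (- k * y) \<le> (1 + 3 / k) ^ 3 * exp (k * y) * exp (- k * y)"
    by (intro mult_right_mono) auto
  also have "\<dots> = (1 + 3 / k) ^ 3" by (simp add: mult.assoc exp_minus)
  finally show ?thesis .
qed

text \<open>\<open>exp (s2 * t\<^sup>2 / 2)\<close> is an integrating factor. By
  \<open>2 * (k * v) \<le> s2\<close> the bound for the derivative of \<open>H\<close> does not
  decrease in \<open>\<bar>t\<bar>\<close>, so its value at \<theta> serves on the whole segment,
  and the mean value inequality keeps the Gaussian factor at \<theta>.\<close>

lemma gaussian_ode_bound:
  fixes D D' :: "real \<Rightarrow> complex" and A k v s2 :: real
  assumes deriv: "\<And>\<theta>. (D has_vector_derivative D' \<theta>) (at \<theta>)" and D0: "D 0 = 0"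
    and err: "\<And>\<theta>. \<bar>\<theta>\<bar> \<le> pi \<Longrightarrow> norm (D' \<theta> + s2 * \<theta> * D \<theta>) \<le> A * (v * \<theta>\<^sup>2 + \<bar>\<theta>\<bar>) * exp (- k * v * \<theta>\<^sup>2)"
    and A: "0 \<le> A" and v: "0 \<le> v" and k: "2 * (k * v) \<le> s2" and \<theta>: "\<bar>\<theta>\<bar> \<le> pi"
  shows "norm (D \<theta>) \<le> \<bar>\<theta>\<bar> * (A * (v * \<theta>\<^sup>2 + \<bar>\<theta>\<bar>) * exp (- k * v * \<theta>\<^sup>2))"
proof -
  define H where "H t = D t * exp (complex_of_real (s2 * t\<^sup>2 / 2))" for t
  define H' where "H' t = exp (complex_of_real (s2 * t\<^sup>2 / 2)) * (D' t + s2 * t * D t)" for t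
  define b where "b = A * (v * \<theta>\<^sup>2 + \<bar>\<theta>\<bar>) * exp ((s2 / 2 - k * v) * \<theta>\<^sup>2)"
  have dH: "(H has_vector_derivative H' t) (at t)" for t
  proof -
    have "((\<lambda>t. exp (complex_of_real (s2 * t\<^sup>2 / 2))) has_vector_derivative
        (s2 * t) *\<^sub>R exp (complex_of_real (s2 * t\<^sup>2 / 2))) (at t)"
    proof -
      have "((\<lambda>t. s2 * t\<^sup>2 / 2) has_vector_derivative s2 * t) (at t)"
        by (auto intro!: derivative_eq_intros simp: has_real_derivative_iff_has_vector_derivative[symmetric])
      moreover have "((\<lambda>x. exp (complex_of_real x)) has_vector_derivative exp (complex_of_real x)) (at x)" for x
        by (auto intro!: derivative_eq_intros simp: has_vector_derivative_complex_iff Re_exp Im_exp)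
      ultimately show ?thesis
        by (rule vector_diff_chain_at[of "\<lambda>t. s2 * t\<^sup>2 / 2" "s2 * t" t "\<lambda>x. exp (complex_of_real x)", unfolded comp_def])
    qed
    from has_vector_derivative_mult[OF deriv this]
    show ?thesis unfolding H_def H'_def
      by (rule has_vector_derivative_eq_rhs) (simp add: scaleR_conv_of_real algebra_simps)
  qed
  have nH': "norm (H' t) \<le> b" if t: "t \<in> closed_segment 0 \<theta>" for t
  proof -
    have t\<theta>: "\<bar>t\<bar> \<le> \<bar>\<theta>\<bar>" using t by (auto simp: closed_segment_eq_real_ivl split: if_splits)
    then have t2: "t\<^sup>2 \<le> \<theta>\<^sup>2" by (simp add: abs_le_square_iff)
    have "norm (H' t) = exp (s2 * t\<^sup>2 / 2) * norm (D' t + s2 * t * D t)"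
      unfolding H'_def norm_mult by (simp flip: exp_of_real)
    also have "\<dots> \<le> exp (s2 * t\<^sup>2 / 2) * (A * (v * t\<^sup>2 + \<bar>t\<bar>) * exp (- k * v * t\<^sup>2))"
      using t\<theta> \<theta> by (intro mult_left_mono err) auto
    also have "\<dots> = A * (v * t\<^sup>2 + \<bar>t\<bar>) * exp ((s2 / 2 - k * v) * t\<^sup>2)"
      by (simp add: mult_exp_exp[symmetric] algebra_simps flip: exp_add)
    also have "\<dots> \<le> b"
      unfolding b_def using t\<theta> t2 A v k
      by (intro mult_mono mult_left_mono add_mono iffD2[OF exp_le_cancel_iff]) auto
    finally show ?thesis .
  qed
  have b0: "0 \<le> b" unfolding b_def using A v by auto
  have "norm (H \<theta> - H 0) \<le> b * norm (\<theta> - 0)"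
  proof (rule differentiable_bound[of "closed_segment 0 \<theta>" H "\<lambda>t h. h *\<^sub>R H' t"])
    show "(H has_derivative (\<lambda>h. h *\<^sub>R H' t)) (at t within closed_segment 0 \<theta>)" for t
      using dH[of t] by (auto simp: has_vector_derivative_def intro: has_derivative_at_withinI)
    show "onorm (\<lambda>h. h *\<^sub>R H' t) \<le> b" if "t \<in> closed_segment 0 \<theta>" for t
    proof (rule onorm_bound[OF b0])
      show "norm (x *\<^sub>R H' t) \<le> b * norm x" for x :: real
        using mult_right_mono[OF nH'[OF that], of "\<bar>x\<bar>"] by (simp add: mult.commute)
    qed
  qed auto
  then have "norm (D \<theta>) * exp (s2 * \<theta>\<^sup>2 / 2) \<le> b * \<bar>\<theta>\<bar>"
    by (simp add: H_def D0 norm_mult flip: exp_of_real)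
  then have "norm (D \<theta>) * exp (s2 * \<theta>\<^sup>2 / 2) * exp (- (s2 * \<theta>\<^sup>2 / 2)) \<le> b * \<bar>\<theta>\<bar> * exp (- (s2 * \<theta>\<^sup>2 / 2))"
    by (intro mult_right_mono) auto
  also have "norm (D \<theta>) * exp (s2 * \<theta>\<^sup>2 / 2) * exp (- (s2 * \<theta>\<^sup>2 / 2)) = norm (D \<theta>)"
    by (simp add: exp_minus)
  also have "b * \<bar>\<theta>\<bar> * exp (- (s2 * \<theta>\<^sup>2 / 2)) = \<bar>\<theta>\<bar> * (A * (v * \<theta>\<^sup>2 + \<bar>\<theta>\<bar>) * (exp ((s2 / 2 - k * v) * \<theta>\<^sup>2) * exp (- (s2 * \<theta>\<^sup>2 / 2))))"
    by (simp add: b_def)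
  also have "exp ((s2 / 2 - k * v) * \<theta>\<^sup>2) * exp (- (s2 * \<theta>\<^sup>2 / 2)) = exp (- k * v * \<theta>\<^sup>2)"
    unfolding exp_add[symmetric] by (simp add: algebra_simps)
  finally show ?thesis .
qed

text \<open>In \<open>y = s\<^sup>2 * \<theta>\<^sup>2\<close> the error is at most
  \<open>A * (2 * (1 + y)) * exp (- k * y)\<close>, and \<open>cube_le_exp\<close> absorbs the
  polynomial factors. The extra \<open>\<bar>\<theta>\<bar> \<le> (1 + y) / s\<close> in the bound
  for \<open>D\<close> yields the gain \<open>1 / s\<close>; \<open>D'\<close> follows from the
  equation itself, since \<open>s2 * \<theta>\<^sup>2 \<le> S * y\<close>.\<close>

lemma gaussian_ode_scaled:
  fixes D D' :: "real \<Rightarrow> complex" and A k s s2 S :: real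
  assumes deriv: "\<And>\<theta>. (D has_vector_derivative D' \<theta>) (at \<theta>)" and D0: "D 0 = 0"
    and err: "\<And>\<theta>. \<bar>\<theta>\<bar> \<le> pi \<Longrightarrow> norm (D' \<theta> + s2 * \<theta> * D \<theta>) \<le> A * (s\<^sup>2 * \<theta>\<^sup>2 + \<bar>\<theta>\<bar>) * exp (- k * s\<^sup>2 * \<theta>\<^sup>2)"
    and A: "0 \<le> A" and s: "1 \<le> s" and k: "0 < k" "2 * (k * s\<^sup>2) \<le> s2" and S: "s2 \<le> S * s\<^sup>2" and \<theta>: "\<bar>\<theta>\<bar> \<le> pi"
  defines "B \<equiv> A * (1 + S) * (2 * (1 + 3 / k) ^ 3)"
  shows "0 \<le> B" "norm (D \<theta>) \<le> B / s * (1 / (1 + s\<^sup>2 * \<theta>\<^sup>2))" "norm (D' \<theta>) \<le> B * (1 / (1 + s\<^sup>2 * \<theta>\<^sup>2))"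
proof -
  define u where "u = s * \<bar>\<theta>\<bar>"
  define y where "y = s\<^sup>2 * \<theta>\<^sup>2"
  define e where "e = exp (- k * y)"
  define C where "C = 2 * (1 + 3 / k) ^ 3"
  have u: "0 \<le> u" "u\<^sup>2 = y" using s by (auto simp: u_def y_def power_mult_distrib)
  have y: "0 \<le> y" by (simp add: y_def)
  have uy: "u \<le> 1 + y"
  proof (cases "u \<le> 1")
    case False
    then have "1 * u \<le> u * u" by (intro mult_right_mono) auto
    then show ?thesis using u by (simp add: power2_eq_square)
  qed (use y in simp)
  have e0: "0 \<le> e" by (simp add: e_def)
  have s2: "0 \<le> s2" using k by (meson mult_nonneg_nonneg order.trans less_imp_le zero_le_numeral zero_le_power2)
  have S0: "0 \<le> S"
    using S s2 s by (metis mult_pos_pos not_less order.trans zero_less_power zero_less_one mult_neg_pos less_le_trans)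
  have C: "(1 + y) ^ 3 * e * 2 \<le> C" unfolding C_def e_def using cube_le_exp[OF y k(1)] by simp
  have C0: "0 \<le> C" using k by (simp add: C_def)
  show B0: "0 \<le> B" unfolding B_def using A S0 k by auto
  have BC: "A * C \<le> B" unfolding B_def C_def[symmetric] using A C0 S0
    using mult_left_mono[of 1 "1 + S" A] by (intro mult_right_mono) auto
  have \<theta>s: "\<bar>\<theta>\<bar> = u / s" using s by (simp add: u_def)
  have lin: "s\<^sup>2 * \<theta>\<^sup>2 + \<bar>\<theta>\<bar> \<le> 2 * (1 + y)"
  proof -
    have "\<bar>\<theta>\<bar> \<le> u" using s by (simp add: u_def mult_le_cancel_right1)
    then show ?thesis using uy by (simp add: y_def[symmetric])
  qed
  have y1: "0 < 1 + y" using y by simp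
  have p3: "(1 + y) * (1 + y) = (1 + y) ^ 3 * (1 / (1 + y))" using y1 by (simp add: power3_eq_cube)
  have nD: "norm (D \<theta>) \<le> \<bar>\<theta>\<bar> * (A * (s\<^sup>2 * \<theta>\<^sup>2 + \<bar>\<theta>\<bar>) * e)"
    using gaussian_ode_bound[OF deriv D0 err A _ k(2) \<theta>] by (simp add: e_def y_def mult.assoc)
  also have "\<dots> \<le> \<bar>\<theta>\<bar> * (A * (2 * (1 + y)) * e)"
    by (intro mult_left_mono mult_right_mono lin A e0) auto
  finally have nD2: "norm (D \<theta>) \<le> \<bar>\<theta>\<bar> * (A * (2 * (1 + y)) * e)" .
  also have "\<dots> \<le> (1 + y) / s * (A * (2 * (1 + y)) * e)"
    unfolding \<theta>s using uy s A y e0 by (intro mult_right_mono divide_right_mono mult_nonneg_nonneg) auto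
  also have "\<dots> = A / s * (((1 + y) * (1 + y)) * e * 2)" by simp
  also have "\<dots> = A / s * ((1 + y) ^ 3 * e * 2) * (1 / (1 + y))"
    unfolding p3 by (simp only: mult_ac)
  also have "\<dots> \<le> A / s * C * (1 / (1 + y))"
    using A s y1 by (intro mult_left_mono mult_right_mono C) auto
  also have "\<dots> \<le> B / s * (1 / (1 + y))"
    using BC s y1 by (intro mult_right_mono) (auto simp: divide_right_mono)
  finally show "norm (D \<theta>) \<le> B / s * (1 / (1 + s\<^sup>2 * \<theta>\<^sup>2))" by (simp add: y_def)
  have "norm (D' \<theta>) \<le> norm (D' \<theta> + s2 * \<theta> * D \<theta>) + norm (s2 * \<theta> * D \<theta>)"
    using norm_triangle_ineq4[of "D' \<theta> + s2 * \<theta> * D \<theta>" "s2 * \<theta> * D \<theta>"] by simp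
  also have "\<dots> \<le> A * (2 * (1 + y)) * e + s2 * \<bar>\<theta>\<bar> * (\<bar>\<theta>\<bar> * (A * (2 * (1 + y)) * e))"
  proof (intro add_mono)
    have "norm (D' \<theta> + s2 * \<theta> * D \<theta>) \<le> A * (s\<^sup>2 * \<theta>\<^sup>2 + \<bar>\<theta>\<bar>) * e"
      using err[OF \<theta>] by (simp add: e_def y_def mult.assoc)
    also have "\<dots> \<le> A * (2 * (1 + y)) * e" by (intro mult_left_mono mult_right_mono lin A e0)
    finally show "norm (D' \<theta> + s2 * \<theta> * D \<theta>) \<le> A * (2 * (1 + y)) * e" .
    show "norm (s2 * \<theta> * D \<theta>) \<le> s2 * \<bar>\<theta>\<bar> * (\<bar>\<theta>\<bar> * (A * (2 * (1 + y)) * e))"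
    proof -
      have "norm (s2 * \<theta> * D \<theta>) = s2 * \<bar>\<theta>\<bar> * norm (D \<theta>)" using s2 by (simp add: norm_mult)
      then show ?thesis using mult_left_mono[OF nD2, of "s2 * \<bar>\<theta>\<bar>"] s2 by simp
    qed
  qed
  also have "\<dots> = (1 + s2 * (\<bar>\<theta>\<bar> * \<bar>\<theta>\<bar>)) * (A * (2 * (1 + y)) * e)"
    by (simp only: ring_distribs mult_1 mult_ac)
  also have "\<bar>\<theta>\<bar> * \<bar>\<theta>\<bar> = \<theta>\<^sup>2" by (simp add: power2_eq_square)
  also have "(1 + s2 * \<theta>\<^sup>2) * (A * (2 * (1 + y)) * e) \<le> ((1 + S) * (1 + y)) * (A * (2 * (1 + y)) * e)"
  proof (intro mult_right_mono)
    have *: "s2 * \<theta>\<^sup>2 \<le> S * s\<^sup>2 * \<theta>\<^sup>2" by (intro mult_right_mono S) auto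
    show "1 + s2 * \<theta>\<^sup>2 \<le> (1 + S) * (1 + y)"
    proof -
      have "S * s\<^sup>2 * \<theta>\<^sup>2 = S * y" by (simp add: y_def)
      moreover have "(1 + S) * (1 + y) = 1 + S + y + S * y" by (simp add: algebra_simps)
      ultimately show ?thesis using * S0 y by linarith
    qed
  qed (use A y e0 in auto)
  also have "\<dots> = A * (1 + S) * (((1 + y) * (1 + y)) * e * 2)" by (simp only: mult_ac)
  also have "\<dots> = A * (1 + S) * ((1 + y) ^ 3 * e * 2) * (1 / (1 + y))"
    unfolding p3 by (simp only: mult_ac)
  also have "\<dots> \<le> A * (1 + S) * C * (1 / (1 + y))"
    using A S0 y1 by (intro mult_left_mono mult_right_mono C) auto
  finally show "norm (D' \<theta>) \<le> B * (1 / (1 + s\<^sup>2 * \<theta>\<^sup>2))" by (simp add: y_def B_def C_def)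
qed

section \<open>The characteristic function of the centred binomial distribution\<close>

lemma sets_shifted_Ints: "{x::real. x + c \<in> \<int>} \<in> sets borel"
proof -
  have "{x::real. x + c \<in> \<int>} = (\<Union>k. {of_int k - c})"
  proof (intro set_eqI iffI)
    fix x :: real assume "x \<in> {x. x + c \<in> \<int>}"
    then obtain k where "x + c = of_int k" by (auto elim: Ints_cases)
    then have "x = of_int k - c" by simp
    then show "x \<in> (\<Union>k. {of_int k - c})" by blast
  qed auto
  then show ?thesis by auto
qed

lemma
  fixes p \<theta> :: real and n :: nat
  assumes p: "0 \<le> p" "p \<le> 1"
  shows real_distribution_centred_binomial: "real_distribution (centred_binomial n p)"
    and integrable_square_centred_binomial: "integrable (centred_binomial n p) (\<lambda>x. x\<^sup>2)"
    and centred_binomial_lattice: "AE x in centred_binomial n p. x + real n * p \<in> \<int>"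
    and char_centred_binomial: "char (centred_binomial n p) \<theta> = (iexp (- \<theta> * p) * (1 - p + p * iexp \<theta>)) ^ n"
proof -
  have P: "p \<in> {0..1}" using p by auto
  have m [measurable]: "(\<lambda>k. real k - real n * p) \<in> measure_pmf (binomial_pmf n p) \<rightarrow>\<^sub>M borel" by simp
  show "real_distribution (centred_binomial n p)"
    unfolding real_distribution_def real_distribution_axioms_def centred_binomial_def
    using measure_pmf.prob_space_distr[OF m] by auto
  show "integrable (centred_binomial n p) (\<lambda>x. x\<^sup>2)"
    unfolding centred_binomial_def by (subst integrable_distr_eq) (auto intro: integrable_binomial_pmf[OF P])
  show "AE x in centred_binomial n p. x + real n * p \<in> \<int>"
    unfolding centred_binomial_def by (subst AE_distr_iff) (use sets_shifted_Ints in auto)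
  have "char (centred_binomial n p) \<theta> = measure_pmf.expectation (binomial_pmf n p) (\<lambda>k. iexp (\<theta> * (real k - real n * p)))"
    unfolding char_def centred_binomial_def by (rule integral_distr) auto
  also have "\<dots> = (\<Sum>k\<le>n. (real (n choose k) * p ^ k * (1 - p) ^ (n - k)) *\<^sub>R iexp (\<theta> * (real k - real n * p)))"
    by (rule expectation_binomial_pmf'[OF P])
  also have "\<dots> = (\<Sum>k\<le>n. iexp (- \<theta> * p) ^ n * (of_nat (n choose k) * (p * iexp \<theta>) ^ k * (1 - p) ^ (n - k)))"
  proof (rule sum.cong[OF refl])
    fix k
    have "iexp (\<theta> * (real k - real n * p)) = iexp (- \<theta> * p) ^ n * iexp \<theta> ^ k"
      unfolding exp_of_nat_mult[symmetric] exp_add[symmetric] by (simp add: algebra_simps)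
    then show "(real (n choose k) * p ^ k * (1 - p) ^ (n - k)) *\<^sub>R iexp (\<theta> * (real k - real n * p))
      = iexp (- \<theta> * p) ^ n * (of_nat (n choose k) * (p * iexp \<theta>) ^ k * (1 - p) ^ (n - k))"
      by (simp only: scaleR_conv_of_real power_mult_distrib of_real_mult of_real_power of_real_of_nat_eq mult_ac)
  qed
  also have "\<dots> = iexp (- \<theta> * p) ^ n * (p * iexp \<theta> + (1 - p)) ^ n"
    unfolding sum_distrib_left[symmetric] binomial_ring of_real_power ..
  finally show "char (centred_binomial n p) \<theta> = (iexp (- \<theta> * p) * (1 - p + p * iexp \<theta>)) ^ n"
    by (simp only: power_mult_distrib add.commute)
qed

text \<open>The characteristic function is \<open>g ^ n\<close>, with \<open>g\<close> that of one
  centred Bernoulli variable, and \<open>g' + p * (1 - p) * \<theta> * g\<close> is of order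
  \<open>\<theta>\<^sup>2\<close>. Differentiation uses up one factor of \<open>g ^ n\<close>, hence
  \<open>n - 1\<close> in the exponent.\<close>

lemma centred_binomial_stein:
  fixes p \<theta> :: real and n :: nat
  assumes p: "0 \<le> p" "p \<le> 1" and n: "0 < n" and \<theta>: "\<bar>\<theta>\<bar> \<le> pi"
  defines "r \<equiv> p * (1 - p) / 12"
  shows "norm (\<i> * dchar (centred_binomial n p) \<theta> + real n * p * (1 - p) * \<theta> * char (centred_binomial n p) \<theta>)
      \<le> n * \<theta>\<^sup>2 * exp (- (real n - 1) * r * \<theta>\<^sup>2)"
    and "norm (char (centred_binomial n p) \<theta>) \<le> exp (- (real n - 1) * r * \<theta>\<^sup>2)"
proof -
  let ?Q = "centred_binomial n p"
  interpret Q: real_distribution ?Q by (rule real_distribution_centred_binomial[OF p])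
  define g where "g t = iexp (- t * p) * (1 - p + p * iexp t)" for t :: real
  define g' where "g' t = \<i> * p * (1 - p) * iexp (- t * p) * (iexp t - 1)" for t :: real
  have ch: "char ?Q = (\<lambda>t. g t ^ n)"
    using char_centred_binomial[OF p] by (simp add: fun_eq_iff g_def)
  have r0: "0 \<le> r" using p by (simp add: r_def)
  have dg: "(g has_vector_derivative g' t) (at t)" for t
  proof -
    have "((\<lambda>t. iexp (- t * p)) has_vector_derivative (- p) *\<^sub>R (\<i> * iexp (- t * p))) (at t)"
      by (rule vector_diff_chain_at[of "\<lambda>t. - t * p" "- p" t iexp, unfolded comp_def])
         (auto intro!: derivative_eq_intros)
    moreover have "((\<lambda>t. 1 - p + p * iexp t) has_vector_derivative p * (\<i> * iexp t)) (at t)"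
      by (auto intro!: derivative_eq_intros)
    ultimately have "(g has_vector_derivative iexp (- t * p) * (p * (\<i> * iexp t)) +
        ((- p) *\<^sub>R (\<i> * iexp (- t * p))) * (1 - p + p * iexp t)) (at t)"
      unfolding g_def by (rule has_vector_derivative_mult)
    then show ?thesis
      by (rule has_vector_derivative_eq_rhs) (simp add: g'_def scaleR_conv_of_real algebra_simps)
  qed
  have dgn: "((\<lambda>t. g t ^ n) has_vector_derivative n * g \<theta> ^ (n - 1) * g' \<theta>) (at \<theta>)"
  proof -
    have "((\<lambda>z. z ^ n) has_field_derivative n * g \<theta> ^ (n - 1)) (at (g \<theta>))"
      by (auto intro!: derivative_eq_intros)
    from field_vector_diff_chain_at[OF dg this] show ?thesis by (simp add: comp_def mult_ac)
  qed
  have "\<i> * dchar ?Q \<theta> = n * g \<theta> ^ (n - 1) * g' \<theta>"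
    using vector_derivative_unique_at[OF Q.char_has_vector_derivative[OF integrable_square_centred_binomial[OF p]] dgn[folded ch]] .
  moreover have "g \<theta> ^ n = g \<theta> ^ (n - 1) * g \<theta>" using n by (simp add: power_eq_if mult.commute)
  ultimately have "\<i> * dchar ?Q \<theta> + real n * p * (1 - p) * \<theta> * char ?Q \<theta> =
      n * g \<theta> ^ (n - 1) * (g' \<theta> + p * (1 - p) * \<theta> * g \<theta>)"
    unfolding ch by (simp add: algebra_simps)
  moreover have "g' \<theta> + p * (1 - p) * \<theta> * g \<theta> =
      (p * (1 - p)) * iexp (- \<theta> * p) * (\<i> * (iexp \<theta> - 1 - \<i> * \<theta>) + \<theta> * p * (iexp \<theta> - 1))"
    unfolding g_def g'_def by (simp add: algebra_simps)
  ultimately have eq: "\<i> * dchar ?Q \<theta> + real n * p * (1 - p) * \<theta> * char ?Q \<theta> =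
      n * g \<theta> ^ (n - 1) * ((p * (1 - p)) * iexp (- \<theta> * p) * (\<i> * (iexp \<theta> - 1 - \<i> * \<theta>) + \<theta> * p * (iexp \<theta> - 1)))"
    by (simp only:)
  have ng: "norm (g \<theta>) \<le> exp (- r * \<theta>\<^sup>2)"
  proof -
    have "norm (g \<theta>) = norm (1 - p + p * iexp \<theta>)" unfolding g_def norm_mult norm_exp_i_times by simp
    also have "\<dots> \<le> 1 + (- r * \<theta>\<^sup>2)"
      using norm_bernoulli_char_le[OF p \<theta>] by (simp add: r_def)
    also have "\<dots> \<le> exp (- r * \<theta>\<^sup>2)" by (rule exp_ge_add_one_self)
    finally show ?thesis .
  qed
  have ngp: "norm (g \<theta>) ^ (n - 1) \<le> exp (- (real n - 1) * r * \<theta>\<^sup>2)"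
  proof -
    have "norm (g \<theta>) ^ (n - 1) \<le> exp (- r * \<theta>\<^sup>2) ^ (n - 1)" by (intro power_mono ng) auto
    also have "\<dots> = exp (- (real n - 1) * r * \<theta>\<^sup>2)"
      using n by (simp add: exp_of_nat_mult[symmetric] of_nat_diff Suc_leI algebra_simps)
    finally show ?thesis .
  qed
  show "norm (char ?Q \<theta>) \<le> exp (- (real n - 1) * r * \<theta>\<^sup>2)"
  proof -
    have "norm (g \<theta>) \<le> 1" using ng by (rule order.trans) (use r0 in simp)
    then have "norm (g \<theta>) ^ n \<le> norm (g \<theta>) ^ (n - 1)" by (intro power_decreasing) auto
    then show ?thesis unfolding ch norm_power using ngp by linarith
  qed
  have pq: "p * (1 - p) \<le> 1/4" "0 \<le> p * (1 - p)"
  proof -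
    have "p * (1 - p) = 1/4 - (p - 1/2)\<^sup>2" by (simp add: power2_eq_square algebra_simps)
    then show "p * (1 - p) \<le> 1/4" by simp
    show "0 \<le> p * (1 - p)" using p by simp
  qed
  have br: "norm (\<i> * (iexp \<theta> - 1 - \<i> * \<theta>) + \<theta> * p * (iexp \<theta> - 1)) \<le> 2 * \<theta>\<^sup>2"
  proof -
    have "norm (\<i> * (iexp \<theta> - 1 - \<i> * \<theta>)) \<le> \<theta>\<^sup>2 / 2"
      unfolding norm_mult using norm_iexp_diff2[of \<theta>] by simp
    moreover have "norm (\<theta> * p * (iexp \<theta> - 1)) \<le> \<bar>\<theta>\<bar> * 1 * \<bar>\<theta>\<bar>"
      unfolding norm_mult using norm_iexp_diff1[of \<theta>] p by (intro mult_mono) (auto simp: norm_mult mult_left_le)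
    moreover have "\<bar>\<theta>\<bar> * 1 * \<bar>\<theta>\<bar> = \<theta>\<^sup>2" "0 \<le> \<theta>\<^sup>2" by (simp_all add: power2_eq_square)
    moreover note norm_triangle_ineq[of "\<i> * (iexp \<theta> - 1 - \<i> * \<theta>)" "\<theta> * p * (iexp \<theta> - 1)"]
    ultimately show ?thesis by linarith
  qed
  have "norm (\<i> * dchar ?Q \<theta> + real n * p * (1 - p) * \<theta> * char ?Q \<theta>) =
      n * norm (g \<theta>) ^ (n - 1) * ((p * (1 - p)) * norm (\<i> * (iexp \<theta> - 1 - \<i> * \<theta>) + \<theta> * p * (iexp \<theta> - 1)))"
    unfolding eq norm_mult[of "_ * _" "_ + _"] norm_mult[of "of_nat n * _"] norm_mult[of "of_nat n"]
      norm_mult[of _ "iexp _"] norm_power norm_exp_i_times norm_of_real using pq(2) by simp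
  also have "\<dots> \<le> n * exp (- (real n - 1) * r * \<theta>\<^sup>2) * (1/4 * (2 * \<theta>\<^sup>2))"
    by (intro mult_mono ngp br pq) (use pq in auto)
  also have "\<dots> \<le> n * exp (- (real n - 1) * r * \<theta>\<^sup>2) * \<theta>\<^sup>2"
    by (intro mult_left_mono) auto
  finally show "norm (\<i> * dchar ?Q \<theta> + real n * p * (1 - p) * \<theta> * char ?Q \<theta>) \<le> n * \<theta>\<^sup>2 * exp (- (real n - 1) * r * \<theta>\<^sup>2)"
    by (simp only: mult_ac)
qed

section \<open>Matching the binomial parameters\<close>

text \<open>Both distributions live on the same lattice, and their variances differ by at most 1.
  The difference of the characteristic functions therefore satisfies the Gaussian equation with
  variance \<sigma>2, where the variance mismatch only adds an error of order
  \<open>\<bar>\<theta>\<bar>\<close>.\<close>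

lemma binomial_approximation:
  fixes P :: "real measure" and A k S v \<sigma>2 m :: real
  assumes P: "real_distribution P" and P2: "integrable P (\<lambda>x. x\<^sup>2)"
    and lat: "AE x in P. x + m \<in> \<int>" and v: "1 \<le> v" and A: "0 \<le> A" and k: "0 < k"
    and stein: "\<And>\<theta>. \<bar>\<theta>\<bar> \<le> pi \<Longrightarrow>
      norm (dchar P \<theta> - \<i> * \<theta> * \<sigma>2 * char P \<theta>) \<le> A * v * \<theta>\<^sup>2 * exp (- k * v * \<theta>\<^sup>2)"
    and lower: "2 * k * v \<le> \<sigma>2" and upper: "\<sigma>2 \<le> S * v" and \<sigma>2: "1 < \<sigma>2"
  defines "\<delta> \<equiv> frac (- 4 * \<sigma>2)"
  defines "t \<equiv> frac (- m + 2 * \<sigma>2 + \<delta> / 2) / (4 * \<sigma>2 + \<delta>)"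
  defines "Q \<equiv> centred_binomial (nat \<lceil>4 * \<sigma>2\<rceil>) (1 / 2 - t)"
  defines "B \<equiv> (A + 5 * S + 1) * (1 + S) * (2 * (1 + 3 / (k / 10)) ^ 3)"
  shows "d_TV P Q \<le> 3 * B / sqrt v" and "d_loc P Q \<le> B / (2 * v)"
proof -
  define n where "n = nat \<lceil>4 * \<sigma>2\<rceil>"
  define p where "p = 1 / 2 - t"
  define s where "s = sqrt v"
  have s: "1 \<le> s" "s\<^sup>2 = v" using v by (auto simp: s_def)
  have n: "real n = 4 * \<sigma>2 + \<delta>"
    unfolding n_def \<delta>_def frac_def using \<sigma>2 by (simp add: ceiling_def)
  have \<delta>: "0 \<le> \<delta>" "\<delta> < 1" unfolding \<delta>_def by (rule frac_ge_0, rule frac_lt_1)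
  have "real n > 4" using n \<sigma>2 \<delta> by linarith
  \<comment> \<open>This is where \<open>\<sigma>2 > 1\<close> enters: it keeps \<open>p\<close>
    between 3/10 and 1/2, so that the binomial distribution has Gaussian decay of its own.\<close>
  then have n5: "5 \<le> n" by linarith
  define f where "f = frac (- m + 2 * \<sigma>2 + \<delta> / 2)"
  have f: "0 \<le> f" "f < 1" unfolding f_def by (rule frac_ge_0, rule frac_lt_1)
  have tf: "t = f / n" by (simp add: t_def n f_def)
  have t: "0 \<le> t" "t \<le> 1 / 5"
  proof -
    show "0 \<le> t" unfolding tf using f by simp
    have "f / n \<le> 1 / 5" using f n5 by (intro frac_le) auto
    then show "t \<le> 1 / 5" by (simp add: tf)
  qed
  have p: "3 / 10 \<le> p" "p \<le> 1 / 2" using t by (auto simp: p_def)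
  have pq: "21 / 100 \<le> p * (1 - p)"
  proof -
    have "p * (1 - p) = 1 / 4 - t\<^sup>2" by (simp add: p_def power2_eq_square algebra_simps)
    moreover have "t\<^sup>2 \<le> (1 / 5)\<^sup>2" using t by (intro power_mono) auto
    ultimately show ?thesis by (simp add: power2_eq_square)
  qed
  \<comment> \<open>The difference equals \<open>\<delta> / 4 - f * t\<close>: rounding up the
    number of trials adds \<open>\<delta> / 4\<close>, and moving the probability away from 1/2
    subtracts \<open>f * t\<close>.\<close>
  have var: "\<bar>real n * p * (1 - p) - \<sigma>2\<bar> \<le> 1"
  proof -
    have "real n * p * (1 - p) = n / 4 - n * t * t" by (simp add: p_def algebra_simps)
    moreover have "real n * t = f" using n5 by (simp add: tf)
    ultimately have "real n * p * (1 - p) - \<sigma>2 = \<delta> / 4 - f * t" using n by (simp only: mult.assoc) (simp add: field_simps)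
    moreover have "f * t \<le> 1 * 1" using f t by (intro mult_mono) auto
    moreover have "0 \<le> f * t" using f t by simp
    ultimately show ?thesis using \<delta> by linarith
  qed
  have p01: "0 \<le> p" "p \<le> 1" using p by auto
  have Qnp: "Q = centred_binomial n p" by (simp add: Q_def n_def p_def)
  have Q: "real_distribution Q" and Q2: "integrable Q (\<lambda>x. x\<^sup>2)"
    unfolding Qnp by (rule real_distribution_centred_binomial[OF p01], rule integrable_square_centred_binomial[OF p01])
  have latQ: "AE x in Q. x + m \<in> \<int>"
  proof -
    \<comment> \<open>The argument of the fractional part \<open>f\<close> is
      \<open>n / 2 - m\<close>, so \<open>n * p = n / 2 - f\<close> is \<open>m\<close> plus the
      integer part of that argument.\<close>
    have np: "real n * p = m + of_int \<lfloor>- m + 2 * \<sigma>2 + \<delta> / 2\<rfloor>"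
    proof -
      have "real n * p = n / 2 - n * t" by (simp add: p_def algebra_simps)
      also have "n * t = f" using n5 by (simp add: tf)
      finally show ?thesis unfolding f_def frac_def using n by linarith
    qed
    have "x + m \<in> \<int>" if "x + real n * p \<in> \<int>" for x
    proof -
      have "x + m = (x + real n * p) - of_int \<lfloor>- m + 2 * \<sigma>2 + \<delta> / 2\<rfloor>" using np by simp
      also have "\<dots> \<in> \<int>" by (intro Ints_diff that Ints_of_int)
      finally show ?thesis .
    qed
    then show ?thesis unfolding Qnp using centred_binomial_lattice[OF p01, of n] by (auto elim!: eventually_mono)
  qed
  interpret P: real_distribution P by (rule P)
  interpret Q: real_distribution Q by (rule Q)
  define D where "D \<theta> = char P \<theta> - char Q \<theta>" for \<theta>
  define D' where "D' \<theta> = \<i> * dchar P \<theta> - \<i> * dchar Q \<theta>" for \<theta>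
  \<comment> \<open>One summand for each source of error: \<open>A\<close> for \<open>P\<close>,
    \<open>5 * S\<close> for the binomial, where \<open>n \<le> 5 * S * v\<close>, and 1 for the
    variance mismatch.\<close>
  define A1 where "A1 = A + 5 * S + 1"
  have dD: "(D has_vector_derivative D' \<theta>) (at \<theta>)" for \<theta>
    unfolding D_def D'_def
    by (intro has_vector_derivative_diff P.char_has_vector_derivative P2 Q.char_has_vector_derivative Q2)
  have D0: "D 0 = 0" by (simp add: D_def P.char_zero Q.char_zero)
  have S0: "0 \<le> S" using upper \<sigma>2 v by (smt (verit) mult_neg_pos)
  have err: "norm (D' \<theta> + \<sigma>2 * \<theta> * D \<theta>) \<le> A1 * (s\<^sup>2 * \<theta>\<^sup>2 + \<bar>\<theta>\<bar>) * exp (- (k / 10) * s\<^sup>2 * \<theta>\<^sup>2)"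
    if \<theta>: "\<bar>\<theta>\<bar> \<le> pi" for \<theta>
  proof -
    define e where "e = exp (- (k / 10) * v * \<theta>\<^sup>2)"
    have e0: "0 \<le> e" by (simp add: e_def)
    have eP: "exp (- k * v * \<theta>\<^sup>2) \<le> e"
    proof -
      have "0 \<le> k * v * \<theta>\<^sup>2" using k v by simp
      then show ?thesis by (simp add: e_def)
    qed
    \<comment> \<open>Origin of \<open>k / 10\<close>:
      \<open>n - 1 \<ge> 3 * \<sigma>2 \<ge> 6 * k * v\<close>, and
      \<open>6 * (21 / 100) / 12\<close> exceeds \<open>1 / 10\<close>.\<close>
    have eQ: "exp (- (real n - 1) * (p * (1 - p) / 12) * \<theta>\<^sup>2) \<le> e"
    proof -
      have "6 * (k * v) \<le> real n - 1" using n \<delta> lower \<sigma>2 by linarith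
      then have "6 * (k * v) * ((21 / 100) / 12) \<le> (real n - 1) * (p * (1 - p) / 12)"
        using pq k v n5 by (intro mult_mono) auto
      moreover have "0 \<le> k * v" using k v by simp
      ultimately have "k / 10 * v \<le> (real n - 1) * (p * (1 - p) / 12)" by linarith
      then have "k / 10 * v * \<theta>\<^sup>2 \<le> (real n - 1) * (p * (1 - p) / 12) * \<theta>\<^sup>2"
        by (intro mult_right_mono) auto
      then show ?thesis by (simp only: e_def exp_le_cancel_iff mult_minus_left neg_le_iff_le)
    qed
    have 1: "norm (\<i> * dchar P \<theta> + \<sigma>2 * \<theta> * char P \<theta>) \<le> A * v * \<theta>\<^sup>2 * e"
    proof -
      have "\<i> * dchar P \<theta> + \<sigma>2 * \<theta> * char P \<theta> = \<i> * (dchar P \<theta> - \<i> * \<theta> * \<sigma>2 * char P \<theta>)"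
        by (simp add: algebra_simps)
      then have "norm (\<i> * dchar P \<theta> + \<sigma>2 * \<theta> * char P \<theta>) = norm (dchar P \<theta> - \<i> * \<theta> * \<sigma>2 * char P \<theta>)"
        by (simp only: norm_mult norm_ii mult_1)
      also have "\<dots> \<le> A * v * \<theta>\<^sup>2 * exp (- k * v * \<theta>\<^sup>2)" by (rule stein[OF \<theta>])
      also have "\<dots> \<le> A * v * \<theta>\<^sup>2 * e" using A v by (intro mult_left_mono eP) auto
      finally show ?thesis .
    qed
    have n0: "0 < n" using n5 by simp
    have "norm (\<i> * dchar Q \<theta> + real n * p * (1 - p) * \<theta> * char Q \<theta>) \<le> n * \<theta>\<^sup>2 * exp (- (real n - 1) * (p * (1 - p) / 12) * \<theta>\<^sup>2)"
      unfolding Qnp by (rule centred_binomial_stein(1)[OF p01 n0 \<theta>])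
    also have "\<dots> \<le> (5 * S * v) * \<theta>\<^sup>2 * e"
    proof (intro mult_mono eQ)
      show "real n \<le> 5 * S * v" using n \<delta> \<sigma>2 upper by linarith
    qed (use S0 v in auto)
    finally have 2: "norm (\<i> * dchar Q \<theta> + real n * p * (1 - p) * \<theta> * char Q \<theta>) \<le> (5 * S * v) * \<theta>\<^sup>2 * e" .
    have 3: "norm ((real n * p * (1 - p) - \<sigma>2) * \<theta> * char Q \<theta>) \<le> 1 * \<bar>\<theta>\<bar> * e"
    proof -
      have "norm (char Q \<theta>) \<le> e"
        using centred_binomial_stein(2)[OF p01 n0 \<theta>] eQ unfolding Qnp by linarith
      then show ?thesis unfolding norm_mult norm_of_real abs_mult
        by (intro mult_mono var) auto
    qed
    have "D' \<theta> + \<sigma>2 * \<theta> * D \<theta> = (\<i> * dchar P \<theta> + \<sigma>2 * \<theta> * char P \<theta>)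
        - (\<i> * dchar Q \<theta> + real n * p * (1 - p) * \<theta> * char Q \<theta>)
        + (real n * p * (1 - p) - \<sigma>2) * \<theta> * char Q \<theta>"
      by (simp add: D_def D'_def algebra_simps)
    then have "norm (D' \<theta> + \<sigma>2 * \<theta> * D \<theta>) \<le> A * v * \<theta>\<^sup>2 * e + (5 * S * v) * \<theta>\<^sup>2 * e + 1 * \<bar>\<theta>\<bar> * e"
      using norm_triangle_le[OF add_mono[OF norm_triangle_le_diff[OF add_mono[OF 1 2]] 3]] by simp
    also have "\<dots> = ((A + 5 * S) * (v * \<theta>\<^sup>2) + \<bar>\<theta>\<bar>) * e" by (simp add: algebra_simps)
    also have "\<dots> \<le> (A1 * (v * \<theta>\<^sup>2 + \<bar>\<theta>\<bar>)) * e"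
    proof (intro mult_right_mono e0)
      have "0 \<le> (A + 5 * S) * \<bar>\<theta>\<bar> + v * \<theta>\<^sup>2" using A S0 v by simp
      then show "(A + 5 * S) * (v * \<theta>\<^sup>2) + \<bar>\<theta>\<bar> \<le> A1 * (v * \<theta>\<^sup>2 + \<bar>\<theta>\<bar>)" by (simp add: A1_def algebra_simps)
    qed
    finally show ?thesis by (simp add: e_def s(2))
  qed
  have A1: "0 \<le> A1" using A S0 by (simp add: A1_def)
  have k': "0 < k / 10" "2 * (k / 10 * s\<^sup>2) \<le> \<sigma>2"
  proof -
    have "0 \<le> k * v" using k v by simp
    then show "2 * (k / 10 * s\<^sup>2) \<le> \<sigma>2" using lower unfolding s(2) by linarith
  qed (use k in simp)
  note scaled = gaussian_ode_scaled[OF dD D0 err A1 s(1) k' upper[folded s(2)]]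
  have B: "B = A1 * (1 + S) * (2 * (1 + 3 / (k / 10)) ^ 3)" by (simp add: B_def A1_def)
  have 0: "0 \<le> B" unfolding B using A1 S0 k by simp
  have 1: "norm (char P \<theta> - char Q \<theta>) \<le> B / s * (1 / (1 + s\<^sup>2 * \<theta>\<^sup>2))" if "\<bar>\<theta>\<bar> \<le> pi" for \<theta>
    unfolding B D_def[symmetric] by (rule scaled(2)) (use that in simp_all)
  have 2: "norm (dchar P \<theta> - dchar Q \<theta>) \<le> B * (1 / (1 + s\<^sup>2 * \<theta>\<^sup>2))" if "\<bar>\<theta>\<bar> \<le> pi" for \<theta>
  proof -
    have "D' \<theta> = \<i> * (dchar P \<theta> - dchar Q \<theta>)" by (simp add: D'_def right_diff_distrib)
    then have "norm (dchar P \<theta> - dchar Q \<theta>) = norm (D' \<theta>)" by (simp only: norm_mult norm_ii mult_1)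
    also have "\<dots> \<le> B * (1 / (1 + s\<^sup>2 * \<theta>\<^sup>2))"
      unfolding B by (rule scaled(3)) (use that in simp_all)
    finally show ?thesis .
  qed
  show "d_TV P Q \<le> 3 * B / sqrt v"
    using d_TV_d_loc_le(1)[OF P Q P2 Q2 lat latQ s(1) 0 1 2] by (simp add: s_def)
  show "d_loc P Q \<le> B / (2 * v)"
    using d_TV_d_loc_le(2)[OF P Q P2 Q2 lat latQ s(1) 0 1 2] by (simp only: s(2))
qed

section \<open>Splitting a Poisson sample into independent cells\<close>

text \<open>The multinomial coefficient. Reading the values of \<kappa> at \<open>1, ..., n\<close>
  as a word identifies these functions with the permutations of the multiset that contains each
  \<open>c\<close> exactly \<open>k c\<close> times.\<close>

lemma card_functions_with_counts:
  fixes k :: "'c \<Rightarrow> nat"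
  assumes V: "finite V" and k: "\<And>c. c \<notin> V \<Longrightarrow> k c = 0" and n: "n = (\<Sum>c\<in>V. k c)"
  shows "card {\<kappa> \<in> {1..n} \<rightarrow>\<^sub>E V. \<forall>c. card {i\<in>{1..n}. \<kappa> i = c} = k c} * (\<Prod>c\<in>V. fact (k c)) = (fact n :: nat)"
proof -
  define A where "A = (\<Sum>c\<in>V. replicate_mset (k c) c)"
  have cA: "count A c = k c" for c
  proof -
    have "count A c = (\<Sum>d\<in>V. if c = d then k d else 0)"
      unfolding A_def count_sum by (intro sum.cong refl) auto
    then show ?thesis using V k by simp
  qed
  have sA: "set_mset A \<subseteq> V" using k by (auto simp: set_mset_def cA) (metis less_irrefl)
  have szA: "size A = n" unfolding A_def n using V by (induction V rule: finite_induct) auto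
  have cnt: "count (mset (map \<kappa> [1..<Suc n])) c = card {i\<in>{1..n}. \<kappa> i = c}" for \<kappa> :: "nat \<Rightarrow> 'c" and c
  proof -
    have "count (mset (map \<kappa> [1..<Suc n])) c = length (filter (\<lambda>i. \<kappa> i = c) [1..<Suc n])"
      by (simp only: count_mset count_list_eq_length_filter filter_map length_map comp_def eq_commute[of c])
    also have "\<dots> = card (set (filter (\<lambda>i. \<kappa> i = c) [1..<Suc n]))"
      by (intro distinct_card[symmetric] distinct_filter distinct_upt)
    also have "set (filter (\<lambda>i. \<kappa> i = c) [1..<Suc n]) = {i\<in>{1..n}. \<kappa> i = c}" by auto
    finally show ?thesis .
  qed
  have "bij_betw (\<lambda>\<kappa>. map \<kappa> [1..<Suc n]) {\<kappa> \<in> {1..n} \<rightarrow>\<^sub>E V. \<forall>c. card {i\<in>{1..n}. \<kappa> i = c} = k c}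
      (permutations_of_multiset A)"
  proof (rule bij_betw_byWitness[where f' = "\<lambda>xs. \<lambda>i\<in>{1..n}. xs ! (i - 1)"])
    show "\<forall>\<kappa>\<in>{\<kappa> \<in> {1..n} \<rightarrow>\<^sub>E V. \<forall>c. card {i\<in>{1..n}. \<kappa> i = c} = k c}.
        (\<lambda>i\<in>{1..n}. map \<kappa> [1..<Suc n] ! (i - 1)) = \<kappa>"
      by (auto simp: fun_eq_iff PiE_def extensional_def simp del: upt_Suc)
    show rinv: "\<forall>xs\<in>permutations_of_multiset A. map (\<lambda>i\<in>{1..n}. xs ! (i - 1)) [1..<Suc n] = xs"
    proof
      fix xs assume "xs \<in> permutations_of_multiset A"
      then have "length xs = n" by (metis permutations_of_multisetD size_mset szA)
      then show "map (\<lambda>i\<in>{1..n}. xs ! (i - 1)) [1..<Suc n] = xs"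
        by (intro nth_equalityI) (auto simp del: upt_Suc)
    qed
    show "(\<lambda>\<kappa>. map \<kappa> [1..<Suc n]) ` {\<kappa> \<in> {1..n} \<rightarrow>\<^sub>E V. \<forall>c. card {i\<in>{1..n}. \<kappa> i = c} = k c}
        \<subseteq> permutations_of_multiset A"
      by (auto intro!: permutations_of_multisetI multiset_eqI simp only: cnt cA)
    show "(\<lambda>xs. \<lambda>i\<in>{1..n}. xs ! (i - 1)) ` permutations_of_multiset A
        \<subseteq> {\<kappa> \<in> {1..n} \<rightarrow>\<^sub>E V. \<forall>c. card {i\<in>{1..n}. \<kappa> i = c} = k c}"
    proof safe
      fix xs assume xs: "xs \<in> permutations_of_multiset A"
      then have m: "mset xs = A" by (rule permutations_of_multisetD)
      then have len: "length xs = n" using szA by auto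
      show "(\<lambda>i\<in>{1..n}. xs ! (i - 1)) i \<in> V" if "i \<in> {1..n}" for i
      proof -
        have "xs ! (i - 1) \<in> set xs" using that len by (intro nth_mem) auto
        then have "xs ! (i - 1) \<in># A" unfolding m[symmetric] by simp
        then show ?thesis using sA that by auto
      qed
      show "card {i\<in>{1..n}. (\<lambda>i\<in>{1..n}. xs ! (i - 1)) i = c} = k c" for c
        using cnt[of "\<lambda>i\<in>{1..n}. xs ! (i - 1)" c] rinv[rule_format, OF xs] m cA by metis
    qed auto
  qed
  then have "card {\<kappa> \<in> {1..n} \<rightarrow>\<^sub>E V. \<forall>c. card {i\<in>{1..n}. \<kappa> i = c} = k c} = card (permutations_of_multiset A)"
    by (rule bij_betw_same_card)
  moreover have "(\<Prod>c\<in>V. fact (k c)) = (\<Prod>c\<in>set_mset A. fact (count A c) :: nat)"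
    unfolding cA using sA V
    by (intro prod.mono_neutral_right) (auto simp: not_in_iff cA)
  ultimately show ?thesis using card_permutations_of_multiset_aux[of A] szA by simp
qed

text \<open>Given the total, the counts are multinomial, and the atom at \<open>k\<close> receives
  mass only from the total \<open>N = \<Sum>c\<in>V. k c\<close>, so the mixture collapses to one
  term. The default value 0 of \<open>Pi_pmf\<close> agrees with the count of a cell outside
  \<open>V\<close>.\<close>

lemma poisson_counts:
  assumes V: "finite V" "V \<noteq> {}" and l: "0 < l"
  shows "bind_pmf (poisson_pmf l)
      (\<lambda>n. map_pmf (\<lambda>\<kappa> c. card {i\<in>{1..n}. \<kappa> i = c}) (pmf_of_set ({1..n} \<rightarrow>\<^sub>E V)))
    = Pi_pmf V 0 (\<lambda>_. poisson_pmf (l / card V))" (is "bind_pmf _ ?f = _")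
proof (rule pmf_eqI)
  fix k :: "'a \<Rightarrow> nat"
  define N where "N = (\<Sum>c\<in>V. k c)"
  have cV: "0 < card V" using V by (simp add: card_gt_0_iff)
  have finK: "finite ({1..n} \<rightarrow>\<^sub>E V)" and neK: "{1..n} \<rightarrow>\<^sub>E V \<noteq> {}" for n :: nat
    using V by (auto intro!: finite_PiE simp: PiE_eq_empty_iff)
  have f: "pmf (?f n) k = card {\<kappa> \<in> {1..n} \<rightarrow>\<^sub>E V. \<forall>c. card {i\<in>{1..n}. \<kappa> i = c} = k c} / card V ^ n" for n
  proof -
    have "pmf (?f n) k = real (card (({1..n} \<rightarrow>\<^sub>E V) \<inter> (\<lambda>\<kappa> c. card {i\<in>{1..n}. \<kappa> i = c}) -` {k})) / card ({1..n} \<rightarrow>\<^sub>E V)"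
      unfolding pmf_map by (rule measure_pmf_of_set[OF neK finK])
    moreover have "({1..n} \<rightarrow>\<^sub>E V) \<inter> (\<lambda>\<kappa> c. card {i\<in>{1..n}. \<kappa> i = c}) -` {k}
        = {\<kappa> \<in> {1..n} \<rightarrow>\<^sub>E V. \<forall>c. card {i\<in>{1..n}. \<kappa> i = c} = k c}"
      by (auto simp: fun_eq_iff)
    ultimately show ?thesis by (simp add: card_PiE)
  qed
  have only: "n = N \<and> (\<forall>c. c \<notin> V \<longrightarrow> k c = 0)" if "pmf (?f n) k \<noteq> 0" for n
  proof -
    have "{\<kappa> \<in> {1..n} \<rightarrow>\<^sub>E V. \<forall>c. card {i\<in>{1..n}. \<kappa> i = c} = k c} \<noteq> {}"
      using that unfolding f by (metis (no_types, lifting) card.empty div_0 of_nat_0)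
    then obtain \<kappa> where \<kappa>: "\<kappa> \<in> {1..n} \<rightarrow>\<^sub>E V" "\<And>c. card {i\<in>{1..n}. \<kappa> i = c} = k c" by auto
    have "k c = 0" if "c \<notin> V" for c
    proof -
      have "{i\<in>{1..n}. \<kappa> i = c} = {}" using \<kappa>(1) that by (auto simp: PiE_iff)
      then show ?thesis unfolding \<kappa>(2)[symmetric] by (simp only: card.empty)
    qed
    moreover have "N = (\<Sum>c\<in>V. \<Sum>i\<in>{i\<in>{1..n}. \<kappa> i = c}. 1)" unfolding N_def \<kappa>(2)[symmetric] by simp
    moreover have "\<dots> = (\<Sum>i\<in>{1..n}. 1)"
      by (rule sum.group) (use V \<kappa>(1) in auto)
    ultimately show ?thesis by simp
  qed
  have lhs: "pmf (bind_pmf (poisson_pmf l) ?f) k = pmf (?f N) k * pmf (poisson_pmf l) N"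
  proof -
    have "pmf (bind_pmf (poisson_pmf l) ?f) k = measure_pmf.expectation (poisson_pmf l) (\<lambda>n. pmf (?f n) k)"
      by (rule pmf_bind)
    also have "\<dots> = (\<Sum>n\<in>{N}. pmf (?f n) k * pmf (poisson_pmf l) n)"
      by (rule integral_measure_pmf_real) (use only in auto)
    finally show ?thesis by simp
  qed
  show "pmf (bind_pmf (poisson_pmf l) ?f) k = pmf (Pi_pmf V 0 (\<lambda>_. poisson_pmf (l / card V))) k"
  proof (cases "\<forall>c. c \<notin> V \<longrightarrow> k c = 0")
    case False
    then have "pmf (?f N) k = 0" using only by blast
    then show ?thesis using False V unfolding lhs by (auto simp: pmf_Pi)
  next
    case True
    define T where "T = card {\<kappa> \<in> {1..N} \<rightarrow>\<^sub>E V. \<forall>c. card {i\<in>{1..N}. \<kappa> i = c} = k c}"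
    define R where "R = (\<Prod>c\<in>V. fact (k c) :: real)"
    have R: "R > 0" unfolding R_def by (intro prod_pos) simp
    have "T * (\<Prod>c\<in>V. fact (k c)) = (fact N :: nat)"
      unfolding T_def by (rule card_functions_with_counts[OF V(1) _ N_def]) (use True in auto)
    then have "real (T * (\<Prod>c\<in>V. fact (k c))) = real (fact N)" by (rule arg_cong)
    then have T: "real T = fact N / R" using R by (simp add: R_def field_simps)
    have "pmf (Pi_pmf V 0 (\<lambda>_. poisson_pmf (l / card V))) k = (\<Prod>c\<in>V. (l / card V) ^ k c / fact (k c) * exp (- (l / card V)))"
      using True V l cV by (simp add: pmf_Pi)
    also have "\<dots> = (l / card V) ^ N / R * exp (- (l / card V)) ^ card V"
      by (simp add: prod.distrib prod_dividef R_def N_def power_sum)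
    also have "exp (- (l / card V)) ^ card V = exp (- l)"
      using cV by (simp add: exp_of_nat_mult[symmetric])
    finally show ?thesis
      unfolding lhs f T_def[symmetric] T using l by (simp add: power_divide)
  qed
qed

section \<open>Joining counts and positions\<close>

text \<open>Converts a family of counts together with a family of point sequences into one family of
  pairs, the form in which cells are independent coordinates. On boxes the inner measure is a
  product over the cells, and its integral over the counts factors.\<close>

lemma distr_pair_Pi_pmf_PiM:
  fixes p :: "'c \<Rightarrow> 'd pmf" and N :: "'c \<Rightarrow> 'b measure"
  assumes V: "finite V" and N: "\<And>c. prob_space (N c)"
  shows "distr (measure_pmf (Pi_pmf V d p) \<Otimes>\<^sub>M PiM V N) (PiM V (\<lambda>c. measure_pmf (p c) \<Otimes>\<^sub>M N c))
      (\<lambda>(k, z). \<lambda>c\<in>V. (k c, z c)) = PiM V (\<lambda>c. measure_pmf (p c) \<Otimes>\<^sub>M N c)" (is "distr ?P ?M ?f = _")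
proof -
  interpret N: prob_space "N c" for c by (rule N)
  have pr: "prob_space (measure_pmf (p c) \<Otimes>\<^sub>M N c)" for c
    by (intro prob_space_pair measure_pmf.prob_space_axioms N)
  interpret product_prob_space "\<lambda>c. measure_pmf (p c) \<Otimes>\<^sub>M N c" V by (rule product_prob_spaceI) (rule pr)
  interpret NP: product_prob_space N V by (rule product_prob_spaceI) (rule N)
  have fm [measurable]: "?f \<in> measurable ?P ?M"
    unfolding case_prod_beta'
  proof (rule measurable_restrict, rule measurable_Pair)
    fix c assume c: "c \<in> V"
    show "(\<lambda>x. fst x c) \<in> measurable ?P (measure_pmf (p c))"
      by (rule measurable_compose[OF measurable_fst]) simp
    show "(\<lambda>x. snd x c) \<in> measurable ?P (N c)"
      by (rule measurable_compose[OF measurable_snd measurable_component_singleton[OF c]])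
  qed
  show ?thesis
  proof (rule PiM_eqI[OF V])
    fix A assume A: "\<And>c. c \<in> V \<Longrightarrow> A c \<in> sets (measure_pmf (p c) \<Otimes>\<^sub>M N c)"
    have E: "Pi\<^sub>E V A \<in> sets ?M" using V A by (intro sets_PiM_I_finite) auto
    have sec: "Pair a -` A c \<in> sets (N c)" if "c \<in> V" for a c
      using A[OF that] by (rule sets_Pair1)
    have "emeasure (distr ?P ?M ?f) (Pi\<^sub>E V A) = emeasure ?P (?f -` Pi\<^sub>E V A \<inter> space ?P)"
      by (rule emeasure_distr[OF fm E])
    also have "\<dots> = (\<integral>\<^sup>+k. emeasure (PiM V N) (Pair k -` (?f -` Pi\<^sub>E V A \<inter> space ?P)) \<partial>Pi_pmf V d p)"
      by (rule NP.P.emeasure_pair_measure_alt) (rule measurable_sets[OF fm E])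
    also have "\<dots> = (\<integral>\<^sup>+k. (\<Prod>c\<in>V. emeasure (N c) (Pair (k c) -` A c)) \<partial>Pi_pmf V d p)"
    proof (rule nn_integral_cong)
      fix k
      have "Pair k -` (?f -` Pi\<^sub>E V A \<inter> space ?P) = Pi\<^sub>E V (\<lambda>c. Pair (k c) -` A c)"
      proof (rule set_eqI)
        fix z
        have sub: "z c \<in> space (N c)" if "c \<in> V" "(k c, z c) \<in> A c" for c
          using sets.sets_into_space[OF sec[OF that(1), of "k c"]] that(2) by auto
        show "z \<in> Pair k -` (?f -` Pi\<^sub>E V A \<inter> space ?P) \<longleftrightarrow> z \<in> Pi\<^sub>E V (\<lambda>c. Pair (k c) -` A c)"
          using sub by (simp add: space_pair_measure space_PiM PiE_iff Pi_iff) blast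
      qed
      then show "emeasure (PiM V N) (Pair k -` (?f -` Pi\<^sub>E V A \<inter> space ?P)) = (\<Prod>c\<in>V. emeasure (N c) (Pair (k c) -` A c))"
        using V sec by (simp add: NP.emeasure_PiM)
    qed
    also have "\<dots> = (\<Prod>c\<in>V. \<integral>\<^sup>+a. emeasure (N c) (Pair a -` A c) \<partial>p c)"
      by (rule nn_integral_prod_Pi_pmf[OF V])
    also have "\<dots> = (\<Prod>c\<in>V. emeasure (measure_pmf (p c) \<Otimes>\<^sub>M N c) (A c))"
      using A by (intro prod.cong refl N.emeasure_pair_measure_alt[symmetric]) auto
    finally show "emeasure (distr ?P ?M ?f) (Pi\<^sub>E V A) = (\<Prod>c\<in>V. emeasure (measure_pmf (p c) \<Otimes>\<^sub>M N c) (A c))" .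
  qed simp
qed

text \<open>Entries of a doubly indexed independent array, read at the slots
  \<open>(\<kappa> i, \<rho> i)\<close>. Injectivity says that no slot is read twice; grouping the
  indices by cell reduces the claim to one sequence per cell.\<close>

lemma emeasure_PiM_nested:
  fixes S :: "'c \<Rightarrow> 'b measure" and \<kappa> :: "'i \<Rightarrow> 'c" and \<rho> :: "'i \<Rightarrow> nat"
  assumes V: "finite V" and S: "\<And>c. prob_space (S c)" and I: "finite I" and \<kappa>: "\<And>i. i \<in> I \<Longrightarrow> \<kappa> i \<in> V"
    and inj: "inj_on (\<lambda>i. (\<kappa> i, \<rho> i)) I" and A: "\<And>i. i \<in> I \<Longrightarrow> A i \<in> sets (S (\<kappa> i))"
  shows "emeasure (PiM V (\<lambda>c. PiM UNIV (\<lambda>_::nat. S c)))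
      {z \<in> space (PiM V (\<lambda>c. PiM UNIV (\<lambda>_. S c))). \<forall>i\<in>I. z (\<kappa> i) (\<rho> i) \<in> A i} = (\<Prod>i\<in>I. emeasure (S (\<kappa> i)) (A i))"
proof -
  let ?Z = "\<lambda>c. PiM UNIV (\<lambda>_::nat. S c)"
  have Z: "prob_space (?Z c)" for c by (intro prob_space_PiM S)
  interpret Z: product_prob_space ?Z V by (rule product_prob_spaceI) (rule Z)
  define B where "B c = {y \<in> space (?Z c). \<forall>i\<in>{i\<in>I. \<kappa> i = c}. y (\<rho> i) \<in> A i}" for c
  have B: "B c \<in> sets (?Z c) \<and> emeasure (?Z c) (B c) = (\<Prod>i\<in>{i\<in>I. \<kappa> i = c}. emeasure (S (\<kappa> i)) (A i))" for c
  proof -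
    define Ic where "Ic = {i\<in>I. \<kappa> i = c}"
    have injc: "inj_on \<rho> Ic" using inj by (auto simp: inj_on_def Ic_def)
    define X where "X k = A (the_inv_into Ic \<rho> k)" for k
    have X: "X (\<rho> i) = A i" if "i \<in> Ic" for i
      unfolding X_def using the_inv_into_f_f[OF injc that] by simp
    have Xs: "X k \<in> sets (S c)" if "k \<in> \<rho> ` Ic" for k
      using that X A by (auto simp: Ic_def)
    have fin: "finite (\<rho> ` Ic)" using I by (auto simp: Ic_def)
    have Beq: "B c = prod_emb UNIV (\<lambda>_. S c) (\<rho> ` Ic) (Pi\<^sub>E (\<rho> ` Ic) X)"
      using X by (auto simp: B_def Ic_def[symmetric] prod_emb_def space_PiM PiE_iff)
    have "emeasure (?Z c) (B c) = (\<Prod>k\<in>\<rho> ` Ic. emeasure (S c) (X k))"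
      unfolding Beq by (rule emeasure_PiM_emb) (use S fin Xs in auto)
    also have "\<dots> = (\<Prod>i\<in>Ic. emeasure (S (\<kappa> i)) (A i))"
      unfolding prod.reindex[OF injc] using X by (auto simp: Ic_def intro!: prod.cong)
    moreover have "B c \<in> sets (?Z c)"
      unfolding Beq by (rule sets_PiM_I) (use fin Xs in auto)
    ultimately show ?thesis by (simp add: Ic_def)
  qed
  have "{z \<in> space (PiM V ?Z). \<forall>i\<in>I. z (\<kappa> i) (\<rho> i) \<in> A i} = Pi\<^sub>E V B"
    using \<kappa> by (auto simp: B_def space_PiM PiE_iff extensional_def)
  then have "emeasure (PiM V ?Z) {z \<in> space (PiM V ?Z). \<forall>i\<in>I. z (\<kappa> i) (\<rho> i) \<in> A i}
      = (\<Prod>c\<in>V. \<Prod>i\<in>{i\<in>I. \<kappa> i = c}. emeasure (S (\<kappa> i)) (A i))"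
    using B V by (simp add: Z.emeasure_PiM)
  also have "\<dots> = (\<Prod>i\<in>I. emeasure (S (\<kappa> i)) (A i))"
    using I V \<kappa> by (intro prod.group) auto
  finally show ?thesis .
qed

text \<open>Independent points with law \<open>U\<close> arise by drawing cells uniformly and taking
  each point from the sequence of its cell. On boxes this is the interchange of a product of
  averages with an average of products over \<open>I \<rightarrow>\<^sub>E V\<close>. Slots may
  depend on \<kappa>, since any injective choice gives the same law, and \<open>pt\<close> adjusts
  points without changing \<open>S c\<close>.\<close>

lemma emeasure_PiM_mixture:
  fixes S :: "'c \<Rightarrow> 'b measure" and U :: "'b measure" and \<rho> :: "('i \<Rightarrow> 'c) \<Rightarrow> 'i \<Rightarrow> nat"
  assumes V: "finite V" "V \<noteq> {}" and S: "\<And>c. prob_space (S c)" and U: "prob_space U"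
    and sets: "\<And>c. sets (S c) = sets U"
    and mix: "\<And>A. A \<in> sets U \<Longrightarrow> emeasure U A = (\<Sum>c\<in>V. emeasure (S c) A) / card V"
    and pt: "\<And>c. pt c \<in> measurable U U" "\<And>c. distr (S c) U (pt c) = S c"
    and I: "finite I" and inj: "\<And>\<kappa>. \<kappa> \<in> I \<rightarrow>\<^sub>E V \<Longrightarrow> inj_on (\<lambda>i. (\<kappa> i, \<rho> \<kappa> i)) I"
    and E: "E \<in> sets (PiM I (\<lambda>_. U))"
  defines "Z \<equiv> PiM V (\<lambda>c. PiM UNIV (\<lambda>_::nat. S c))"
  shows "emeasure (PiM I (\<lambda>_. U)) E =
    (\<integral>\<^sup>+\<kappa>. emeasure Z {z \<in> space Z. (\<lambda>i\<in>I. pt (\<kappa> i) (z (\<kappa> i) (\<rho> \<kappa> i))) \<in> E} \<partial>pmf_of_set (I \<rightarrow>\<^sub>E V))"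
proof -
  let ?p = "pmf_of_set (I \<rightarrow>\<^sub>E V)"
  let ?Y = "\<lambda>\<kappa> z. \<lambda>i\<in>I. pt (\<kappa> i) (z (\<kappa> i) (\<rho> \<kappa> i))"
  interpret Z: prob_space Z unfolding Z_def by (intro prob_space_PiM S)
  have meq: "measurable (S c) U = measurable U U" for c
    by (rule measurable_cong_sets[OF sets refl])
  have sp: "space (S c) = space U" for c by (rule sets_eq_imp_space_eq[OF sets])
  have Ym: "?Y \<kappa> \<in> measurable Z (PiM I (\<lambda>_. U))" if "\<kappa> \<in> I \<rightarrow>\<^sub>E V" for \<kappa>
    unfolding Z_def
  proof (rule measurable_restrict)
    fix i assume "i \<in> I"
    then have "\<kappa> i \<in> V" using that by auto
    have "(\<lambda>z. z (\<kappa> i) (\<rho> \<kappa> i)) \<in> measurable (PiM V (\<lambda>c. PiM UNIV (\<lambda>_::nat. S c))) (S (\<kappa> i))"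
      by (rule measurable_compose[OF measurable_component_singleton[OF \<open>\<kappa> i \<in> V\<close>] measurable_component_singleton]) simp
    from measurable_compose[OF this, of "pt (\<kappa> i)" U] pt(1) meq
    show "(\<lambda>z. pt (\<kappa> i) (z (\<kappa> i) (\<rho> \<kappa> i))) \<in> measurable (PiM V (\<lambda>c. PiM UNIV (\<lambda>_::nat. S c))) U" by auto
  qed
  have K: "finite (I \<rightarrow>\<^sub>E V)" "I \<rightarrow>\<^sub>E V \<noteq> {}"
    using V I by (auto intro!: finite_PiE simp: PiE_eq_empty_iff)
  have cK: "card (I \<rightarrow>\<^sub>E V) = card V ^ card I" using I by (simp add: card_PiE)
  have cV: "0 < card V" using V by (simp add: card_gt_0_iff)
  \<comment> \<open>Outside the support of \<open>?p\<close> the value only has to be a probability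
    measure, so that \<open>k\<close> is a kernel everywhere.\<close>
  define k where "k \<kappa> = (if \<kappa> \<in> I \<rightarrow>\<^sub>E V then distr Z (PiM I (\<lambda>_. U)) (?Y \<kappa>) else PiM I (\<lambda>_. U))" for \<kappa>
  have pU: "prob_space (PiM I (\<lambda>_. U))" by (intro prob_space_PiM U)
  have pk: "prob_space (k \<kappa>)" and sk: "sets (k \<kappa>) = sets (PiM I (\<lambda>_. U))" for \<kappa>
    using pU Ym by (auto simp: k_def intro: Z.prob_space_distr)
  have km: "k \<in> measurable (measure_pmf ?p) (subprob_algebra (PiM I (\<lambda>_. U)))"
    using pk sk by (auto simp: space_subprob_algebra intro: prob_space_imp_subprob_space)
  have kY: "emeasure (k \<kappa>) F = emeasure Z {z \<in> space Z. ?Y \<kappa> z \<in> F}"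
    if "\<kappa> \<in> I \<rightarrow>\<^sub>E V" "F \<in> sets (PiM I (\<lambda>_. U))" for \<kappa> F
    using that Ym[OF that(1)] by (simp add: k_def emeasure_distr vimage_def Int_def conj_commute)
  have bnd: "emeasure (measure_pmf ?p \<bind> k) F = (\<integral>\<^sup>+\<kappa>. emeasure Z {z \<in> space Z. ?Y \<kappa> z \<in> F} \<partial>?p)"
    if F: "F \<in> sets (PiM I (\<lambda>_. U))" for F
  proof -
    have "emeasure (measure_pmf ?p \<bind> k) F = (\<integral>\<^sup>+\<kappa>. emeasure (k \<kappa>) F \<partial>?p)"
      by (rule emeasure_bind[OF _ km F]) simp
    also have "\<dots> = (\<integral>\<^sup>+\<kappa>. emeasure Z {z \<in> space Z. ?Y \<kappa> z \<in> F} \<partial>?p)"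
      by (rule nn_integral_cong_AE) (use kY[OF _ F] K in \<open>auto simp: AE_measure_pmf_iff\<close>)
    finally show ?thesis .
  qed
  interpret product_prob_space "\<lambda>_. U" I by (rule product_prob_spaceI) (rule U)
  have "measure_pmf ?p \<bind> k = PiM I (\<lambda>_. U)"
  proof (rule PiM_eqI[OF I])
    show "sets (measure_pmf ?p \<bind> k) = sets (PiM I (\<lambda>_. U))"
      by (rule sets_bind) (use sk in auto)
    fix A assume A: "\<And>i. i \<in> I \<Longrightarrow> A i \<in> sets U"
    have EA: "Pi\<^sub>E I A \<in> sets (PiM I (\<lambda>_. U))" using I A by (intro sets_PiM_I_finite) auto
    have r: "emeasure Z {z \<in> space Z. ?Y \<kappa> z \<in> Pi\<^sub>E I A} = (\<Prod>i\<in>I. emeasure (S (\<kappa> i)) (A i))"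
      if \<kappa>: "\<kappa> \<in> I \<rightarrow>\<^sub>E V" for \<kappa>
    proof -
      define A' where "A' i = pt (\<kappa> i) -` A i \<inter> space U" for i
      have A': "A' i \<in> sets (S (\<kappa> i))" "emeasure (S (\<kappa> i)) (A' i) = emeasure (S (\<kappa> i)) (A i)" if "i \<in> I" for i
      proof -
        show "A' i \<in> sets (S (\<kappa> i))" unfolding A'_def sets using measurable_sets[OF pt(1) A[OF that]] .
        have "emeasure (S (\<kappa> i)) (A i) = emeasure (distr (S (\<kappa> i)) U (pt (\<kappa> i))) (A i)" by (simp only: pt(2))
        also have "\<dots> = emeasure (S (\<kappa> i)) (A' i)"
          unfolding A'_def sp[of "\<kappa> i", symmetric] by (rule emeasure_distr) (use pt(1) meq A[OF that] in auto)
        finally show "emeasure (S (\<kappa> i)) (A' i) = emeasure (S (\<kappa> i)) (A i)" by simp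
      qed
      have "{z \<in> space Z. ?Y \<kappa> z \<in> Pi\<^sub>E I A} = {z \<in> space Z. \<forall>i\<in>I. z (\<kappa> i) (\<rho> \<kappa> i) \<in> A' i}"
        using \<kappa> by (auto simp: A'_def Z_def space_PiM PiE_iff sp)
      then have "emeasure Z {z \<in> space Z. ?Y \<kappa> z \<in> Pi\<^sub>E I A} = (\<Prod>i\<in>I. emeasure (S (\<kappa> i)) (A' i))"
        using emeasure_PiM_nested[where S = S and A = A', OF V(1) S I _ inj[OF \<kappa>] A'(1), folded Z_def] \<kappa> by auto
      then show ?thesis using A' by simp
    qed
    have "emeasure (measure_pmf ?p \<bind> k) (Pi\<^sub>E I A) = (\<integral>\<^sup>+\<kappa>. (\<Prod>i\<in>I. emeasure (S (\<kappa> i)) (A i)) \<partial>?p)"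
      unfolding bnd[OF EA] by (rule nn_integral_cong_AE) (use r K in \<open>auto simp: AE_measure_pmf_iff\<close>)
    also have "\<dots> = (\<Sum>\<kappa>\<in>I \<rightarrow>\<^sub>E V. \<Prod>i\<in>I. emeasure (S (\<kappa> i)) (A i)) / card (I \<rightarrow>\<^sub>E V)"
      by (rule nn_integral_pmf_of_set[OF K(2,1)])
    also have "\<dots> = (\<Prod>i\<in>I. \<Sum>c\<in>V. emeasure (S c) (A i)) / card (I \<rightarrow>\<^sub>E V)"
      by (subst prod_sum_PiE[OF I]) (use V in auto)
    also have "\<dots> = (\<Prod>i\<in>I. (\<Sum>c\<in>V. emeasure (S c) (A i)) / card V)"
      by (simp add: divide_ennreal_def prod.distrib cK ennreal_inverse_power)
    also have "\<dots> = (\<Prod>i\<in>I. emeasure U (A i))" using mix A by (intro prod.cong refl) auto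
    finally show "emeasure (measure_pmf ?p \<bind> k) (Pi\<^sub>E I A) = (\<Prod>i\<in>I. emeasure U (A i))" .
  qed
  then show ?thesis using bnd[OF E] by simp
qed

text \<open>Point \<open>i\<close> of the sample lies in cell \<open>\<kappa> i\<close>, where it is point number \<open>\<rho> i\<close>.\<close>

lemma poisson_thinning:
  fixes S :: "'c \<Rightarrow> 'b measure" and U :: "'b measure" and H :: "nat \<Rightarrow> (nat \<Rightarrow> 'b) \<Rightarrow> real"
    and l :: real and F :: "('c \<Rightarrow> nat \<times> (nat \<Rightarrow> 'b)) \<Rightarrow> real"
  assumes V: "finite V" "V \<noteq> {}" and S: "\<And>c. prob_space (S c)" and U: "prob_space U"
    and sets: "\<And>c. sets (S c) = sets U"
    and mix: "\<And>A. A \<in> sets U \<Longrightarrow> emeasure U A = (\<Sum>c\<in>V. emeasure (S c) A) / card V"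
    and pt: "\<And>c. pt c \<in> measurable U U" "\<And>c. distr (S c) U (pt c) = S c" and l: "0 < l"
    and H [measurable]: "\<And>n. H n \<in> borel_measurable (PiM {1..n} (\<lambda>_. U))"
    and F: "F \<in> borel_measurable (PiM V (\<lambda>c. measure_pmf (poisson_pmf (l / real (card V))) \<Otimes>\<^sub>M PiM UNIV (\<lambda>_. S c)))"
    and HF: "\<And>n \<kappa> \<rho> z. \<kappa> \<in> {1..n} \<rightarrow>\<^sub>E V \<Longrightarrow>
      (\<And>c. c \<in> V \<Longrightarrow> bij_betw \<rho> {i\<in>{1..n}. \<kappa> i = c} {..<card {i\<in>{1..n}. \<kappa> i = c}}) \<Longrightarrow>
      H n (\<lambda>i\<in>{1..n}. pt (\<kappa> i) (z (\<kappa> i) (\<rho> i))) = F (\<lambda>c\<in>V. (card {i\<in>{1..n}. \<kappa> i = c}, z c))"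
    and A: "A \<in> sets borel"
  defines "W \<equiv> PiM V (\<lambda>c. measure_pmf (poisson_pmf (l / real (card V))) \<Otimes>\<^sub>M PiM UNIV (\<lambda>_. S c))"
  shows "(\<integral>\<^sup>+n. emeasure (PiM {1..n} (\<lambda>_. U)) {x \<in> space (PiM {1..n} (\<lambda>_. U)). H n x \<in> A} \<partial>measure_pmf (poisson_pmf l))
    = emeasure W {\<omega> \<in> space W. F \<omega> \<in> A}"
proof -
  define Z where "Z = PiM V (\<lambda>c. PiM UNIV (\<lambda>_::nat. S c))"
  define cnt where "cnt n \<kappa> = (\<lambda>c. card {i\<in>{1..n}. \<kappa> i = c})" for n :: nat and \<kappa> :: "nat \<Rightarrow> 'c"
  define \<phi> where "\<phi> k = emeasure Z {z \<in> space Z. F (\<lambda>c\<in>V. (k c, z c)) \<in> A}" for k :: "'c \<Rightarrow> nat"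
  interpret Z: prob_space Z unfolding Z_def by (intro prob_space_PiM S)
  \<comment> \<open>The chosen bijection depends on \<open>i\<close> only through its cell, so all
    points of a cell are numbered by the same bijection.\<close>
  define \<rho> where "\<rho> n \<kappa> i = (SOME h. bij_betw h {j\<in>{1..n}. \<kappa> j = \<kappa> i} {..<cnt n \<kappa> (\<kappa> i)}) i"
    for n :: nat and \<kappa> :: "nat \<Rightarrow> 'c" and i
  have \<rho>: "bij_betw (\<rho> n \<kappa>) {i\<in>{1..n}. \<kappa> i = c} {..<cnt n \<kappa> c}" for n \<kappa> c
  proof -
    define h where "h = (SOME h. bij_betw h {j\<in>{1..n}. \<kappa> j = c} {..<cnt n \<kappa> c})"
    have "\<exists>h. bij_betw h {j\<in>{1..n}. \<kappa> j = c} {..<cnt n \<kappa> c}"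
      using ex_bij_betw_finite_nat[of "{j\<in>{1..n}. \<kappa> j = c}"] by (simp add: cnt_def atLeast0LessThan)
    then have "bij_betw h {j\<in>{1..n}. \<kappa> j = c} {..<cnt n \<kappa> c}" unfolding h_def by (rule someI_ex)
    moreover have "\<rho> n \<kappa> i = h i" if "i \<in> {i\<in>{1..n}. \<kappa> i = c}" for i
      using that by (simp add: \<rho>_def h_def)
    ultimately show ?thesis by (subst bij_betw_cong) auto
  qed
  have inj: "inj_on (\<lambda>i. (\<kappa> i, \<rho> n \<kappa> i)) {1..n}" for n \<kappa>
  proof (rule inj_onI)
    fix i j assume ij: "i \<in> {1..n}" "j \<in> {1..n}" and eq: "(\<kappa> i, \<rho> n \<kappa> i) = (\<kappa> j, \<rho> n \<kappa> j)"
    show "i = j" using \<rho>[of n \<kappa> "\<kappa> i"] ij eq unfolding bij_betw_def inj_on_def by auto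
  qed
  have K: "finite ({1..n} \<rightarrow>\<^sub>E V)" "{1..n} \<rightarrow>\<^sub>E V \<noteq> {}" for n :: nat
    using V by (auto intro!: finite_PiE simp: PiE_eq_empty_iff)
  \<comment> \<open>\<open>HF\<close> removes the numbering and the assignment \<kappa> except for
    the counts; this is what allows \<open>poisson_counts\<close> to be applied afterwards.\<close>
  have step: "emeasure (PiM {1..n} (\<lambda>_. U)) {x \<in> space (PiM {1..n} (\<lambda>_. U)). H n x \<in> A}
      = (\<integral>\<^sup>+\<kappa>. \<phi> (cnt n \<kappa>) \<partial>pmf_of_set ({1..n} \<rightarrow>\<^sub>E V))" for n
  proof -
    define E where "E = {x \<in> space (PiM {1..n} (\<lambda>_. U)). H n x \<in> A}"
    have E: "E \<in> sets (PiM {1..n} (\<lambda>_. U))"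
      unfolding E_def using A by measurable
    have "emeasure (PiM {1..n} (\<lambda>_. U)) E =
      (\<integral>\<^sup>+\<kappa>. emeasure Z {z \<in> space Z. (\<lambda>i\<in>{1..n}. pt (\<kappa> i) (z (\<kappa> i) (\<rho> n \<kappa> i))) \<in> E} \<partial>pmf_of_set ({1..n} \<rightarrow>\<^sub>E V))"
      unfolding Z_def by (rule emeasure_PiM_mixture[OF V S U sets mix pt _ inj E]) auto
    also have "\<dots> = (\<integral>\<^sup>+\<kappa>. \<phi> (cnt n \<kappa>) \<partial>pmf_of_set ({1..n} \<rightarrow>\<^sub>E V))"
    proof (rule nn_integral_cong_AE, unfold AE_measure_pmf_iff, rule ballI)
      fix \<kappa> assume "\<kappa> \<in> set_pmf (pmf_of_set ({1..n} \<rightarrow>\<^sub>E V))"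
      then have \<kappa>: "\<kappa> \<in> {1..n} \<rightarrow>\<^sub>E V" using K by simp
      have "(\<lambda>i\<in>{1..n}. pt (\<kappa> i) (z (\<kappa> i) (\<rho> n \<kappa> i))) \<in> E \<longleftrightarrow> F (\<lambda>c\<in>V. (cnt n \<kappa> c, z c)) \<in> A"
        if z: "z \<in> space Z" for z
      proof -
        have "(\<lambda>i\<in>{1..n}. pt (\<kappa> i) (z (\<kappa> i) (\<rho> n \<kappa> i))) \<in> space (PiM {1..n} (\<lambda>_. U))"
        proof -
          have "pt (\<kappa> i) (z (\<kappa> i) (\<rho> n \<kappa> i)) \<in> space U" if "i \<in> {1..n}" for i
          proof -
            have "\<kappa> i \<in> V" using \<kappa> that by auto
            then have "z (\<kappa> i) (\<rho> n \<kappa> i) \<in> space (S (\<kappa> i))" using z by (auto simp: Z_def space_PiM PiE_iff)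
            then show ?thesis using measurable_space[OF pt(1)] sets_eq_imp_space_eq[OF sets] by blast
          qed
          then show ?thesis by (auto simp: space_PiM)
        qed
        then show ?thesis unfolding E_def using HF[OF \<kappa>, of "\<rho> n \<kappa>" z] \<rho>[of n \<kappa>] by (simp add: cnt_def)
      qed
      then show "emeasure Z {z \<in> space Z. (\<lambda>i\<in>{1..n}. pt (\<kappa> i) (z (\<kappa> i) (\<rho> n \<kappa> i))) \<in> E} = \<phi> (cnt n \<kappa>)"
        unfolding \<phi>_def by (intro arg_cong[where f = "emeasure Z"]) auto
    qed
    finally show ?thesis unfolding E_def .
  qed
  let ?Q = "Pi_pmf V 0 (\<lambda>_. poisson_pmf (l / real (card V)))"
  have "(\<integral>\<^sup>+n. emeasure (PiM {1..n} (\<lambda>_. U)) {x \<in> space (PiM {1..n} (\<lambda>_. U)). H n x \<in> A} \<partial>measure_pmf (poisson_pmf l))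
      = (\<integral>\<^sup>+k. \<phi> k \<partial>bind_pmf (poisson_pmf l) (\<lambda>n. map_pmf (cnt n) (pmf_of_set ({1..n} \<rightarrow>\<^sub>E V))))"
    by (simp add: step nn_integral_bind_pmf del: One_nat_def)
  also have "\<dots> = (\<integral>\<^sup>+k. \<phi> k \<partial>?Q)"
    unfolding cnt_def using poisson_counts[OF V l] by simp
  also have "\<dots> = emeasure W {\<omega> \<in> space W. F \<omega> \<in> A}"
  proof -
    let ?f = "\<lambda>(k, z). \<lambda>c\<in>V. (k c :: nat, z c :: nat \<Rightarrow> 'b)"
    have Zc: "prob_space (PiM UNIV (\<lambda>_::nat. S c))" for c by (intro prob_space_PiM S)
    have W: "distr (measure_pmf ?Q \<Otimes>\<^sub>M Z) W ?f = W"
      unfolding W_def Z_def by (rule distr_pair_Pi_pmf_PiM[OF V(1) Zc])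
    have fm: "?f \<in> measurable (measure_pmf ?Q \<Otimes>\<^sub>M Z) W"
      unfolding case_prod_beta' W_def
    proof (rule measurable_restrict, rule measurable_Pair)
      fix c assume c: "c \<in> V"
      show "(\<lambda>x. fst x c) \<in> measurable (measure_pmf ?Q \<Otimes>\<^sub>M Z) (measure_pmf (poisson_pmf (l / real (card V))))"
        by (rule measurable_compose[OF measurable_fst]) simp
      show "(\<lambda>x. snd x c) \<in> measurable (measure_pmf ?Q \<Otimes>\<^sub>M Z) (PiM UNIV (\<lambda>_. S c))"
        unfolding Z_def by (rule measurable_compose[OF measurable_snd measurable_component_singleton[OF c]])
    qed
    have E: "{\<omega> \<in> space W. F \<omega> \<in> A} \<in> sets W" using F A unfolding W_def[symmetric] by measurable
    have "emeasure W {\<omega> \<in> space W. F \<omega> \<in> A} = emeasure (distr (measure_pmf ?Q \<Otimes>\<^sub>M Z) W ?f) {\<omega> \<in> space W. F \<omega> \<in> A}"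
      by (simp only: W)
    also have "\<dots> = emeasure (measure_pmf ?Q \<Otimes>\<^sub>M Z) (?f -` {\<omega> \<in> space W. F \<omega> \<in> A} \<inter> space (measure_pmf ?Q \<Otimes>\<^sub>M Z))"
      by (rule emeasure_distr[OF fm E])
    also have "\<dots> = (\<integral>\<^sup>+k. emeasure Z (Pair k -` (?f -` {\<omega> \<in> space W. F \<omega> \<in> A} \<inter> space (measure_pmf ?Q \<Otimes>\<^sub>M Z))) \<partial>?Q)"
      by (rule Z.emeasure_pair_measure_alt) (rule measurable_sets[OF fm E])
    also have "\<dots> = (\<integral>\<^sup>+k. \<phi> k \<partial>?Q)"
    proof (rule nn_integral_cong)
      fix k
      have "Pair k -` (?f -` {\<omega> \<in> space W. F \<omega> \<in> A} \<inter> space (measure_pmf ?Q \<Otimes>\<^sub>M Z)) = {z \<in> space Z. F (\<lambda>c\<in>V. (k c, z c)) \<in> A}"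
      proof (rule set_eqI)
        fix z
        have "?f (k, z) \<in> space W" if "z \<in> space Z"
          by (rule measurable_space[OF fm]) (use that in \<open>simp add: space_pair_measure\<close>)
        then show "z \<in> Pair k -` (?f -` {\<omega> \<in> space W. F \<omega> \<in> A} \<inter> space (measure_pmf ?Q \<Otimes>\<^sub>M Z)) \<longleftrightarrow> z \<in> {z \<in> space Z. F (\<lambda>c\<in>V. (k c, z c)) \<in> A}"
          by (auto simp: space_pair_measure)
      qed
      then show "emeasure Z (Pair k -` (?f -` {\<omega> \<in> space W. F \<omega> \<in> A} \<inter> space (measure_pmf ?Q \<Otimes>\<^sub>M Z))) = \<phi> k"
        by (simp only: \<phi>_def)
    qed
    finally show ?thesis by simp
  qed
  finally show ?thesis .
qed

section \<open>Cells of the torus\<close>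

text \<open>The half-open cube of side \<open>1 / m\<close> with lower corner \<open>c / m\<close>.
  The floor makes disjointness immediate, and the torus itself is the case
  \<open>m = 1\<close>.\<close>

definition cell :: "nat \<Rightarrow> ('n \<Rightarrow> int) \<Rightarrow> (real ^ 'n) set" where
  "cell m c = {x. \<forall>i. \<lfloor>real m * x $ i\<rfloor> = c i}"

definition cells :: "nat \<Rightarrow> ('n \<Rightarrow> int) set" where
  "cells m = {c. \<forall>i. 0 \<le> c i \<and> c i < int m}"

text \<open>For \<open>r * m \<le> 3\<close> a point reaches at most 3/2 cell widths in each
  coordinate, so cell indices differ by at most 2, modulo \<open>m\<close> because of the
  torus.\<close>

definition cell_nbs :: "nat \<Rightarrow> ('n \<Rightarrow> int) \<Rightarrow> ('n \<Rightarrow> int) set" where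
  "cell_nbs m c = {c' \<in> cells m. \<forall>i. \<exists>k\<in>{-2..2}. c' i = (c i + k) mod int m}"

lemma cells_PiE: "cells m = (UNIV :: 'n set) \<rightarrow>\<^sub>E {0..<int m}"
  by (auto simp: cells_def PiE_iff)

lemma finite_cells: "finite (cells m :: ('n::finite \<Rightarrow> int) set)"
  unfolding cells_PiE by (intro finite_PiE) auto

lemma card_cells: "card (cells m :: ('n::finite \<Rightarrow> int) set) = m ^ CARD('n)"
  unfolding cells_PiE by (subst card_PiE) auto

lemma cells_nonempty: "0 < m \<Longrightarrow> (cells m :: ('n::finite \<Rightarrow> int) set) \<noteq> {}"
  by (auto simp: cells_def intro!: exI[of _ "\<lambda>_. 0"])

lemma cell_nbs_refl: "c \<in> cells m \<Longrightarrow> c \<in> cell_nbs m c"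
  unfolding cell_nbs_def by (auto simp: cells_def intro!: bexI[of _ 0])

lemma cell_nbs_sub: "cell_nbs m c \<subseteq> cells m"
  by (auto simp: cell_nbs_def)

lemma cell_nbs_sym:
  assumes c: "c \<in> cells m" and c': "c' \<in> cell_nbs m c"
  shows "c \<in> cell_nbs m c'"
  unfolding cell_nbs_def
proof (intro CollectI conjI allI c)
  fix i
  obtain k where k: "k \<in> {-2..2}" "c' i = (c i + k) mod int m" using c' unfolding cell_nbs_def by blast
  have "(c' i + - k) mod int m = c i mod int m"
    unfolding k(2) by (simp add: mod_diff_left_eq)
  also have "\<dots> = c i" using c by (simp add: cells_def)
  finally show "\<exists>k\<in>{-2..2}. c i = (c' i + k) mod int m"
    using k(1) by (intro bexI[of _ "- k"]) auto
qed

lemma card_cell_nbs: "card (cell_nbs m (c :: 'n::finite \<Rightarrow> int)) \<le> 5 ^ CARD('n)"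
proof -
  let ?K = "(UNIV :: 'n set) \<rightarrow>\<^sub>E {-2..2::int}"
  have fin: "finite ?K" by (intro finite_PiE) auto
  have "cell_nbs m c \<subseteq> (\<lambda>k i. (c i + k i) mod int m) ` ?K"
  proof
    fix c' assume "c' \<in> cell_nbs m c"
    then have "\<forall>i. \<exists>k. k \<in> {-2..2} \<and> c' i = (c i + k) mod int m" unfolding cell_nbs_def by blast
    then obtain k where "\<forall>i. k i \<in> {-2..2} \<and> c' i = (c i + k i) mod int m" by metis
    then show "c' \<in> (\<lambda>k i. (c i + k i) mod int m) ` ?K" by (intro image_eqI[of _ _ k]) auto
  qed
  then have "card (cell_nbs m c) \<le> card ?K" by (rule surj_card_le[OF fin])
  also have "card ?K = 5 ^ CARD('n)" by (subst card_PiE) auto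
  finally show ?thesis .
qed

lemma torus_eq_cell: "torus = cell 1 (\<lambda>_. 0)"
  by (auto simp: torus_def cell_def floor_eq_iff)

lemma torus_eq_UN_cells:
  assumes m: "0 < m"
  shows "torus = (\<Union>c\<in>cells m. cell m c)"
proof (intro set_eqI iffI)
  fix x :: "real ^ 'a" assume x: "x \<in> torus"
  have "(\<lambda>i. \<lfloor>real m * x $ i\<rfloor>) \<in> cells m"
    using x m by (auto simp: cells_def torus_def floor_less_iff)
  then show "x \<in> (\<Union>c\<in>cells m. cell m c)" by (auto simp: cell_def)
next
  fix x :: "real ^ 'a" assume "x \<in> (\<Union>c\<in>cells m. cell m c)"
  then obtain c where c: "\<And>i. 0 \<le> c i \<and> c i < int m" "\<And>i. \<lfloor>real m * x $ i\<rfloor> = c i"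
    unfolding cells_def cell_def by blast
  then have "0 \<le> real m * x $ i" "real m * x $ i < real m" for i
    using c[of i] by linarith+
  then show "x \<in> torus" using m by (auto simp: torus_def zero_le_mult_iff)
qed

lemma cell_sub_torus: "0 < m \<Longrightarrow> c \<in> cells m \<Longrightarrow> cell m c \<subseteq> torus"
  using torus_eq_UN_cells by blast

lemma cell_sets [measurable]: "cell m (c :: 'n::finite \<Rightarrow> int) \<in> sets borel"
proof -
  have "cell m c = {x \<in> space borel. \<forall>i\<in>UNIV. \<lfloor>real m * x $ i\<rfloor> = c i}" by (auto simp: cell_def)
  also have "\<dots> \<in> sets borel" by measurable
  finally show ?thesis .
qed

lemma torus_sets [measurable]: "(torus :: (real ^ 'n::finite) set) \<in> sets borel"
  unfolding torus_eq_cell by (rule cell_sets)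

lemma emeasure_cell:
  assumes m: "0 < m"
  shows "emeasure lborel (cell m (c :: 'n::finite \<Rightarrow> int)) = ennreal ((1 / m) ^ CARD('n))"
proof -
  define a b :: "real ^ 'n" where "a = (\<chi> i. c i / m)" and "b = (\<chi> i. (c i + 1) / m)"
  have ba: "(b - a) \<bullet> e = 1 / m" if "e \<in> Basis" for e
    using that by (auto simp: a_def b_def Basis_vec_def inner_axis add_divide_distrib)
  have le: "a \<bullet> e \<le> b \<bullet> e" if "e \<in> Basis" for e
    using ba[OF that] m by (simp add: inner_diff_left) (smt (verit) divide_nonneg_nonneg of_nat_0_le_iff)
  have pr: "(\<Prod>e\<in>Basis. (b - a) \<bullet> e) = (1 / m) ^ CARD('n)"
    using ba by simp
  have x: "x \<in> cell m c \<longleftrightarrow> (\<forall>i. a $ i \<le> x $ i \<and> x $ i < b $ i)" for x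
    using m by (simp add: cell_def floor_eq_iff a_def b_def field_simps)
  have "box a b \<subseteq> cell m c" "cell m c \<subseteq> cbox a b"
    by (auto simp: x mem_box_cart less_imp_le)
  then have "emeasure lborel (box a b) \<le> emeasure lborel (cell m c)"
      "emeasure lborel (cell m c) \<le> emeasure lborel (cbox a b)"
    by (auto intro!: emeasure_mono)
  then show ?thesis using le by (simp add: pr emeasure_lborel_box emeasure_lborel_cbox)
qed

section \<open>Uniform distributions on the torus and on its cells\<close>

definition torus_unif :: "(real ^ 'n) measure" where
  "torus_unif = uniform_measure lborel torus"

definition cell_unif :: "nat \<Rightarrow> ('n \<Rightarrow> int) \<Rightarrow> (real ^ 'n) measure" where
  "cell_unif m c = uniform_measure lborel (cell m c)"

lemma sets_unif [simp, measurable_cong]: "sets torus_unif = sets borel" "sets (cell_unif m c) = sets borel"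
  by (simp_all add: torus_unif_def cell_unif_def)

lemma prob_space_cell_unif:
  assumes "0 < m"
  shows "prob_space (cell_unif m (c :: 'n::finite \<Rightarrow> int))"
  unfolding cell_unif_def
  by (rule prob_space_uniform_measure) (use emeasure_cell[OF assms, of c] assms in auto)

lemma prob_space_torus_unif: "prob_space (torus_unif :: (real ^ 'n::finite) measure)"
  using prob_space_cell_unif[of 1 "\<lambda>_. 0"] by (simp add: torus_unif_def cell_unif_def torus_eq_cell)

text \<open>The cells partition the torus and have equal volume, the reciprocal of their
  number.\<close>

lemma torus_unif_mixture:
  assumes m: "0 < m" and A: "A \<in> sets (torus_unif :: (real ^ 'n::finite) measure)"
  shows "emeasure torus_unif A = (\<Sum>c\<in>cells m. emeasure (cell_unif m c) A) / card (cells m :: ('n \<Rightarrow> int) set)"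
proof -
  have A': "A \<in> sets borel" using A by simp
  have disj: "disjoint_family_on (\<lambda>c. cell m c \<inter> A) (cells m)"
    by (auto simp: disjoint_family_on_def cell_def)
  have "emeasure torus_unif A = emeasure lborel (torus \<inter> A)"
    unfolding torus_unif_def using A' emeasure_cell[of 1 "\<lambda>_::'n. 0"]
    by (subst emeasure_uniform_measure) (auto simp: torus_eq_cell divide_ennreal_def)
  also have "torus \<inter> A = (\<Union>c\<in>cells m. cell m c \<inter> A)" unfolding torus_eq_UN_cells[OF m] by auto
  also have "emeasure lborel \<dots> = (\<Sum>c\<in>cells m. emeasure lborel (cell m c \<inter> A))"
    by (rule sum_emeasure[symmetric]) (use A' finite_cells disj in auto)
  also have "\<dots> = (\<Sum>c\<in>cells m. emeasure (cell_unif m c) A / card (cells m :: ('n \<Rightarrow> int) set))"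
  proof (rule sum.cong[OF refl])
    fix c :: "'n \<Rightarrow> int"
    define d where "d = real (m ^ CARD('n))"
    have d: "0 < d" using m by (simp add: d_def)
    have e: "emeasure lborel (cell m c) = ennreal (1 / d)"
      using emeasure_cell[OF m, of c] by (simp add: d_def power_one_over)
    have "emeasure (cell_unif m c) A = emeasure lborel (cell m c \<inter> A) / ennreal (1 / d)"
      unfolding cell_unif_def using A' by (subst emeasure_uniform_measure) (auto simp: e)
    moreover have "of_nat (card (cells m :: ('n \<Rightarrow> int) set)) = ennreal d"
      by (simp only: card_cells d_def ennreal_of_nat_eq_real_of_nat)
    moreover have "x / ennreal (1 / d) / ennreal d = x" for x
      using d by (simp add: divide_ennreal_def inverse_ennreal mult.assoc flip: ennreal_mult')
    ultimately show "emeasure lborel (cell m c \<inter> A) = emeasure (cell_unif m c) A / card (cells m :: ('n \<Rightarrow> int) set)"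
      by simp
  qed
  also have "\<dots> = (\<Sum>c\<in>cells m. emeasure (cell_unif m c) A) / card (cells m :: ('n \<Rightarrow> int) set)"
    by (simp add: divide_ennreal_def sum_distrib_right)
  finally show ?thesis .
qed

text \<open>
  A point drawn from \<open>cell_unif m c\<close> lies in the cell only almost surely; \<open>into_cell\<close> makes this sure
  without changing the distribution.
\<close>

definition into_cell :: "nat \<Rightarrow> ('n \<Rightarrow> int) \<Rightarrow> real ^ 'n \<Rightarrow> real ^ 'n" where
  "into_cell m c x = (if x \<in> cell m c then x else (\<chi> i. c i / m))"

lemma into_cell_mem: "0 < m \<Longrightarrow> into_cell m c x \<in> cell m c"
  by (auto simp: into_cell_def cell_def)

lemma into_cell_measurable [measurable]: "into_cell m (c :: 'n::finite \<Rightarrow> int) \<in> borel_measurable borel"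
  unfolding into_cell_def by measurable

lemma distr_into_cell: "distr (cell_unif m c) torus_unif (into_cell m (c :: 'n::finite \<Rightarrow> int)) = cell_unif m c"
proof -
  have "distr (cell_unif m c) torus_unif (into_cell m c) = distr (cell_unif m c) (cell_unif m c) (\<lambda>x. x)"
  proof (rule distr_cong_AE)
    show "AE x in cell_unif m c. into_cell m c x = x"
      unfolding cell_unif_def by (rule AE_uniform_measureI) (auto simp: into_cell_def)
  qed auto
  then show ?thesis by simp
qed

section \<open>Cubes on the torus and cells\<close>

text \<open>The integer \<open>k\<close>, chosen per coordinate, undoes the wrapping; it is the
  floor of the lifted coordinate. The image under \<open>to_torus\<close> thereby becomes a
  condition with countable quantifiers, from which joint measurability in \<open>x\<close> and
  \<open>y\<close> follows.\<close>

lemma mem_torus_cube_iff: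
  fixes x y :: "real ^ 'n::finite"
  shows "y \<in> torus_cube r x \<longleftrightarrow> y \<in> torus \<and> (\<forall>i. \<exists>k::int. \<bar>y $ i + of_int k - x $ i\<bar> \<le> r / 2)"
proof
  assume "y \<in> torus_cube r x"
  then obtain w where w: "w \<in> cbox (\<chi> i. x $ i - r / 2) (\<chi> i. x $ i + r / 2)" "y = to_torus w"
    by (auto simp: torus_cube_def)
  have "\<bar>y $ i + of_int \<lfloor>w $ i\<rfloor> - x $ i\<bar> \<le> r / 2" for i
  proof -
    have "x $ i - r / 2 \<le> w $ i" "w $ i \<le> x $ i + r / 2" using w(1) by (auto simp: mem_box_cart)
    moreover have "y $ i = w $ i - of_int \<lfloor>w $ i\<rfloor>" using w(2) by (simp add: to_torus_def frac_def)
    ultimately show ?thesis by linarith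
  qed
  moreover have "y \<in> torus" using w by (auto simp: to_torus_def torus_def frac_lt_1)
  ultimately show "y \<in> torus \<and> (\<forall>i. \<exists>k::int. \<bar>y $ i + of_int k - x $ i\<bar> \<le> r / 2)" by blast
next
  assume y: "y \<in> torus \<and> (\<forall>i. \<exists>k::int. \<bar>y $ i + of_int k - x $ i\<bar> \<le> r / 2)"
  then obtain k where k: "\<And>i. \<bar>y $ i + of_int (k i) - x $ i\<bar> \<le> r / 2" by metis
  define w where "w = (\<chi> i. y $ i + of_int (k i))"
  have "w \<in> cbox (\<chi> i. x $ i - r / 2) (\<chi> i. x $ i + r / 2)"
    unfolding mem_box_cart
  proof
    fix i
    show "(\<chi> i. x $ i - r / 2) $ i \<le> w $ i \<and> w $ i \<le> (\<chi> i. x $ i + r / 2) $ i"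
      using k[of i] unfolding w_def vec_lambda_beta by linarith
  qed
  moreover have "y = to_torus w"
  proof -
    have "frac (y $ i + of_int (k i)) = y $ i" for i
    proof -
      have "frac (y $ i + of_int (k i)) = frac (y $ i)" by (simp add: frac_def)
      then show ?thesis using y by (simp add: torus_def frac_eq)
    qed
    then show ?thesis by (simp add: to_torus_def w_def vec_eq_iff)
  qed
  ultimately show "y \<in> torus_cube r x" by (auto simp: torus_cube_def)
qed

lemma torus_cube_measurable [measurable]:
  assumes [measurable]: "f \<in> borel_measurable M" "g \<in> borel_measurable M"
  shows "Measurable.pred M (\<lambda>z. (g z :: real ^ 'n::finite) \<in> torus_cube r (f z))"
proof -
  have [measurable]: "(\<lambda>z. f z $ i) \<in> borel_measurable M" "(\<lambda>z. g z $ i) \<in> borel_measurable M" for i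
    by (rule measurable_compose[OF _ borel_measurable_continuous_onI], measurable, intro continuous_intros)+
  have "(\<lambda>z. g z \<in> torus_cube r (f z)) = (\<lambda>z. g z \<in> torus \<and> (\<forall>i\<in>UNIV. \<exists>k::int. \<bar>g z $ i + of_int k - f z $ i\<bar> \<le> r / 2))"
    by (simp add: mem_torus_cube_iff)
  also have "Measurable.pred M \<dots>" by measurable
  finally show ?thesis .
qed

text \<open>Points of one cell differ by at most \<open>1 / m \<le> r / 2\<close> in each
  coordinate, without wrapping.\<close>

lemma cell_mem_torus_cube:
  fixes r :: real
  assumes m: "0 < m" "2 \<le> r * m" and c: "c \<in> cells m" and x: "x \<in> cell m c" and y: "y \<in> cell m c"
  shows "y \<in> torus_cube r x"
  unfolding mem_torus_cube_iff
proof (intro conjI allI exI[of _ 0])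
  show "y \<in> torus" using cell_sub_torus[OF m(1) c] y by auto
  fix i
  have "\<lfloor>m * x $ i\<rfloor> = \<lfloor>m * y $ i\<rfloor>" using x y by (simp add: cell_def)
  then have "\<bar>m * y $ i - m * x $ i\<bar> \<le> 1" by linarith
  also have "\<bar>m * y $ i - m * x $ i\<bar> = m * \<bar>y $ i - x $ i\<bar>" by (simp add: abs_mult flip: right_diff_distrib)
  also have "1 \<le> m * (r / 2)" using m by (simp add: mult.commute)
  finally have "m * \<bar>y $ i - x $ i\<bar> \<le> m * (r / 2)" .
  then show "\<bar>y $ i + of_int 0 - x $ i\<bar> \<le> r / 2" using m by simp
qed

text \<open>After scaling by \<open>m\<close> the lifted coordinates differ by at most 3/2, hence
  their floors by at most 2; the wrapping integer contributes a multiple of \<open>m\<close>, which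
  disappears modulo \<open>m\<close>.\<close>

lemma torus_cube_cell_nbs:
  fixes r :: real
  assumes m: "0 < m" "r * m \<le> 3" and c': "c' \<in> cells m"
    and x: "x \<in> cell m c" and y: "y \<in> cell m c'" and xy: "y \<in> torus_cube r x"
  shows "c' \<in> cell_nbs m c"
  unfolding cell_nbs_def
proof (intro CollectI conjI allI c')
  fix i
  obtain k :: int where k: "\<bar>y $ i + of_int k - x $ i\<bar> \<le> r / 2"
    using xy unfolding mem_torus_cube_iff by blast
  have "m * \<bar>y $ i + of_int k - x $ i\<bar> \<le> m * (r / 2)" using k by (intro mult_left_mono) auto
  also have "\<dots> \<le> 3 / 2" using m by (simp add: mult.commute)
  also have "m * \<bar>y $ i + of_int k - x $ i\<bar> = \<bar>m * y $ i + of_int (int m * k) - m * x $ i\<bar>"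
  proof -
    have "m * y $ i + of_int (int m * k) - m * x $ i = m * (y $ i + of_int k - x $ i)" by (simp add: algebra_simps)
    then show ?thesis by (simp only: abs_mult abs_of_nat)
  qed
  finally have d: "\<bar>m * y $ i + of_int (int m * k) - m * x $ i\<bar> \<le> 3 / 2" .
  have fx: "\<lfloor>m * x $ i\<rfloor> = c i" and fy: "\<lfloor>m * y $ i\<rfloor> = c' i" using x y by (auto simp: cell_def)
  define j where "j = c' i + int m * k - c i"
  have "j \<in> {-2..2}" unfolding j_def using d fx fy by (simp, linarith)
  moreover have "c' i = (c i + j) mod int m"
    using c' by (simp add: j_def cells_def)
  ultimately show "\<exists>k\<in>{-2..2}. c' i = (c i + k) mod int m" by blast
qed

text \<open>
  Two points of the same cell lie in each other's cube, so only a cell with exactly one point can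
  contain an isolated point.
\<close>

definition isolated_cell ::
  "nat \<Rightarrow> real \<Rightarrow> ('n \<Rightarrow> int) \<Rightarrow> (('n \<Rightarrow> int) \<Rightarrow> nat \<times> (nat \<Rightarrow> real ^ 'n)) \<Rightarrow> real" where
  "isolated_cell m r c \<omega> = of_bool (fst (\<omega> c) = 1 \<and>
     (\<forall>c'\<in>cell_nbs m c - {c}. \<forall>k<fst (\<omega> c').
        into_cell m c' (snd (\<omega> c') k) \<notin> torus_cube r (into_cell m c (snd (\<omega> c) 0))))"

section \<open>Isolated cells as a dependency field\<close>

text \<open>A configuration is a count together with an infinite sequence, whose initial segment of
  that length gives the points; in this way configurations of every size share one product
  space.\<close>

definition cell_process :: "nat \<Rightarrow> real \<Rightarrow> ('n \<Rightarrow> int) \<Rightarrow> (nat \<times> (nat \<Rightarrow> real ^ 'n)) measure" where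
  "cell_process m \<nu> c = measure_pmf (poisson_pmf \<nu>) \<Otimes>\<^sub>M PiM UNIV (\<lambda>_. cell_unif m c)"

text \<open>Group the points by cell. A cell with two or more points contributes nothing by
  \<open>cell_mem_torus_cube\<close>. For a cell with a single point,
  \<open>torus_cube_cell_nbs\<close> shows that only neighbouring cells can disturb it, and the
  bijections \<rho> translate between sample indices and positions in the sequences.\<close>

lemma isolated_count_eq_sum_cells:
  fixes z :: "('n::finite \<Rightarrow> int) \<Rightarrow> nat \<Rightarrow> real ^ 'n" and r :: real
  assumes m: "0 < m" "2 \<le> r * m" "r * m \<le> 3" and \<kappa>: "\<kappa> \<in> {1..n} \<rightarrow>\<^sub>E cells m"
    and \<rho>: "\<And>c. c \<in> cells m \<Longrightarrow> bij_betw \<rho> {i\<in>{1..n}. \<kappa> i = c} {..<card {i\<in>{1..n}. \<kappa> i = c}}"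
  shows "isolated_count r n (\<lambda>i\<in>{1..n}. into_cell m (\<kappa> i) (z (\<kappa> i) (\<rho> i))) torus =
    (\<Sum>c\<in>cells m. isolated_cell m r c (\<lambda>c\<in>cells m. (card {i\<in>{1..n}. \<kappa> i = c}, z c)))"
proof -
  define I where "I c = {i\<in>{1..n}. \<kappa> i = c}" for c
  define x where "x = (\<lambda>i\<in>{1..n}. into_cell m (\<kappa> i) (z (\<kappa> i) (\<rho> i)))"
  define \<omega> where "\<omega> = (\<lambda>c\<in>cells m. (card (I c), z c))"
  have \<kappa>c: "\<kappa> i \<in> cells m" if "i \<in> {1..n}" for i using \<kappa> that by auto
  have xc: "x i \<in> cell m (\<kappa> i)" if "i \<in> {1..n}" for i
    using that into_cell_mem[OF m(1)] by (simp add: x_def)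
  have xt: "x i \<in> torus" if "i \<in> {1..n}" for i
    using xc[OF that] cell_sub_torus[OF m(1) \<kappa>c[OF that]] by auto
  define g :: "nat \<Rightarrow> real" where
    "g i = of_bool (x i \<in> torus) * of_bool (\<forall>j\<in>{1..n}. j \<noteq> i \<longrightarrow> x j \<notin> torus_cube r (x i))" for i
  have finI: "finite (I c)" for c by (auto simp: I_def)
  have "isolated_count r n x torus = (\<Sum>i\<in>{1..n}. g i)"
    by (simp add: isolated_count_def g_def)
  also have "\<dots> = (\<Sum>c\<in>cells m. \<Sum>i\<in>I c. g i)"
    unfolding I_def by (rule sum.group[symmetric]) (use \<kappa>c finite_cells in auto)
  also have "\<dots> = (\<Sum>c\<in>cells m. isolated_cell m r c \<omega>)"
  proof (rule sum.cong[OF refl])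
    fix c :: "'n \<Rightarrow> int" assume c: "c \<in> cells m"
    have fc: "fst (\<omega> c') = card (I c')" "snd (\<omega> c') = z c'" if "c' \<in> cells m" for c'
      using that by (auto simp: \<omega>_def)
    consider "card (I c) = 0" | "card (I c) = 1" | "2 \<le> card (I c)" by linarith
    then show "(\<Sum>i\<in>I c. g i) = isolated_cell m r c \<omega>"
    proof cases
      case 1
      then have "I c = {}" using finI by auto
      then show ?thesis using fc(1)[OF c] by (simp add: isolated_cell_def)
    next
      case 3
      have "g i = 0" if i: "i \<in> I c" for i
      proof -
        have "I c - {i} \<noteq> {}"
        proof
          assume "I c - {i} = {}"
          then have "I c = {i}" using i by auto
          then show False using 3 by simp
        qed
        then obtain j where j: "j \<in> I c" "j \<noteq> i" by auto
        have "x j \<in> torus_cube r (x i)"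
          using cell_mem_torus_cube[OF m(1,2) c] xc[of i] xc[of j] i j by (auto simp: I_def)
        then show ?thesis using j by (auto simp: g_def I_def)
      qed
      then show ?thesis using 3 fc(1)[OF c] by (simp add: isolated_cell_def)
    next
      case 2
      then obtain i where Ii: "I c = {i}" using card_1_singletonE by blast
      then have i: "i \<in> {1..n}" "\<kappa> i = c" by (auto simp: I_def)
      \<comment> \<open>Numbering within a cell starts at 0, which is the entry that
        \<open>isolated_cell\<close> reads.\<close>
      have "\<rho> i = 0" using \<rho>[OF c] Ii 2 unfolding I_def[symmetric] by (auto simp: bij_betw_def)
      then have xi: "x i = into_cell m c (z c 0)" using i by (simp add: x_def)
      have "(\<forall>j\<in>{1..n}. j \<noteq> i \<longrightarrow> x j \<notin> torus_cube r (x i)) \<longleftrightarrow>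
        (\<forall>c'\<in>cell_nbs m c - {c}. \<forall>k<fst (\<omega> c'). into_cell m c' (snd (\<omega> c') k) \<notin> torus_cube r (x i))"
      proof (intro iffI ballI allI impI)
        fix c' k assume all: "\<forall>j\<in>{1..n}. j \<noteq> i \<longrightarrow> x j \<notin> torus_cube r (x i)"
          and c': "c' \<in> cell_nbs m c - {c}" and k: "k < fst (\<omega> c')"
        have c'm: "c' \<in> cells m" using c' cell_nbs_sub by auto
        have "k \<in> \<rho> ` I c'" using \<rho>[OF c'm] k fc(1)[OF c'm] unfolding I_def[symmetric] by (auto simp: bij_betw_def)
        then obtain j where j: "j \<in> I c'" "k = \<rho> j" by auto
        then have "x j = into_cell m c' (snd (\<omega> c') k)" using fc(2)[OF c'm] by (auto simp: x_def I_def)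
        moreover have "j \<in> {1..n}" "j \<noteq> i" using j i c' by (auto simp: I_def)
        ultimately show "into_cell m c' (snd (\<omega> c') k) \<notin> torus_cube r (x i)" using all by metis
      next
        fix j assume all: "\<forall>c'\<in>cell_nbs m c - {c}. \<forall>k<fst (\<omega> c'). into_cell m c' (snd (\<omega> c') k) \<notin> torus_cube r (x i)"
          and j: "j \<in> {1..n}" "j \<noteq> i"
        show "x j \<notin> torus_cube r (x i)"
        proof
          assume xx: "x j \<in> torus_cube r (x i)"
          have "\<kappa> j \<in> cell_nbs m c"
            using torus_cube_cell_nbs[OF m(1,3) \<kappa>c[OF j(1)] _ xc[OF j(1)] xx] xc[OF i(1)] i(2) by simp
          moreover have "\<kappa> j \<noteq> c" using j Ii by (auto simp: I_def)
          moreover have "\<rho> j < fst (\<omega> (\<kappa> j))"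
            using \<rho>[OF \<kappa>c[OF j(1)]] fc(1)[OF \<kappa>c[OF j(1)]] j(1) unfolding bij_betw_def I_def by auto
          moreover have "x j = into_cell m (\<kappa> j) (snd (\<omega> (\<kappa> j)) (\<rho> j))"
            using j(1) fc(2)[OF \<kappa>c[OF j(1)]] by (simp add: x_def)
          ultimately show False using all xx by auto
        qed
      qed
      then have "g i = isolated_cell m r c \<omega>"
        using xt[OF i(1)] fc[OF c] 2 by (simp add: g_def isolated_cell_def xi)
      then show ?thesis using Ii by simp
    qed
  qed
  finally show ?thesis unfolding x_def \<omega>_def I_def .
qed

lemma cell_process_fst_measurable [measurable]: "fst \<in> measurable (cell_process m \<nu> c) (count_space UNIV)"
  unfolding cell_process_def by (rule measurable_compose[OF measurable_fst, where g = "\<lambda>x. x"]) simp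

lemma cell_process_snd_measurable: "(\<lambda>y. snd y k) \<in> borel_measurable (cell_process m \<nu> c)"
proof -
  have "(\<lambda>y. snd y k) \<in> measurable (cell_process m \<nu> c) (cell_unif m c)"
    unfolding cell_process_def by (rule measurable_compose[OF measurable_snd measurable_component_singleton]) simp
  then show ?thesis by (simp cong: measurable_cong_sets)
qed

lemma prob_space_cell_process:
  "0 < m \<Longrightarrow> prob_space (cell_process m \<nu> (c :: 'n::finite \<Rightarrow> int))"
  unfolding cell_process_def
  by (intro prob_space_pair measure_pmf.prob_space_axioms prob_space_PiM prob_space_cell_unif)

lemma measure_cell_process_count:
  assumes m: "0 < m"
  shows "measure (cell_process m \<nu> (c :: 'n::finite \<Rightarrow> int)) {y \<in> space (cell_process m \<nu> c). fst y = k} = pmf (poisson_pmf \<nu>) k"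
proof -
  interpret N: prob_space "PiM UNIV (\<lambda>_::nat. cell_unif m c)" by (intro prob_space_PiM prob_space_cell_unif m)
  have "{y \<in> space (cell_process m \<nu> c). fst y = k} = {k} \<times> space (PiM UNIV (\<lambda>_::nat. cell_unif m c))"
    by (auto simp: cell_process_def space_pair_measure)
  then have "emeasure (cell_process m \<nu> c) {y \<in> space (cell_process m \<nu> c). fst y = k} = ennreal (pmf (poisson_pmf \<nu>) k)"
    unfolding cell_process_def
    by (simp add: N.emeasure_pair_measure_Times N.emeasure_space_1 emeasure_pmf_single)
  then show ?thesis by (simp add: measure_def)
qed

lemma isolated_cell_measurable:
  assumes m: "0 < m" and c: "(c :: 'n::finite \<Rightarrow> int) \<in> cells m"
  shows "isolated_cell m r c \<in> borel_measurable (PiM (cells m) (cell_process m \<nu>))"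
proof -
  let ?P = "PiM (cells m) (cell_process m \<nu> :: ('n \<Rightarrow> int) \<Rightarrow> _)"
  have f [measurable]: "(\<lambda>\<omega>. fst (\<omega> c')) \<in> measurable ?P (count_space UNIV)" if "c' \<in> cells m" for c'
    by (rule measurable_compose[OF measurable_component_singleton[OF that] cell_process_fst_measurable])
  have s: "(\<lambda>\<omega>. into_cell m c' (snd (\<omega> c') k)) \<in> borel_measurable ?P" if "c' \<in> cells m" for c' k
    by (rule measurable_compose[OF measurable_compose[OF measurable_component_singleton[OF that] cell_process_snd_measurable] into_cell_measurable])
  have p: "Measurable.pred ?P (\<lambda>\<omega>. \<forall>k<fst (\<omega> c'). into_cell m c' (snd (\<omega> c') k) \<notin> torus_cube r (into_cell m c (snd (\<omega> c) 0)))"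
    if c': "c' \<in> cells m" for c'
  proof -
    have [measurable]: "Measurable.pred ?P (\<lambda>\<omega>. into_cell m c' (snd (\<omega> c') k) \<in> torus_cube r (into_cell m c (snd (\<omega> c) 0)))" for k
      by (rule torus_cube_measurable[OF s[OF c] s[OF c']])
    note f[OF c', measurable]
    show ?thesis by measurable
  qed
  have "Measurable.pred ?P (\<lambda>\<omega>. \<forall>c'\<in>cell_nbs m c - {c}. \<forall>k<fst (\<omega> c').
        into_cell m c' (snd (\<omega> c') k) \<notin> torus_cube r (into_cell m c (snd (\<omega> c) 0)))"
  proof (rule pred_intros_finite)
    show "finite (cell_nbs m c - {c})" using finite_subset[OF cell_nbs_sub finite_cells] by auto
  qed (use cell_nbs_sub[of m c] in \<open>auto intro!: p\<close>)
  moreover note f[OF c, measurable]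
  ultimately have "Measurable.pred ?P (\<lambda>\<omega>. fst (\<omega> c) = 1 \<and> (\<forall>c'\<in>cell_nbs m c - {c}. \<forall>k<fst (\<omega> c').
        into_cell m c' (snd (\<omega> c') k) \<notin> torus_cube r (into_cell m c (snd (\<omega> c) 0))))"
    by measurable
  then show ?thesis unfolding isolated_cell_def by measurable
qed

text \<open>\<open>p0\<close> and \<open>q\<close> are the Poisson probabilities of 0 and 1 points,
  the same for every cell. With empty neighbours the test in \<open>isolated_cell\<close> is
  vacuous, so exactly the cells with one point count, as \<open>surrounded\<close> demands.\<close>

lemma dependency_field_isolated_cell:
  assumes m: "0 < m" and \<nu>: "0 < \<nu>"
  shows "dependency_field (cells m) (cell_process m \<nu>) (cell_nbs m) (5 ^ CARD('n))
    (isolated_cell m r :: ('n::finite \<Rightarrow> int) \<Rightarrow> _) (\<lambda>y. fst y = 0) (\<lambda>y. fst y = 1) (exp (- \<nu>)) (\<nu> * exp (- \<nu>))"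
proof (rule dependency_field.intro)
  show "prob_space (cell_process m \<nu> c)" for c :: "'n \<Rightarrow> int" by (rule prob_space_cell_process[OF m])
  show "finite (cells m :: ('n \<Rightarrow> int) set)" by (rule finite_cells)
  show "c \<in> cell_nbs m c" "cell_nbs m c \<subseteq> cells m" "card (cell_nbs m c) \<le> 5 ^ CARD('n)"
    if "c \<in> cells m" for c :: "'n \<Rightarrow> int"
    using cell_nbs_refl[OF that] cell_nbs_sub card_cell_nbs by auto
  show "c \<in> cell_nbs m c'" if "c \<in> cells m" "c' \<in> cell_nbs m c" for c c' :: "'n \<Rightarrow> int"
    by (rule cell_nbs_sym[OF that])
  show "isolated_cell m r c \<in> borel_measurable (PiM (cells m) (cell_process m \<nu>))" if "c \<in> cells m" for c :: "'n \<Rightarrow> int"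
    by (rule isolated_cell_measurable[OF m that])
  show "0 \<le> isolated_cell m r c \<omega>" "isolated_cell m r c \<omega> \<le> 1" for c :: "'n \<Rightarrow> int" and \<omega>
    by (auto simp: isolated_cell_def)
  show "local_on (cell_nbs m c) (isolated_cell m r c)" if "c \<in> cells m" for c :: "'n \<Rightarrow> int"
    unfolding local_on_def
  proof (intro allI impI)
    fix \<omega> \<omega>' :: "('n \<Rightarrow> int) \<Rightarrow> nat \<times> (nat \<Rightarrow> real ^ 'n)" assume "\<forall>c'\<in>cell_nbs m c. \<omega> c' = \<omega>' c'"
    moreover from this have "\<omega> c = \<omega>' c" using cell_nbs_refl[OF that] by auto
    ultimately show "isolated_cell m r c \<omega> = isolated_cell m r c \<omega>'"
      unfolding isolated_cell_def by (auto intro!: arg_cong[where f = of_bool])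
  qed
  show "isolated_cell m r c \<omega> = 0" if "fst (\<omega> c) = 0" for c :: "'n \<Rightarrow> int" and \<omega>
    using that by (simp add: isolated_cell_def)
  show "isolated_cell m r c \<omega> = of_bool (fst (\<omega> c) = 1)"
    if "\<And>c'. c' \<in> cell_nbs m c - {c} \<Longrightarrow> fst (\<omega> c') = 0" for c :: "'n \<Rightarrow> int" and \<omega>
    using that by (simp add: isolated_cell_def)
  show "Measurable.pred (cell_process m \<nu> c) (\<lambda>y. fst y = 0)" "Measurable.pred (cell_process m \<nu> c) (\<lambda>y. fst y = 1)"
    for c :: "'n \<Rightarrow> int" by measurable
  show "(0::nat) < 5 ^ CARD('n)" "0 \<le> exp (- \<nu>)" by auto
  show "exp (- \<nu>) \<le> measure (cell_process m \<nu> c) {y \<in> space (cell_process m \<nu> c). fst y = 0}" for c :: "'n \<Rightarrow> int"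
    unfolding measure_cell_process_count[OF m] using \<nu> by simp
  show "measure (cell_process m \<nu> c) {y \<in> space (cell_process m \<nu> c). fst y = 1} = \<nu> * exp (- \<nu>)" for c :: "'n \<Rightarrow> int"
    unfolding measure_cell_process_count[OF m] using \<nu> by simp
qed

section \<open>The isolated points of the sample\<close>

lemma isolated_count_cong:
  "(\<And>i. i \<in> {1..n} \<Longrightarrow> x i = y i) \<Longrightarrow> isolated_count r n x B = isolated_count r n y B"
  unfolding isolated_count_def by (intro sum.cong refl) (auto simp del: One_nat_def)

lemma isolated_count_measurable:
  fixes Y :: "nat \<Rightarrow> 'a \<Rightarrow> real ^ 'n::finite"
  assumes Y: "\<And>i. i \<in> {1..n} \<Longrightarrow> Y i \<in> borel_measurable N"
  shows "(\<lambda>\<omega>. isolated_count r n (\<lambda>i. Y i \<omega>) torus) \<in> borel_measurable N"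
  unfolding isolated_count_def
proof (rule borel_measurable_sum)
  fix i assume i: "i \<in> {1..n}"
  have [measurable]: "Y i \<in> borel_measurable N" by (rule Y[OF i])
  have "Measurable.pred N (\<lambda>\<omega>. \<forall>j\<in>{1..n}. j \<noteq> i \<longrightarrow> Y j \<omega> \<notin> torus_cube r (Y i \<omega>))"
  proof (rule pred_intros_finite)
    fix j assume j: "j \<in> {1..n}"
    have [measurable]: "Measurable.pred N (\<lambda>\<omega>. Y j \<omega> \<in> torus_cube r (Y i \<omega>))"
      by (rule torus_cube_measurable[OF Y[OF i] Y[OF j]])
    show "Measurable.pred N (\<lambda>\<omega>. j \<noteq> i \<longrightarrow> Y j \<omega> \<notin> torus_cube r (Y i \<omega>))" by measurable
  qed simp
  then show "(\<lambda>\<omega>. of_bool (Y i \<omega> \<in> torus) * of_bool (\<forall>j\<in>{1..n}. j \<noteq> i \<longrightarrow> Y j \<omega> \<notin> torus_cube r (Y i \<omega>)) :: real)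
      \<in> borel_measurable N"
    by measurable
qed

text \<open>Split according to \<open>\<tau> = n\<close>: independence of \<tau> from the whole
  sequence factors each event, and the first \<open>n\<close> points have the product law. The sum
  over \<open>n\<close> becomes the Poisson integral on which \<open>poisson_thinning\<close>
  operates.\<close>

lemma sample_isolated_count:
  fixes X :: "nat \<Rightarrow> 'w \<Rightarrow> real ^ 'n::finite"
  assumes smp: "poisson_uniform_sample M l \<tau> X"
  shows "(\<lambda>\<omega>. isolated_count r (\<tau> \<omega>) (\<lambda>i. X i \<omega>) torus) \<in> borel_measurable M"
    and "A \<in> sets borel \<Longrightarrow>
      emeasure M {\<omega> \<in> space M. isolated_count r (\<tau> \<omega>) (\<lambda>i. X i \<omega>) torus \<in> A} =
      (\<integral>\<^sup>+n. emeasure (PiM {1..n} (\<lambda>_. torus_unif))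
        {x \<in> space (PiM {1..n} (\<lambda>_. torus_unif :: (real ^ 'n) measure)). isolated_count r n x torus \<in> A}
        \<partial>measure_pmf (poisson_pmf l))"
proof -
  have prob: "prob_space M" and \<tau> [measurable]: "\<tau> \<in> measurable M (count_space UNIV)"
    and \<tau>d: "distr M (count_space UNIV) \<tau> = measure_pmf (poisson_pmf l)"
    and X: "\<And>i. 1 \<le> i \<Longrightarrow> X i \<in> borel_measurable M"
    and Xd: "\<And>i. 1 \<le> i \<Longrightarrow> distr M borel (X i) = torus_unif"
    and indX: "prob_space.indep_vars M (\<lambda>_. borel) X {1..}"
    and ind: "prob_space.indep_set M (sets (vimage_algebra (space M) \<tau> (count_space UNIV)))
       (sets (vimage_algebra (space M) (\<lambda>\<omega>. \<lambda>i\<in>{1..}. X i \<omega>) (Pi\<^sub>M {1..} (\<lambda>_. borel))))"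
    using smp unfolding poisson_uniform_sample_def torus_unif_def by auto
  interpret prob_space M by (rule prob)
  define C where "C n \<omega> = isolated_count r n (\<lambda>i. X i \<omega>) torus" for n \<omega>
  have Cm [measurable]: "C n \<in> borel_measurable M" for n
    unfolding C_def by (rule isolated_count_measurable) (use X in auto)
  show "(\<lambda>\<omega>. isolated_count r (\<tau> \<omega>) (\<lambda>i. X i \<omega>) torus) \<in> borel_measurable M"
    unfolding C_def[symmetric] by (rule measurable_compose_countable'[OF Cm \<tau>]) simp_all
  assume A: "A \<in> sets borel"
  have law: "emeasure M {\<omega> \<in> space M. C n \<omega> \<in> A} =
      emeasure (PiM {1..n} (\<lambda>_. torus_unif))
        {x \<in> space (PiM {1..n} (\<lambda>_. torus_unif :: (real ^ 'n) measure)). isolated_count r n x torus \<in> A}" for n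
  proof -
    let ?U = "PiM {1..n} (\<lambda>_. torus_unif :: (real ^ 'n) measure)"
    have d: "distr M ?U (\<lambda>\<omega>. \<lambda>i\<in>{1..n}. X i \<omega>) = ?U"
    \<comment> \<open>For \<open>n = 0\<close> the product space is a single point, so both measures
      are the unit mass on it.\<close>
    proof (cases "n = 0")
      case True
      interpret U: prob_space ?U by (intro prob_space_PiM prob_space_torus_unif)
      show ?thesis
      proof (rule measure_eqI)
        fix B assume "B \<in> sets (distr M ?U (\<lambda>\<omega>. \<lambda>i\<in>{1..n}. X i \<omega>))"
        then have B: "B \<in> sets ?U" by simp
        then have B': "B = {} \<or> B = space ?U"
          using True sets.sets_into_space[OF B] by (auto simp: space_PiM subset_singleton_iff)
        have m: "(\<lambda>\<omega>. \<lambda>i\<in>{1..n}. X i \<omega>) \<in> measurable M ?U"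
          using True by (intro measurable_restrict) auto
        interpret D: prob_space "distr M ?U (\<lambda>\<omega>. \<lambda>i\<in>{1..n}. X i \<omega>)" by (rule prob_space_distr[OF m])
        show "emeasure (distr M ?U (\<lambda>\<omega>. \<lambda>i\<in>{1..n}. X i \<omega>)) B = emeasure ?U B"
          using B' D.emeasure_space_1 U.emeasure_space_1 by auto
      qed simp
    next
      case False
      have "indep_vars (\<lambda>_. borel) X {1..n}" by (rule indep_vars_subset[OF indX]) auto
      then have "distr M (PiM {1..n} (\<lambda>_. borel)) (\<lambda>\<omega>. \<lambda>i\<in>{1..n}. X i \<omega>) = PiM {1..n} (\<lambda>i. distr M borel (X i))"
        by (subst (asm) indep_vars_iff_distr_eq_PiM') (use False X in auto)
      also have "PiM {1..n} (\<lambda>i. distr M borel (X i)) = ?U"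
        by (rule PiM_cong) (use Xd in auto)
      finally have e: "distr M (PiM {1..n} (\<lambda>_. borel)) (\<lambda>\<omega>. \<lambda>i\<in>{1..n}. X i \<omega>) = ?U" .
      have "distr M ?U (\<lambda>\<omega>. \<lambda>i\<in>{1..n}. X i \<omega>) = distr M (PiM {1..n} (\<lambda>_. borel)) (\<lambda>\<omega>. \<lambda>i\<in>{1..n}. X i \<omega>)"
        by (rule distr_cong) (auto intro!: sets_PiM_cong)
      then show ?thesis using e by simp
    qed
    have m: "(\<lambda>\<omega>. \<lambda>i\<in>{1..n}. X i \<omega>) \<in> measurable M ?U"
    proof (rule measurable_restrict)
      fix i assume "i \<in> {1..n}"
      then have "X i \<in> borel_measurable M" using X by auto
      then show "X i \<in> measurable M torus_unif" by (simp cong: measurable_cong_sets)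
    qed
    let ?E = "{x \<in> space ?U. isolated_count r n x torus \<in> A}"
    have "(\<lambda>x. isolated_count r n (\<lambda>i. x i) torus) \<in> borel_measurable ?U"
    proof (rule isolated_count_measurable)
      fix i assume "i \<in> {1..n}"
      then have "(\<lambda>x. x i) \<in> measurable ?U torus_unif" by simp
      then show "(\<lambda>x. x i) \<in> borel_measurable ?U" by (simp cong: measurable_cong_sets)
    qed
    then have E: "?E \<in> sets ?U" using A by measurable
    have "emeasure ?U ?E = emeasure (distr M ?U (\<lambda>\<omega>. \<lambda>i\<in>{1..n}. X i \<omega>)) ?E" by (simp only: d)
    also have "\<dots> = emeasure M ((\<lambda>\<omega>. \<lambda>i\<in>{1..n}. X i \<omega>) -` ?E \<inter> space M)" by (rule emeasure_distr[OF m E])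
    also have "(\<lambda>\<omega>. \<lambda>i\<in>{1..n}. X i \<omega>) -` ?E \<inter> space M = {\<omega> \<in> space M. C n \<omega> \<in> A}"
    proof -
      have "isolated_count r n (\<lambda>i\<in>{1..n}. X i \<omega>) torus = C n \<omega>" for \<omega>
        unfolding C_def by (rule isolated_count_cong) simp
      then show ?thesis using measurable_space[OF m] by auto
    qed
    finally show ?thesis by (rule sym)
  qed
  have split: "emeasure M {\<omega> \<in> space M. \<tau> \<omega> = n \<and> C n \<omega> \<in> A} =
      ennreal (pmf (poisson_pmf l) n) * emeasure M {\<omega> \<in> space M. C n \<omega> \<in> A}" for n
  proof -
    let ?T = "{\<omega> \<in> space M. \<tau> \<omega> = n}" and ?B = "{\<omega> \<in> space M. C n \<omega> \<in> A}"
    have T: "?T \<in> sets (vimage_algebra (space M) \<tau> (count_space UNIV))"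
    proof -
      have "?T = \<tau> -` {n} \<inter> space M" by auto
      then show ?thesis using in_vimage_algebra[of "{n}" "count_space UNIV" \<tau> "space M"] by simp
    qed
    have B: "?B \<in> sets (vimage_algebra (space M) (\<lambda>\<omega>. \<lambda>i\<in>{1..}. X i \<omega>) (Pi\<^sub>M {1..} (\<lambda>_. borel)))"
    proof -
      let ?N = "Pi\<^sub>M {1..} (\<lambda>_::nat. borel :: (real ^ 'n) measure)"
      have "(\<lambda>x. isolated_count r n (\<lambda>i. x i) torus) \<in> borel_measurable ?N"
        by (rule isolated_count_measurable) auto
      then have E: "{x \<in> space ?N. isolated_count r n x torus \<in> A} \<in> sets ?N" using A by measurable
      have "isolated_count r n (\<lambda>i\<in>{1..}. X i \<omega>) torus = C n \<omega>" for \<omega>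
        unfolding C_def by (rule isolated_count_cong) simp
      then have "?B = (\<lambda>\<omega>. \<lambda>i\<in>{1..}. X i \<omega>) -` {x \<in> space ?N. isolated_count r n x torus \<in> A} \<inter> space M"
        by (auto simp: space_PiM)
      then show ?thesis using in_vimage_algebra[OF E, of "\<lambda>\<omega>. \<lambda>i\<in>{1..}. X i \<omega>" "space M"] by simp
    qed
    have pT: "prob ?T = pmf (poisson_pmf l) n"
    proof -
      have "prob ?T = measure (distr M (count_space UNIV) \<tau>) {n}"
        by (subst measure_distr) (auto intro!: arg_cong[where f = prob])
      then show ?thesis by (simp add: \<tau>d measure_pmf_single)
    qed
    have "prob (?T \<inter> ?B) = prob ?T * prob ?B" by (rule indep_setD[OF ind T B])
    moreover have "?T \<inter> ?B = {\<omega> \<in> space M. \<tau> \<omega> = n \<and> C n \<omega> \<in> A}" by auto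
    ultimately show ?thesis by (simp add: emeasure_eq_measure pT ennreal_mult)
  qed
  have "emeasure M {\<omega> \<in> space M. C (\<tau> \<omega>) \<omega> \<in> A} = emeasure M (\<Union>n. {\<omega> \<in> space M. \<tau> \<omega> = n \<and> C n \<omega> \<in> A})"
    by (rule arg_cong[where f = "emeasure M"]) auto
  also have "\<dots> = (\<Sum>n. emeasure M {\<omega> \<in> space M. \<tau> \<omega> = n \<and> C n \<omega> \<in> A})"
    by (rule suminf_emeasure[symmetric]) (use A in \<open>auto simp: disjoint_family_on_def\<close>)
  also have "\<dots> = (\<Sum>n. ennreal (pmf (poisson_pmf l) n) * emeasure M {\<omega> \<in> space M. C n \<omega> \<in> A})"
    by (simp only: split)
  also have "\<dots> = (\<integral>\<^sup>+n. emeasure M {\<omega> \<in> space M. C n \<omega> \<in> A} \<partial>measure_pmf (poisson_pmf l))"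
    by (simp add: nn_integral_measure_pmf nn_integral_count_space_nat)
  also have "\<dots> = (\<integral>\<^sup>+n. emeasure (PiM {1..n} (\<lambda>_. torus_unif))
        {x \<in> space (PiM {1..n} (\<lambda>_. torus_unif :: (real ^ 'n) measure)). isolated_count r n x torus \<in> A}
        \<partial>measure_pmf (poisson_pmf l))"
    by (simp only: law)
  finally show "emeasure M {\<omega> \<in> space M. isolated_count r (\<tau> \<omega>) (\<lambda>i. X i \<omega>) torus \<in> A} =
      (\<integral>\<^sup>+n. emeasure (PiM {1..n} (\<lambda>_. torus_unif))
        {x \<in> space (PiM {1..n} (\<lambda>_. torus_unif :: (real ^ 'n) measure)). isolated_count r n x torus \<in> A}
        \<partial>measure_pmf (poisson_pmf l))"
    unfolding C_def .
qed

text \<open>Carries the law of the count from the arbitrary space \<open>M\<close> to the product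
  space of the cells, where the dependency field lives.\<close>

lemma distr_isolated_count:
  fixes X :: "nat \<Rightarrow> 'w \<Rightarrow> real ^ 'n::finite" and l r :: real and m :: nat
  assumes smp: "poisson_uniform_sample M l \<tau> X" and l: "0 < l" and m: "0 < m" "2 \<le> r * m" "r * m \<le> 3"
  defines "W \<equiv> PiM (cells m :: ('n \<Rightarrow> int) set) (cell_process m (l / real (card (cells m :: ('n \<Rightarrow> int) set))))"
  shows "distr M borel (\<lambda>\<omega>. isolated_count r (\<tau> \<omega>) (\<lambda>i. X i \<omega>) torus) =
    distr W borel (\<lambda>\<omega>. \<Sum>c\<in>cells m. isolated_cell m r c \<omega>)"
proof (rule measure_eqI)
  let ?F = "\<lambda>\<omega>. \<Sum>c\<in>(cells m :: ('n \<Rightarrow> int) set). isolated_cell m r c \<omega>"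
  let ?\<Phi> = "\<lambda>\<omega>. isolated_count r (\<tau> \<omega>) (\<lambda>i. X i \<omega>) torus"
  have Fm: "?F \<in> borel_measurable W"
    unfolding W_def by (rule borel_measurable_sum) (rule isolated_cell_measurable[OF m(1)])
  have W: "W = PiM (cells m) (\<lambda>c. measure_pmf (poisson_pmf (l / real (card (cells m :: ('n \<Rightarrow> int) set)))) \<Otimes>\<^sub>M PiM UNIV (\<lambda>_. cell_unif m c))"
    unfolding W_def cell_process_def ..
  fix A assume "A \<in> sets (distr M borel ?\<Phi>)"
  then have A: "A \<in> sets borel" by simp
  have "emeasure (distr M borel ?\<Phi>) A = emeasure M {\<omega> \<in> space M. ?\<Phi> \<omega> \<in> A}"
    by (subst emeasure_distr[OF sample_isolated_count(1)[OF smp] A]) (auto intro!: arg_cong[where f = "emeasure M"])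
  also have "\<dots> = (\<integral>\<^sup>+n. emeasure (PiM {1..n} (\<lambda>_. torus_unif))
        {x \<in> space (PiM {1..n} (\<lambda>_. torus_unif :: (real ^ 'n) measure)). isolated_count r n x torus \<in> A}
        \<partial>measure_pmf (poisson_pmf l))"
    by (rule sample_isolated_count(2)[OF smp A])
  also have "\<dots> = emeasure W {\<omega> \<in> space W. ?F \<omega> \<in> A}"
    unfolding W
  proof (rule poisson_thinning[where pt = "into_cell m"])
    show "finite (cells m :: ('n \<Rightarrow> int) set)" "(cells m :: ('n \<Rightarrow> int) set) \<noteq> {}"
      using finite_cells cells_nonempty[OF m(1)] by auto
    show "prob_space (cell_unif m c)" for c :: "'n \<Rightarrow> int" by (rule prob_space_cell_unif[OF m(1)])
    show "prob_space (torus_unif :: (real ^ 'n) measure)" by (rule prob_space_torus_unif)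
    show "emeasure torus_unif B = (\<Sum>c\<in>cells m. emeasure (cell_unif m c) B) / of_nat (card (cells m :: ('n \<Rightarrow> int) set))"
      if "B \<in> sets torus_unif" for B :: "(real ^ 'n) set"
      by (rule torus_unif_mixture[OF m(1) that])
    show "into_cell m c \<in> measurable torus_unif torus_unif" for c :: "'n \<Rightarrow> int"
      using into_cell_measurable by (simp cong: measurable_cong_sets)
    show "distr (cell_unif m c) torus_unif (into_cell m c) = cell_unif m c" for c :: "'n \<Rightarrow> int"
      by (rule distr_into_cell)
    show "(\<lambda>x. isolated_count r n x torus) \<in> borel_measurable (PiM {1..n} (\<lambda>_. torus_unif :: (real ^ 'n) measure))" for n
    proof (rule isolated_count_measurable[where Y = "\<lambda>i x. x i"])
      fix i assume "i \<in> {1..n}"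
      then have "(\<lambda>x. x i) \<in> measurable (PiM {1..n} (\<lambda>_. torus_unif :: (real ^ 'n) measure)) torus_unif" by simp
      then show "(\<lambda>x. x i) \<in> borel_measurable (PiM {1..n} (\<lambda>_. torus_unif :: (real ^ 'n) measure))"
        by (simp cong: measurable_cong_sets)
    qed
    show "?F \<in> borel_measurable (PiM (cells m) (\<lambda>c. measure_pmf (poisson_pmf (l / real (card (cells m :: ('n \<Rightarrow> int) set)))) \<Otimes>\<^sub>M PiM UNIV (\<lambda>_. cell_unif m c)))"
      using Fm unfolding W .
    show "isolated_count r n (\<lambda>i\<in>{1..n}. into_cell m (\<kappa> i) (z (\<kappa> i) (\<rho> i))) torus =
        ?F (\<lambda>c\<in>cells m. (card {i\<in>{1..n}. \<kappa> i = c}, z c))"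
      if "\<kappa> \<in> {1..n} \<rightarrow>\<^sub>E (cells m :: ('n \<Rightarrow> int) set)"
        "\<And>c. c \<in> cells m \<Longrightarrow> bij_betw \<rho> {i\<in>{1..n}. \<kappa> i = c} {..<card {i\<in>{1..n}. \<kappa> i = c}}" for n \<kappa> \<rho> z
      by (rule isolated_count_eq_sum_cells[OF m that])
  qed (use l A in simp_all)
  also have "\<dots> = emeasure (distr W borel ?F) A"
    by (subst emeasure_distr[OF Fm A]) (auto intro!: arg_cong[where f = "emeasure W"])
  finally show "emeasure (distr M borel ?\<Phi>) A = emeasure (distr W borel ?F) A" .
qed simp

lemma d_TV_le_1: "prob_space P \<Longrightarrow> prob_space Q \<Longrightarrow> d_TV P Q \<le> 1"
  unfolding d_TV_def
proof (rule cSUP_least)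
  fix A assume "prob_space P" "prob_space Q"
  then show "\<bar>measure P A - measure Q A\<bar> \<le> 1"
    using prob_space.prob_le_1[of P A] prob_space.prob_le_1[of Q A] measure_nonneg[of P A] measure_nonneg[of Q A]
    by linarith
qed auto

lemma d_loc_le_1: "prob_space P \<Longrightarrow> prob_space Q \<Longrightarrow> d_loc P Q \<le> 1"
  unfolding d_loc_def
proof (rule cSUP_least)
  fix x assume "prob_space P" "prob_space Q"
  then show "\<bar>measure P {x..<x + 1} - measure Q {x..<x + 1}\<bar> \<le> 1"
    using prob_space.prob_le_1[of P] prob_space.prob_le_1[of Q] measure_nonneg[of P] measure_nonneg[of Q]
    by (smt (verit))
qed auto

text \<open>The main regime. \<open>k\<close> and \<open>A\<close> bound the decay rate and the
  Stein constant of the field by quantities in \<open>a\<close> and the dimension alone. The number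
  \<open>v\<close> of cells is at least \<open>l / a\<close>, which turns \<open>1 / sqrt v\<close>
  and \<open>1 / v\<close> into powers of \<open>l\<close>.\<close>

lemma isolated_points_approximation:
  fixes X :: "nat \<Rightarrow> 'w \<Rightarrow> real ^ 'n::finite" and a l r :: real
  defines "K \<equiv> 5 ^ CARD('n) :: nat"
  defines "k \<equiv> exp (- a) ^ K * (a / 3 ^ CARD('n) * exp (- a) * exp (- a)) / 12 / K\<^sup>2"
  defines "A \<equiv> 3 * real K ^ 6 * exp (pi\<^sup>2 * (2 * real K ^ 6))"
  defines "B \<equiv> (A + 5 * real K ^ 2 + 1) * (1 + real K ^ 2) * (2 * (1 + 3 / (k / 10)) ^ 3)"
  assumes a: "0 < a" and l: "0 < l" and r: "0 < r" "r \<le> 1" and lra: "l * r ^ CARD('n) = a"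
    and smp: "poisson_uniform_sample M l \<tau> X"
  defines "\<Phi> \<equiv> \<lambda>\<omega>. isolated_count r (\<tau> \<omega>) (\<lambda>i. X i \<omega>) torus"
  defines "\<mu> \<equiv> prob_space.expectation M \<Phi>"
  defines "\<sigma>2 \<equiv> prob_space.variance M (\<lambda>\<omega>. \<Phi> \<omega> - \<mu>)"
  defines "\<delta> \<equiv> frac (- 4 * \<sigma>2)"
  defines "t \<equiv> frac (- \<mu> + 2 * \<sigma>2 + \<delta> / 2) / (4 * \<sigma>2 + \<delta>)"
  defines "P \<equiv> distr M borel (\<lambda>\<omega>. \<Phi> \<omega> - \<mu>)"
  defines "Q \<equiv> centred_binomial (nat \<lceil>4 * \<sigma>2\<rceil>) (1 / 2 - t)"
  assumes \<sigma>2: "1 < \<sigma>2"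
  shows "d_TV P Q \<le> 3 * B * sqrt a * l powr (- 1 / 2)" and "d_loc P Q \<le> B * a * l powr (- 2 / 2)"
proof -
  let ?d = "CARD('n)"
  let ?V = "cells :: nat \<Rightarrow> ('n \<Rightarrow> int) set"
  \<comment> \<open>Then \<open>2 \<le> r * m \<le> 2 + r\<close>, and \<open>r \<le> 1\<close>
    gives the upper bound 3.\<close>
  define m where "m = nat \<lceil>2 / r\<rceil>"
  have mr: "2 / r \<le> m" "m \<le> 2 / r + 1" using r by (auto simp: m_def)
  have m: "0 < m" "2 \<le> r * m" "r * m \<le> 3"
  proof -
    show "0 < m" using r by (simp add: m_def)
    show "2 \<le> r * m" using mr(1) r by (simp add: pos_divide_le_eq mult.commute)
    have "r * m \<le> r * (2 / r + 1)" using mr(2) r by (intro mult_left_mono) auto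
    then show "r * m \<le> 3" using r by (simp add: ring_distribs)
  qed
  define v where "v = real (card (?V m))"
  have v: "v = real m ^ ?d" by (simp add: v_def card_cells)
  have rv: "r ^ ?d * v = (r * m) ^ ?d" by (simp add: v power_mult_distrib)
  have rd: "0 < r ^ ?d" using r by simp
  have lv: "a * v = l * (r * m) ^ ?d" unfolding rv[symmetric] lra[symmetric] by simp
  have v1: "1 \<le> v" using m(1) by (simp add: v)
  have lo: "l \<le> a * v" unfolding lv using l m one_le_power[of "r * m" ?d] by (simp add: mult_le_cancel_left1)
  have hi: "a * v \<le> l * 3 ^ ?d" unfolding lv using l m r by (intro mult_left_mono power_mono) auto
  \<comment> \<open>The mean number of points per cell equals \<open>a / (r * m) ^ CARD('n)\<close>,
    so \<open>2 \<le> r * m \<le> 3\<close> confines it to an interval that depends only on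
    \<open>a\<close> and the dimension.\<close>
  define \<nu> where "\<nu> = l / v"
  have \<nu>: "0 < \<nu>" "a / 3 ^ ?d \<le> \<nu>" "\<nu> \<le> a"
    using l v1 lo hi by (auto simp: \<nu>_def field_simps)
  interpret dependency_field "?V m" "cell_process m \<nu>" "cell_nbs m" K
    "isolated_cell m r" "\<lambda>y. fst y = 0" "\<lambda>y. fst y = 1" "exp (- \<nu>)" "\<nu> * exp (- \<nu>)"
    unfolding K_def by (rule dependency_field_isolated_cell[OF m(1) \<nu>(1)])
  let ?W = "PiM (?V m) (cell_process m \<nu>)"
  define F where "F \<omega> = (\<Sum>c\<in>?V m. isolated_cell m r c \<omega>)" for \<omega>
  have ne: "?V m \<noteq> {}" by (rule cells_nonempty[OF m(1)])
  interpret SM: prob_space M using smp by (simp add: poisson_uniform_sample_def)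
  have \<Phi>m [measurable]: "\<Phi> \<in> borel_measurable M" unfolding \<Phi>_def by (rule sample_isolated_count(1)[OF smp])
  have Fm [measurable]: "F \<in> borel_measurable ?W" unfolding F_def by (rule borel_measurable_sum) (rule meas)
  have law: "distr M borel \<Phi> = distr ?W borel F"
    unfolding \<Phi>_def F_def \<nu>_def v_def by (rule distr_isolated_count[OF smp l m])
  have tr: "(\<integral>\<omega>. f (\<Phi> \<omega>) \<partial>M) = (\<integral>\<omega>. f (F \<omega>) \<partial>?W)" if "f \<in> borel_measurable borel" for f :: "real \<Rightarrow> real"
  proof -
    have "(\<integral>\<omega>. f (\<Phi> \<omega>) \<partial>M) = (\<integral>x. f x \<partial>distr M borel \<Phi>)" by (rule integral_distr[symmetric]) (use that in auto)
    also have "\<dots> = (\<integral>\<omega>. f (F \<omega>) \<partial>?W)" unfolding law by (rule integral_distr) (use that in auto)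
    finally show ?thesis .
  qed
  have \<mu>F: "\<mu> = (\<integral>\<omega>. F \<omega> \<partial>?W)" unfolding \<mu>_def using tr[of "\<lambda>x. x"] by simp
  have \<eta>F: "\<eta>s (?V m) \<omega> = F \<omega> - \<mu>" for \<omega>
    unfolding \<mu>F F_def \<eta>_def sum_subtractf
    by (subst Bochner_Integration.integral_sum) (auto intro: integrable_\<xi>)
  note \<eta>m [measurable] = \<eta>s_measurable[OF order.refl]
  have PW: "P = distr ?W borel (\<eta>s (?V m))"
  proof -
    have "P = distr (distr M borel \<Phi>) borel (\<lambda>x. x - \<mu>)" unfolding P_def by (subst distr_distr) (auto simp: comp_def)
    also have "\<dots> = distr ?W borel (\<lambda>\<omega>. F \<omega> - \<mu>)" unfolding law by (subst distr_distr) (auto simp: comp_def)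
    finally show ?thesis by (simp only: \<eta>F)
  qed
  have b2: "(\<eta>s (?V m) \<omega>)\<^sup>2 \<le> real (card (?V m)) ^ 2" for \<omega>
    using power_mono[OF abs_\<eta>s_le[OF order.refl], of \<omega> 2] by simp
  have i2: "integrable ?W (\<lambda>\<omega>. (\<eta>s (?V m) \<omega>)\<^sup>2)"
    by (rule integrable_bounded[of _ "real (card (?V m)) ^ 2"]) (use b2 in simp_all)
  have i1: "integrable ?W (\<eta>s (?V m))"
    by (rule integrable_bounded[of _ "card (?V m)"]) (use abs_\<eta>s_le[OF order.refl] in simp_all)
  have s2: "\<sigma>2 = (\<integral>\<omega>. (\<eta>s (?V m) \<omega>)\<^sup>2 \<partial>?W)"
  proof -
    have "SM.expectation (\<lambda>\<omega>. \<Phi> \<omega> - \<mu>) = (\<integral>\<omega>. \<eta>s (?V m) \<omega> \<partial>?W)"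
      using tr[of "\<lambda>x. x - \<mu>"] by (simp add: \<eta>F)
    also have "\<dots> = 0"
    proof (subst Bochner_Integration.integral_sum)
      show "integrable ?W (\<eta> c)" if "c \<in> ?V m" for c
        by (rule integrable_bounded[of _ 1]) (use that abs_\<eta>_le in auto)
    qed (simp add: integral_\<eta>)
    finally show ?thesis
      unfolding \<sigma>2_def using tr[of "\<lambda>x. (x - \<mu>)\<^sup>2"] by (simp add: \<eta>F)
  qed
  have P: "real_distribution P"
    unfolding PW real_distribution_def real_distribution_axioms_def
    using P.prob_space_distr[OF \<eta>m] by auto
  have P2: "integrable P (\<lambda>x. x\<^sup>2)" unfolding PW using i2 by (subst integrable_distr_eq) auto
  have lat: "AE x in P. x + \<mu> \<in> \<int>"
    unfolding PW
  proof (subst AE_distr_iff)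
    have "F \<omega> \<in> \<int>" for \<omega> unfolding F_def by (rule Ints_sum) (simp add: isolated_cell_def)
    then show "AE \<omega> in ?W. \<eta>s (?V m) \<omega> + \<mu> \<in> \<int>" by (simp add: \<eta>F)
  qed (use sets_shifted_Ints in auto)
  have ch: "char P \<theta> = (\<integral>\<omega>. iexp (\<theta> * \<eta>s (?V m) \<omega>) \<partial>?W)"
    and dch: "dchar P \<theta> = (\<integral>\<omega>. \<eta>s (?V m) \<omega> * iexp (\<theta> * \<eta>s (?V m) \<omega>) \<partial>?W)" for \<theta>
    unfolding char_def dchar_def PW by (rule integral_distr; measurable)+
  have rate: "k \<le> rate" "rate \<le> 1"
    unfolding k_def by (rule rate_bounds[OF refl refl _ \<nu>(2,3)], use a in simp)+
  have k0: "0 < k" unfolding k_def K_def using a by simp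
  have A0: "0 \<le> A" by (simp add: A_def)
  have stein: "norm (dchar P \<theta> - \<i> * \<theta> * \<sigma>2 * char P \<theta>) \<le> A * v * \<theta>\<^sup>2 * exp (- k * v * \<theta>\<^sup>2)"
    if \<theta>: "\<bar>\<theta>\<bar> \<le> pi" for \<theta>
  proof -
    have "norm (dchar P \<theta> - \<i> * \<theta> * \<sigma>2 * char P \<theta>)
      \<le> v * (3 * real K ^ 6 * \<theta>\<^sup>2 * exp (rate * pi\<^sup>2 * (2 * real K ^ 6)) * exp (- rate * \<theta>\<^sup>2 * v))"
      using char_stein[OF \<theta>] unfolding ch dch s2 v_def by simp
    also have "\<dots> \<le> v * (3 * real K ^ 6 * \<theta>\<^sup>2 * exp (pi\<^sup>2 * (2 * real K ^ 6)) * exp (- k * v * \<theta>\<^sup>2))"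
    proof -
      have "rate * (pi\<^sup>2 * (2 * real K ^ 6)) \<le> 1 * (pi\<^sup>2 * (2 * real K ^ 6))"
        using rate by (intro mult_right_mono) auto
      then have e1: "exp (rate * pi\<^sup>2 * (2 * real K ^ 6)) \<le> exp (pi\<^sup>2 * (2 * real K ^ 6))" by (simp add: mult.assoc)
      have "k * (v * \<theta>\<^sup>2) \<le> rate * (v * \<theta>\<^sup>2)" using rate v1 by (intro mult_right_mono) auto
      then have e2: "exp (- rate * \<theta>\<^sup>2 * v) \<le> exp (- k * v * \<theta>\<^sup>2)" by (simp add: mult_ac)
      show ?thesis by (intro mult_left_mono mult_mono e1 e2) (use v1 in auto)
    qed
    also have "\<dots> = A * v * \<theta>\<^sup>2 * exp (- k * v * \<theta>\<^sup>2)" by (simp add: A_def)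
    finally show ?thesis .
  qed
  have lower: "2 * k * v \<le> \<sigma>2"
  proof -
    have "2 * k * v \<le> 2 * rate * v" using rate v1 by (intro mult_right_mono) auto
    also have "\<dots> \<le> \<sigma>2" unfolding s2 v_def by (rule variance_ge[OF ne])
    finally show ?thesis .
  qed
  have upper: "\<sigma>2 \<le> real K ^ 2 * v" unfolding s2 v_def by (rule variance_le)
  have B0: "0 \<le> B" unfolding B_def using A0 k0 by simp
  note approx = binomial_approximation[OF P P2 lat v1 A0 k0 stein lower upper \<sigma>2]
  have "d_TV P Q \<le> 3 * B / sqrt v" unfolding B_def Q_def t_def \<delta>_def by (rule approx(1))
  also have "\<dots> \<le> 3 * B * sqrt a * l powr (- 1 / 2)"
  proof -
    have "1 / sqrt v \<le> sqrt a / sqrt l"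
    proof -
      have "sqrt l \<le> sqrt a * sqrt v" unfolding real_sqrt_mult[symmetric] using lo by simp
      then show ?thesis using l v1 by (simp add: field_simps)
    qed
    also have "\<dots> = sqrt a * l powr (- 1 / 2)"
    proof -
      have "l powr (- (1 / 2)) = 1 / sqrt l" unfolding powr_minus_divide using l by (simp only: powr_half_sqrt less_imp_le)
      then show ?thesis by simp
    qed
    finally have "3 * B * (1 / sqrt v) \<le> 3 * B * (sqrt a * l powr (- 1 / 2))" using B0 by (intro mult_left_mono) auto
    then show ?thesis by (simp add: mult.assoc)
  qed
  finally show "d_TV P Q \<le> 3 * B * sqrt a * l powr (- 1 / 2)" .
  have "d_loc P Q \<le> B / (2 * v)" unfolding B_def Q_def t_def \<delta>_def by (rule approx(2))
  also have "\<dots> \<le> B * (1 / v)" using B0 v1 by (simp add: divide_left_mono)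
  also have "\<dots> \<le> B * (a * l powr (- 2 / 2))"
  proof -
    have "1 / v \<le> a / l" using lo l v1 by (simp add: field_simps)
    also have "\<dots> = a * l powr (- 2 / 2)"
    proof -
      have "l powr (- 1) = 1 / l" unfolding powr_minus_divide using l by (simp only: powr_one less_imp_le)
      then show ?thesis by simp
    qed
    finally show ?thesis using B0 by (intro mult_left_mono) auto
  qed
  finally show "d_loc P Q \<le> B * a * l powr (- 2 / 2)" by (simp add: mult.assoc)
qed

text \<open>For \<open>r > 1\<close> the constraint forces \<open>l \<le> a\<close>, so
  \<open>sqrt a * l powr (- 1 / 2)\<close> and \<open>a * l powr (- 2 / 2)\<close> are at least 1
  and dominate the trivial bound. The constants of the main regime are enlarged by
  \<open>sqrt a\<close> and \<open>a\<close> for this purpose.\<close>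

lemma isolated_points_bounds:
  fixes X :: "nat \<Rightarrow> 'w \<Rightarrow> real ^ 'n::finite" and a l r :: real
  defines "K \<equiv> 5 ^ CARD('n) :: nat"
  defines "k \<equiv> exp (- a) ^ K * (a / 3 ^ CARD('n) * exp (- a) * exp (- a)) / 12 / K\<^sup>2"
  defines "A \<equiv> 3 * real K ^ 6 * exp (pi\<^sup>2 * (2 * real K ^ 6))"
  defines "B \<equiv> (A + 5 * real K ^ 2 + 1) * (1 + real K ^ 2) * (2 * (1 + 3 / (k / 10)) ^ 3)"
  assumes a: "0 < a" and l: "0 < l" and r: "0 < r" and lra: "l * r ^ CARD('n) = a"
    and smp: "poisson_uniform_sample M l \<tau> X"
  defines "\<Phi> \<equiv> \<lambda>\<omega>. isolated_count r (\<tau> \<omega>) (\<lambda>i. X i \<omega>) torus"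
  defines "\<mu> \<equiv> prob_space.expectation M \<Phi>"
  defines "\<sigma>2 \<equiv> prob_space.variance M (\<lambda>\<omega>. \<Phi> \<omega> - \<mu>)"
  defines "\<delta> \<equiv> frac (- 4 * \<sigma>2)"
  defines "t \<equiv> frac (- \<mu> + 2 * \<sigma>2 + \<delta> / 2) / (4 * \<sigma>2 + \<delta>)"
  defines "P \<equiv> distr M borel (\<lambda>\<omega>. \<Phi> \<omega> - \<mu>)"
  defines "Q \<equiv> centred_binomial (nat \<lceil>4 * \<sigma>2\<rceil>) (1 / 2 - t)"
  assumes \<sigma>2: "1 < \<sigma>2"
  shows "d_TV P Q \<le> (3 * B * sqrt a + sqrt a) * l powr (- 1 / 2)" and "d_loc P Q \<le> (B * a + a) * l powr (- 2 / 2)"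
proof -
  have "0 < k" "0 \<le> A" using a by (simp_all add: k_def K_def A_def)
  then have B0: "0 \<le> B" by (simp add: B_def)
  have "d_TV P Q \<le> (3 * B * sqrt a + sqrt a) * l powr (- 1 / 2) \<and> d_loc P Q \<le> (B * a + a) * l powr (- 2 / 2)"
  proof (cases "r \<le> 1")
    case True
    have "d_TV P Q \<le> 3 * B * sqrt a * l powr (- 1 / 2)"
      unfolding B_def A_def k_def K_def Q_def P_def t_def \<delta>_def \<sigma>2_def \<mu>_def \<Phi>_def
        by (rule isolated_points_approximation(1)[OF a l r True lra smp \<sigma>2[unfolded \<sigma>2_def \<mu>_def \<Phi>_def]])
    moreover have "d_loc P Q \<le> B * a * l powr (- 2 / 2)"
      unfolding B_def A_def k_def K_def Q_def P_def t_def \<delta>_def \<sigma>2_def \<mu>_def \<Phi>_def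
        by (rule isolated_points_approximation(2)[OF a l r True lra smp \<sigma>2[unfolded \<sigma>2_def \<mu>_def \<Phi>_def]])
    moreover have "0 \<le> sqrt a * l powr (- 1 / 2)" "0 \<le> a * l powr (- 2 / 2)" using a by auto
    ultimately show ?thesis by (simp only: ring_distribs) linarith
  next
    case False
    have "l * 1 \<le> l * r ^ CARD('n)" using False l by (intro mult_left_mono one_le_power) auto
    then have la: "l \<le> a" using lra by simp
    have 1: "1 \<le> sqrt a * l powr (- 1 / 2)"
    proof -
      have "l powr (- (1 / 2)) = 1 / sqrt l" unfolding powr_minus_divide using l by (simp only: powr_half_sqrt less_imp_le)
      then show ?thesis using la l by simp
    qed
    have 2: "1 \<le> a * l powr (- 2 / 2)"
    proof -
      have "l powr (- 1) = 1 / l" unfolding powr_minus_divide using l by (simp only: powr_one less_imp_le)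
      then show ?thesis using la l by simp
    qed
    \<comment> \<open>The trivial bound needs \<open>Q\<close> to be a probability measure:
      \<open>\<sigma>2 > 1\<close> gives \<open>0 \<le> t \<le> 1/4\<close>, so
      \<open>1/2 - t\<close> is a valid success probability.\<close>
    have d: "0 \<le> \<delta>" unfolding \<delta>_def by (rule frac_ge_0)
    have "0 \<le> t" unfolding t_def using \<sigma>2 d frac_ge_0 by (intro divide_nonneg_nonneg) auto
    moreover have "t \<le> 1 / 4"
      unfolding t_def using \<sigma>2 d frac_lt_1[of "- \<mu> + 2 * \<sigma>2 + \<delta> / 2"] by (intro frac_le) auto
    ultimately have Q: "prob_space Q"
      using real_distribution_centred_binomial[of "1 / 2 - t"] by (simp add: Q_def real_distribution_def)
    have P: "prob_space P"
      unfolding P_def \<Phi>_def using smp sample_isolated_count(1)[OF smp, of r]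
      by (intro prob_space.prob_space_distr) (auto simp: poisson_uniform_sample_def)
    have "0 \<le> 3 * B * sqrt a * l powr (- 1 / 2)" "0 \<le> B * a * l powr (- 2 / 2)" using a B0 by auto
    then show ?thesis
      using d_TV_le_1[OF P Q] d_loc_le_1[OF P Q] 1 2 by (simp only: ring_distribs) linarith
  qed
  then show "d_TV P Q \<le> (3 * B * sqrt a + sqrt a) * l powr (- 1 / 2)" "d_loc P Q \<le> (B * a + a) * l powr (- 2 / 2)"
    by auto
qed

theorem theorem4p2:
  fixes a :: real
  assumes "a > 0"
  shows "\<exists>C1 C2 :: real.
    \<forall>(l :: real) (r :: real) (M :: 'w measure) (\<tau> :: 'w \<Rightarrow> nat)
      (X :: nat \<Rightarrow> 'w \<Rightarrow> real ^ 'n).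
      l > 0 \<longrightarrow> r > 0 \<longrightarrow> l * r ^ CARD('n) = a \<longrightarrow>
      poisson_uniform_sample M l \<tau> X \<longrightarrow>
      (let \<Phi> = (\<lambda>\<omega>. isolated_count r (\<tau> \<omega>) (\<lambda>i. X i \<omega>));
           \<mu> = mean_measure M \<Phi>;
           W = (\<lambda>\<omega>. \<Phi> \<omega> torus - \<mu> torus);
           \<sigma>2 = prob_space.variance M W;
           \<delta> = frac (- 4 * \<sigma>2);
           t = frac (- \<mu> torus + 2 * \<sigma>2 + \<delta> / 2) / (4 * \<sigma>2 + \<delta>);
           P = distr M borel W;
           Q = centred_binomial (nat \<lceil>4 * \<sigma>2\<rceil>) (1 / 2 - t)
       in \<sigma>2 > 1 \<longrightarrow>
          d_TV P Q \<le> C1 * l powr (- 1 / 2) \<and>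
          d_loc P Q \<le> C2 * l powr (- 2 / 2))"
  \<comment> \<open>The constants are left schematic before the universal variables are fixed, so
    they cannot depend on these; unification then finds them in
    \<open>isolated_points_bounds\<close>, where they involve only \<open>a\<close> and
    \<open>CARD('n)\<close>.\<close>
  by (intro exI allI impI, unfold Let_def mean_measure_def, intro impI conjI)
    (rule isolated_points_bounds[OF assms]; assumption)+

end
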